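(* Let $\Gamma=\langle r,s,t \mid r^2, s^2, t^2, (rs)^2, (st)^j, (rt)^5\rangle$ with $j\in\{4,5\}$ act simplicially on a systolic complex $X$. For any $u\in\{r,s,t\}$ the invariance set $X_u$ is a systolic, isometrically embedded, full subcomplex of $X$, and its maximal simplices are stabilized by $u$.
   Context: A flag simplicial complex is $k$-large ($k\ge4$) if every cycle of length at least $4$ and strictly less than $k$ has a diagonal, i.e. an edge of the complex connecting two nonconsecutive vertices of the cycle. A simplicial complex is systolic if it is connected, simply connected, and all its vertex links are $6$-large. Write $x^u$ for the image of a vertex $x$ under $u$, and $a\sim b$ if the vertices $a,b$ are joined by an edge. The invariance set $X_u$ is the flag simplicial complex in $X$ spanned by those vertices $x$ of $X$ for which either $x^u=x$ or $x^u\sim x$. The distance of two vertices is the length of a shortest edge path between them; isometrically embedded means that for any two vertices of $X_u$ their distances in the $1$-skeleta of $X_u$ and of $X$ agree. A subcomplex is full if every simplex of $X$ with all its vertices in the subcomplex belongs to the subcomplex. A simplex is stabilized by $u$ if $u$ maps it to itself setwise. *)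

theory Defs
  imports "HOL-Analysis.Analysis" "HOL-Algebra.Group_Action"
begin

section \<open>Abstract simplicial complexes\<close>

text \<open>A complex is given by its set of simplices; a simplex is the nonempty finite set of its
  vertices.  Neither finiteness of the dimension nor local finiteness is required.\<close>

definition abstract_complex :: "'a set set \<Rightarrow> bool" where
  "abstract_complex K \<longleftrightarrow>
     (\<forall>\<sigma>\<in>K. finite \<sigma> \<and> \<sigma> \<noteq> {}) \<and>
     (\<forall>\<sigma>\<in>K. \<forall>\<tau>. \<tau> \<subseteq> \<sigma> \<and> \<tau> \<noteq> {} \<longrightarrow> \<tau> \<in> K)"

definition verts :: "'a set set \<Rightarrow> 'a set" where
  "verts K = \<Union>K"

definition adjacent :: "'a set set \<Rightarrow> 'a \<Rightarrow> 'a \<Rightarrow> bool" where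
  "adjacent K a b \<longleftrightarrow> a \<noteq> b \<and> {a, b} \<in> K"

definition flag_complex :: "'a set set \<Rightarrow> bool" where
  "flag_complex K \<longleftrightarrow> abstract_complex K \<and>
     (\<forall>\<sigma>. finite \<sigma> \<and> \<sigma> \<noteq> {} \<and> \<sigma> \<subseteq> verts K \<and> (\<forall>a\<in>\<sigma>. \<forall>b\<in>\<sigma>. a \<noteq> b \<longrightarrow> adjacent K a b)
        \<longrightarrow> \<sigma> \<in> K)"

definition vertex_link :: "'a set set \<Rightarrow> 'a \<Rightarrow> 'a set set" where
  "vertex_link K v = {\<tau>\<in>K. v \<notin> \<tau> \<and> insert v \<tau> \<in> K}"

definition subcomplex :: "'a set set \<Rightarrow> 'a set set \<Rightarrow> bool" where
  "subcomplex L K \<longleftrightarrow> abstract_complex L \<and> L \<subseteq> K"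

definition full_subcomplex :: "'a set set \<Rightarrow> 'a set set \<Rightarrow> bool" where
  "full_subcomplex L K \<longleftrightarrow> subcomplex L K \<and> (\<forall>\<sigma>\<in>K. \<sigma> \<subseteq> verts L \<longrightarrow> \<sigma> \<in> L)"

definition maximal_simplex :: "'a set set \<Rightarrow> 'a set \<Rightarrow> bool" where
  "maximal_simplex K \<sigma> \<longleftrightarrow> \<sigma> \<in> K \<and> (\<forall>\<tau>\<in>K. \<sigma> \<subseteq> \<tau> \<longrightarrow> \<tau> = \<sigma>)"


section \<open>Cycles and largeness\<close>

text \<open>A cycle is embedded: it is the cyclic list of its pairwise distinct vertices, so that its
  length, the number of edges, is the length of the list.\<close>

definition is_cycle :: "'a set set \<Rightarrow> 'a list \<Rightarrow> bool" where
  "is_cycle K c \<longleftrightarrow> 3 \<le> length c \<and> distinct c \<and>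
     (\<forall>i<length c. adjacent K (c ! i) (c ! (Suc i mod length c)))"

definition has_diagonal :: "'a set set \<Rightarrow> 'a list \<Rightarrow> bool" where
  "has_diagonal K c \<longleftrightarrow>
     (\<exists>i<length c. \<exists>j<length c. i \<noteq> j \<and> j \<noteq> Suc i mod length c \<and> i \<noteq> Suc j mod length c \<and>
        adjacent K (c ! i) (c ! j))"

definition large :: "nat \<Rightarrow> 'a set set \<Rightarrow> bool" where
  "large k K \<longleftrightarrow> flag_complex K \<and>
     (\<forall>c. is_cycle K c \<and> 4 \<le> length c \<and> length c < k \<longrightarrow> has_diagonal K c)"


section \<open>The geometric realization\<close>

text \<open>Points are given by their barycentric coordinates.\<close>

definition closed_simplex :: "'a set \<Rightarrow> ('a \<Rightarrow> real) set" where
  "closed_simplex \<sigma> = {\<alpha>. (\<forall>v. 0 \<le> \<alpha> v) \<and> (\<forall>v. v \<notin> \<sigma> \<longrightarrow> \<alpha> v = 0) \<and> (\<Sum>v\<in>\<sigma>. \<alpha> v) = 1}"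

definition realization_carrier :: "'a set set \<Rightarrow> ('a \<Rightarrow> real) set" where
  "realization_carrier K = (\<Union>\<sigma>\<in>K. closed_simplex \<sigma>)"

text \<open>The weak (coherent) topology.  On a single closed simplex, the product topology of the type
  \<^typ>\<open>'a \<Rightarrow> real\<close> is the Euclidean one, since only the finitely many coordinates
  in the simplex vary.\<close>

definition realization :: "'a set set \<Rightarrow> ('a \<Rightarrow> real) topology" where
  "realization K = topology (\<lambda>U. U \<subseteq> realization_carrier K \<and>
     (\<forall>\<sigma>\<in>K. openin (top_of_set (closed_simplex \<sigma>)) (U \<inter> closed_simplex \<sigma>)))"

lemma istopology_realization:
  "istopology (\<lambda>U. U \<subseteq> realization_carrier K \<and>
     (\<forall>\<sigma>\<in>K. openin (top_of_set (closed_simplex \<sigma>)) (U \<inter> closed_simplex \<sigma>)))"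
  unfolding istopology_def
proof (intro conjI allI impI)
  fix S T :: "('a \<Rightarrow> real) set"
  assume S: "S \<subseteq> realization_carrier K \<and>
      (\<forall>\<sigma>\<in>K. openin (top_of_set (closed_simplex \<sigma>)) (S \<inter> closed_simplex \<sigma>))"
    and T: "T \<subseteq> realization_carrier K \<and>
      (\<forall>\<sigma>\<in>K. openin (top_of_set (closed_simplex \<sigma>)) (T \<inter> closed_simplex \<sigma>))"
  show "S \<inter> T \<subseteq> realization_carrier K"
    using S by blast
  show "\<forall>\<sigma>\<in>K. openin (top_of_set (closed_simplex \<sigma>)) (S \<inter> T \<inter> closed_simplex \<sigma>)"
  proof
    fix \<sigma> assume "\<sigma> \<in> K"
    with S T have "openin (top_of_set (closed_simplex \<sigma>)) (S \<inter> closed_simplex \<sigma>)"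
      and "openin (top_of_set (closed_simplex \<sigma>)) (T \<inter> closed_simplex \<sigma>)"
      by blast+
    then have "openin (top_of_set (closed_simplex \<sigma>))
        ((S \<inter> closed_simplex \<sigma>) \<inter> (T \<inter> closed_simplex \<sigma>))"
      by (rule openin_Int)
    then show "openin (top_of_set (closed_simplex \<sigma>)) (S \<inter> T \<inter> closed_simplex \<sigma>)"
      by (simp add: Int_ac)
  qed
next
  fix \<U> :: "('a \<Rightarrow> real) set set"
  assume U: "\<forall>S\<in>\<U>. S \<subseteq> realization_carrier K \<and>
      (\<forall>\<sigma>\<in>K. openin (top_of_set (closed_simplex \<sigma>)) (S \<inter> closed_simplex \<sigma>))"
  show "\<Union>\<U> \<subseteq> realization_carrier K"
    using U by blast
  show "\<forall>\<sigma>\<in>K. openin (top_of_set (closed_simplex \<sigma>)) (\<Union>\<U> \<inter> closed_simplex \<sigma>)"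
  proof
    fix \<sigma> assume "\<sigma> \<in> K"
    then have "openin (top_of_set (closed_simplex \<sigma>)) (\<Union>S\<in>\<U>. S \<inter> closed_simplex \<sigma>)"
      using U by (intro openin_Union) auto
    then show "openin (top_of_set (closed_simplex \<sigma>)) (\<Union>\<U> \<inter> closed_simplex \<sigma>)"
      by (simp only: Int_Union2)
  qed
qed

lemma openin_realization:
  "openin (realization K) U \<longleftrightarrow> U \<subseteq> realization_carrier K \<and>
     (\<forall>\<sigma>\<in>K. openin (top_of_set (closed_simplex \<sigma>)) (U \<inter> closed_simplex \<sigma>))"
  unfolding realization_def by (subst topology_inverse'[OF istopology_realization]) simp

lemma topspace_realization: "topspace (realization K) = realization_carrier K"
proof
  show "topspace (realization K) \<subseteq> realization_carrier K"
    using openin_topspace openin_realization by blast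
  have "openin (realization K) (realization_carrier K)"
    unfolding openin_realization
  proof (intro conjI ballI)
    fix \<sigma> assume "\<sigma> \<in> K"
    then have "realization_carrier K \<inter> closed_simplex \<sigma> = closed_simplex \<sigma>"
      by (auto simp: realization_carrier_def)
    then show "openin (top_of_set (closed_simplex \<sigma>)) (realization_carrier K \<inter> closed_simplex \<sigma>)"
      by simp
  qed simp
  then show "realization_carrier K \<subseteq> topspace (realization K)"
    by (rule openin_subset)
qed

text \<open>This is \<^const>\<open>simply_connected\<close> with the ambient topological type replaced by
  an abstract topology: any two loops are freely homotopic, which includes path-connectedness.\<close>

definition simply_connected_top :: "'b topology \<Rightarrow> bool" where
  "simply_connected_top T \<longleftrightarrow>
     (\<forall>p q. pathin T p \<and> p 1 = p 0 \<and> pathin T q \<and> q 1 = q 0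
        \<longrightarrow> homotopic_with (\<lambda>r. r 1 = r 0) (top_of_set {0..1}) T p q)"

lemma simply_connected_top_top_of_set:
  "simply_connected_top (top_of_set S) \<longleftrightarrow> simply_connected S"
proof -
  have "pathin (top_of_set S) p \<longleftrightarrow> path p \<and> path_image p \<subseteq> S" for p
    by (auto simp: pathin_def path_def path_image_def)
  then show ?thesis
    unfolding simply_connected_top_def simply_connected_def homotopic_loops_def
      pathstart_def pathfinish_def by meson
qed

text \<open>Connected complexes are nonempty by convention.\<close>

definition systolic :: "'a set set \<Rightarrow> bool" where
  "systolic K \<longleftrightarrow> abstract_complex K \<and> K \<noteq> {} \<and>
     connected_space (realization K) \<and> simply_connected_top (realization K) \<and>
     (\<forall>v\<in>verts K. large 6 (vertex_link K v))"


section \<open>Distances\<close>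

definition edge_path :: "'a set set \<Rightarrow> 'a list \<Rightarrow> bool" where
  "edge_path K p \<longleftrightarrow> p \<noteq> [] \<and> set p \<subseteq> verts K \<and> successively (adjacent K) p"

text \<open>The value is \<^term>\<open>\<infinity>\<close> if no edge path exists.\<close>

definition edge_dist :: "'a set set \<Rightarrow> 'a \<Rightarrow> 'a \<Rightarrow> enat" where
  "edge_dist K a b = (INF p\<in>{p. edge_path K p \<and> hd p = a \<and> last p = b}. enat (length p - 1))"

definition isometrically_embedded :: "'a set set \<Rightarrow> 'a set set \<Rightarrow> bool" where
  "isometrically_embedded L K \<longleftrightarrow>
     subcomplex L K \<and> (\<forall>a\<in>verts L. \<forall>b\<in>verts L. edge_dist L a b = edge_dist K a b)"


section \<open>Group presentations\<close>

text \<open>The letter \<^term>\<open>(x, True)\<close> stands for the generator \<^term>\<open>x\<close>,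
  and \<^term>\<open>(x, False)\<close> for its inverse.\<close>

type_synonym 'g word = "('g \<times> bool) list"

inductive pres_eq :: "'g word set \<Rightarrow> 'g word \<Rightarrow> 'g word \<Rightarrow> bool" for Rels where
  pres_refl: "pres_eq Rels w w"
| pres_sym: "pres_eq Rels v w \<Longrightarrow> pres_eq Rels w v"
| pres_trans: "pres_eq Rels u v \<Longrightarrow> pres_eq Rels v w \<Longrightarrow> pres_eq Rels u w"
| pres_cancel: "pres_eq Rels (u @ [(x, b), (x, \<not> b)] @ v) (u @ v)"
| pres_rel: "w \<in> Rels \<Longrightarrow> pres_eq Rels (u @ w @ v) (u @ v)"

definition word_class :: "'g word set \<Rightarrow> 'g word \<Rightarrow> 'g word set" where
  "word_class Rels w = {v. pres_eq Rels w v}"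

definition presented_group :: "'g word set \<Rightarrow> 'g word set monoid" where
  "presented_group Rels =
     \<lparr>carrier = range (word_class Rels),
      monoid.mult = (\<lambda>A B. \<Union>a\<in>A. \<Union>b\<in>B. word_class Rels (a @ b)),
      one = word_class Rels []\<rparr>"

lemma word_class_eq_iff: "word_class Rels v = word_class Rels w \<longleftrightarrow> pres_eq Rels v w"
proof
  assume "word_class Rels v = word_class Rels w"
  moreover have "w \<in> word_class Rels w" by (simp add: word_class_def pres_refl)
  ultimately show "pres_eq Rels v w" by (simp add: word_class_def set_eq_iff)
next
  assume vw: "pres_eq Rels v w"
  have "pres_eq Rels v x \<longleftrightarrow> pres_eq Rels w x" for x
    using pres_trans[OF vw] pres_trans[OF pres_sym[OF vw]] by metis
  then show "word_class Rels v = word_class Rels w" by (simp add: word_class_def)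
qed

lemma pres_eq_context: "pres_eq Rels v w \<Longrightarrow> pres_eq Rels (a @ v @ c) (a @ w @ c)"
proof (induction rule: pres_eq.induct)
  case (pres_refl w)
  show ?case by (rule pres_eq.pres_refl)
next
  case (pres_sym v w)
  show ?case by (rule pres_eq.pres_sym[OF pres_sym.IH])
next
  case (pres_trans u v w)
  show ?case by (rule pres_eq.pres_trans[OF pres_trans.IH])
next
  case (pres_cancel u x b v)
  show ?case using pres_eq.pres_cancel[of Rels "a @ u" x b "v @ c"] by simp
next
  case (pres_rel w u v)
  then show ?case using pres_eq.pres_rel[of w Rels "a @ u" "v @ c"] by simp
qed

lemma pres_eq_append:
  assumes "pres_eq Rels v v'" "pres_eq Rels w w'"
  shows "pres_eq Rels (v @ w) (v' @ w')"
proof -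
  have "pres_eq Rels (v @ w) (v' @ w)"
    using pres_eq_context[OF assms(1), of "[]" w] by simp
  moreover have "pres_eq Rels (v' @ w) (v' @ w')"
    using pres_eq_context[OF assms(2), of v' "[]"] by simp
  ultimately show ?thesis by (rule pres_trans)
qed

lemma presented_group_mult:
  "word_class Rels v \<otimes>\<^bsub>presented_group Rels\<^esub> word_class Rels w = word_class Rels (v @ w)"
proof -
  have "word_class Rels (a @ b) = word_class Rels (v @ w)"
    if "a \<in> word_class Rels v" "b \<in> word_class Rels w" for a b
  proof -
    have "pres_eq Rels (v @ w) (a @ b)"
      using that by (intro pres_eq_append) (simp_all add: word_class_def)
    then show ?thesis by (metis word_class_eq_iff)
  qed
  moreover have "v \<in> word_class Rels v" "w \<in> word_class Rels w"
    by (simp_all add: word_class_def pres_refl)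
  ultimately have "(\<Union>a\<in>word_class Rels v. \<Union>b\<in>word_class Rels w. word_class Rels (a @ b)) =
      word_class Rels (v @ w)"
    by blast
  then show ?thesis by (simp add: presented_group_def)
qed

lemma pres_eq_inverse: "pres_eq Rels (map (\<lambda>(x, b). (x, \<not> b)) (rev w) @ w) []"
proof (induction w)
  case Nil
  show ?case by (simp add: pres_refl)
next
  case (Cons a w)
  obtain x b where a: "a = (x, b)" by force
  have "pres_eq Rels (map (\<lambda>(x, b). (x, \<not> b)) (rev w) @ [(x, \<not> b), (x, \<not> \<not> b)] @ w)
      (map (\<lambda>(x, b). (x, \<not> b)) (rev w) @ w)"
    by (rule pres_cancel)
  from pres_trans[OF this Cons.IH] show ?case by (simp add: a)
qed

lemma group_presented_group: "group (presented_group Rels)"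
proof (rule groupI)
  fix A assume "A \<in> carrier (presented_group Rels)"
  then obtain w where w: "A = word_class Rels w" by (auto simp: presented_group_def)
  let ?B = "word_class Rels (map (\<lambda>(x, b). (x, \<not> b)) (rev w))"
  have "?B \<in> carrier (presented_group Rels)" by (simp add: presented_group_def)
  moreover have "?B \<otimes>\<^bsub>presented_group Rels\<^esub> A = \<one>\<^bsub>presented_group Rels\<^esub>"
    unfolding w presented_group_mult by (simp add: presented_group_def word_class_eq_iff pres_eq_inverse)
  ultimately show "\<exists>B\<in>carrier (presented_group Rels).
      B \<otimes>\<^bsub>presented_group Rels\<^esub> A = \<one>\<^bsub>presented_group Rels\<^esub>" by blast
next
  have one: "\<one>\<^bsub>presented_group Rels\<^esub> = word_class Rels []"
    and car: "carrier (presented_group Rels) = range (word_class Rels)"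
    by (simp_all add: presented_group_def)
  show "\<one>\<^bsub>presented_group Rels\<^esub> \<in> carrier (presented_group Rels)"
    by (simp add: one car)
  show "A \<otimes>\<^bsub>presented_group Rels\<^esub> B \<in> carrier (presented_group Rels)"
    if "A \<in> carrier (presented_group Rels)" "B \<in> carrier (presented_group Rels)" for A B
    using that by (auto simp: car presented_group_mult)
  show "A \<otimes>\<^bsub>presented_group Rels\<^esub> B \<otimes>\<^bsub>presented_group Rels\<^esub> C =
      A \<otimes>\<^bsub>presented_group Rels\<^esub> (B \<otimes>\<^bsub>presented_group Rels\<^esub> C)"
    if "A \<in> carrier (presented_group Rels)" "B \<in> carrier (presented_group Rels)"
      "C \<in> carrier (presented_group Rels)" for A B C
    using that by (auto simp: car presented_group_mult)
  show "\<one>\<^bsub>presented_group Rels\<^esub> \<otimes>\<^bsub>presented_group Rels\<^esub> A = A"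
    if "A \<in> carrier (presented_group Rels)" for A
    using that by (auto simp: car one presented_group_mult)
qed

datatype gen = Gen_r | Gen_s | Gen_t

definition word_power :: "'g word \<Rightarrow> nat \<Rightarrow> 'g word" where
  "word_power w n = concat (replicate n w)"

definition triangle_relators :: "nat \<Rightarrow> gen word set" where
  "triangle_relators j =
     (let r = (Gen_r, True); s = (Gen_s, True); t = (Gen_t, True) in
      {word_power [r] 2, word_power [s] 2, word_power [t] 2,
       word_power [r, s] 2, word_power [s, t] j, word_power [r, t] 5})"

definition triangle_group :: "nat \<Rightarrow> gen word set monoid" where
  "triangle_group j = presented_group (triangle_relators j)"

definition triangle_gen :: "nat \<Rightarrow> gen \<Rightarrow> gen word set" where
  "triangle_gen j x = word_class (triangle_relators j) [(x, True)]"


section \<open>Simplicial actions and invariance sets\<close>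

text \<open>The image of the vertex \<^term>\<open>x\<close> under \<^term>\<open>g\<close> is
  \<^term>\<open>\<phi> g x\<close>.
  Actions are left actions; a right action becomes one by passing to inverses, which does not change
  the maps given by the generators of the triangle group, as these are involutions.\<close>

definition simplicial_action :: "('g, 'm) monoid_scheme \<Rightarrow> 'a set set \<Rightarrow> ('g \<Rightarrow> 'a \<Rightarrow> 'a) \<Rightarrow> bool" where
  "simplicial_action G K \<phi> \<longleftrightarrow>
     group_action G (verts K) \<phi> \<and> (\<forall>g\<in>carrier G. \<forall>\<sigma>\<in>K. \<phi> g ` \<sigma> \<in> K)"

definition invariance_verts :: "'a set set \<Rightarrow> ('g \<Rightarrow> 'a \<Rightarrow> 'a) \<Rightarrow> 'g \<Rightarrow> 'a set" where
  "invariance_verts K \<phi> u = {x\<in>verts K. \<phi> u x = x \<or> adjacent K (\<phi> u x) x}"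

text \<open>The flag complex spanned by these vertices: its simplices are all finite sets of them that are
  pairwise adjacent in the ambient complex.  That they are simplices of the ambient complex is not
  part of the definition.\<close>

definition invariance_set :: "'a set set \<Rightarrow> ('g \<Rightarrow> 'a \<Rightarrow> 'a) \<Rightarrow> 'g \<Rightarrow> 'a set set" where
  "invariance_set K \<phi> u =
     {\<sigma>. finite \<sigma> \<and> \<sigma> \<noteq> {} \<and> \<sigma> \<subseteq> invariance_verts K \<phi> u \<and>
         (\<forall>a\<in>\<sigma>. \<forall>b\<in>\<sigma>. a \<noteq> b \<longrightarrow> adjacent K a b)}"

end

theory Submission
  imports Defs
begin

text \<open>A graph is weakly bridged if, seen from any vertex \<open>y\<close>, adjacent vertices at equal distance
  from \<open>y\<close> have a common neighbour closer to \<open>y\<close>, and the neighbours of a vertex that are closer to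
  \<open>y\<close> are pairwise adjacent.  The 1-skeleton of a systolic complex \<open>X\<close> is weakly bridged: starting from \<open>y\<close>,
  a cover with these two properties is built sphere by sphere, where 6-largeness of the links is what
  makes the identifications on each new sphere transitive; simple connectivity, used through
  simplicial approximations of homotopies, shows that this cover is \<open>X\<close> itself.

  Let \<open>u\<close> be the involution.  If \<open>x\<close>, \<open>y\<close> are in the invariance set, the vertices \<open>x\<close>, \<open>x\<^sup>u\<close> (for two
  adjacent vertices: they and their images) form a clique \<open>\<sigma>\<close>, and among the common neighbours of \<open>\<sigma>\<close>
  that are closer to \<open>y\<close> one lies in the invariance set.  Hence the invariance set is
  isometrically embedded and its graph is again weakly bridged.  Finally, a flag complex with weakly
  bridged graph is simply connected, since loops can be pushed towards a base vertex.\<close>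

section \<open>Distances in graphs\<close>

text \<open>The definition of \<open>systolic\<close> does not ask that \<open>X\<close> be flag, so
  three pairwise adjacent vertices need not span a simplex. Filled triangles are therefore kept
  apart from adjacency until the conditions on distances are known; seen from one corner of a
  3-cycle, the first condition returns that very corner and so fills the cycle, and flagness then
  follows from the links.

  The bound 6 has its origin in a cycle of length at most 5: if two pairs \<open>(a, z)\<close> and
  \<open>(c, z)\<close> are identified with \<open>(b, z)\<close>, then \<open>z\<close>,
  \<open>a\<close>, \<open>c\<close> and the predecessors that \<open>b\<close> shares with
  \<open>a\<close> and with \<open>c\<close> form such a cycle in the link of \<open>b\<close>, and
  diagonals from \<open>z\<close> to the predecessors are impossible.

  The obstacle in the descent towards \<open>y\<close> is that the image of a vertex closer to
  \<open>y\<close> is only known to be closer to the image of \<open>y\<close>. A vertex closer to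
  both has to be found.

  On the topological side the complex may be locally infinite. Passing from continuous to simplicial
  maps rests on open stars and Lebesgue numbers, and passing back on straight lines inside finitely
  many simplices.\<close>

definition gdist :: "('a \<Rightarrow> 'a \<Rightarrow> bool) \<Rightarrow> 'a \<Rightarrow> 'a \<Rightarrow> nat" where
  "gdist A a b = (LEAST n. (A ^^ n) a b)"

lemma relpowp_sym:
  assumes "\<And>a b. A a b \<Longrightarrow> A b a" and "(A ^^ n) a b"
  shows "(A ^^ n) b a"
  using assms(2)
proof (induction n arbitrary: b)
  case (Suc n)
  then obtain c where "(A ^^ n) a c" "A c b" by auto
  then show ?case using Suc.IH assms(1) by (metis relpowp_Suc_I2)
qed auto

lemma relpowp_concat: "(A ^^ m) a b \<Longrightarrow> (A ^^ n) b c \<Longrightarrow> (A ^^ (m + n)) a c"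
  by (auto simp: relpowp_add)

locale connected_graph =
  fixes V :: "'a set" and A :: "'a \<Rightarrow> 'a \<Rightarrow> bool"
  assumes adj_sym: "A a b \<Longrightarrow> A b a"
    and adj_irrefl: "\<not> A a a"
    and adj_V: "A a b \<Longrightarrow> a \<in> V"
    and conn: "a \<in> V \<Longrightarrow> b \<in> V \<Longrightarrow> \<exists>n. (A ^^ n) a b"
begin

abbreviation d where "d \<equiv> gdist A"

lemma adj_V2: "A a b \<Longrightarrow> b \<in> V"
  using adj_sym adj_V by blast

lemma d_relpowp: "a \<in> V \<Longrightarrow> b \<in> V \<Longrightarrow> (A ^^ d a b) a b"
  unfolding gdist_def using conn by (metis LeastI)

lemma d_le: "(A ^^ n) a b \<Longrightarrow> d a b \<le> n"
  unfolding gdist_def by (rule Least_le)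

lemma d_sym: "a \<in> V \<Longrightarrow> b \<in> V \<Longrightarrow> d a b = d b a"
  by (meson adj_sym d_le d_relpowp le_antisym relpowp_sym)

lemma d_self [simp]: "d a a = 0"
  using d_le[of 0 a a] by simp

lemma d_0: "a \<in> V \<Longrightarrow> b \<in> V \<Longrightarrow> d a b = 0 \<longleftrightarrow> a = b"
  using d_relpowp[of a b] by auto

lemma d_triangle: "a \<in> V \<Longrightarrow> b \<in> V \<Longrightarrow> c \<in> V \<Longrightarrow> d a c \<le> d a b + d b c"
  by (meson d_le d_relpowp relpowp_concat)

lemma d_adj: "A a b \<Longrightarrow> d a b = 1"
proof -
  assume ab: "A a b"
  then have "d a b \<le> 1" using d_le[of 1 a b] by (simp add: OO_def)
  moreover have "d a b \<noteq> 0" using ab d_0 adj_V adj_V2 adj_irrefl by metis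
  ultimately show ?thesis by simp
qed

lemma d_1: "a \<in> V \<Longrightarrow> b \<in> V \<Longrightarrow> d a b = 1 \<longleftrightarrow> A a b"
  using d_relpowp[of a b] d_adj by force

lemma d_le_1: "a \<in> V \<Longrightarrow> b \<in> V \<Longrightarrow> d a b \<le> 1 \<longleftrightarrow> a = b \<or> A a b"
  using d_0[of a b] d_1[of a b] by linarith

lemma d_adj_le: "A a b \<Longrightarrow> y \<in> V \<Longrightarrow> d a y \<le> Suc (d b y)"
  using d_triangle[of a b y] d_adj adj_V adj_V2 by force

lemma d_Suc:
  assumes "a \<in> V" "b \<in> V" "d a b = Suc n"
  obtains c where "A a c" "d c b = n"
proof -
  obtain c where c: "A a c" "(A ^^ n) c b"
    using d_relpowp[OF assms(1,2)] assms(3) by (metis relpowp_Suc_D2)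
  then have "d c b \<le> n" using d_le by blast
  moreover have "Suc n \<le> Suc (d c b)" using d_adj_le[OF c(1) assms(2)] assms(3) by simp
  ultimately show ?thesis using c that by auto
qed

lemma d_nbr_cases: "A a b \<Longrightarrow> y \<in> V \<Longrightarrow> d a y \<le> Suc (d b y) \<and> d b y \<le> Suc (d a y)"
  using d_adj_le adj_sym by blast

end

section \<open>The geodesic cover\<close>

text \<open>\<open>T a b c\<close> says that the 3-cycle \<open>a, b, c\<close> bounds a simplex,
  and \<open>T v a b\<close> is read as an edge from \<open>a\<close> to \<open>b\<close> in the
  link of \<open>v\<close>. The last three axioms are flagness of links for 3-cycles and diagonals
  for cycles of lengths 4 and 5.\<close>

locale six_large_links =
  fixes A :: "'a \<Rightarrow> 'a \<Rightarrow> bool" and T :: "'a \<Rightarrow> 'a \<Rightarrow> 'a \<Rightarrow> bool"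
  assumes A_sym: "A a b \<Longrightarrow> A b a"
    and A_irrefl: "\<not> A a a"
    and T_swap: "T a b c \<Longrightarrow> T b a c"
    and T_rot: "T a b c \<Longrightarrow> T b c a"
    and T_A: "T a b c \<Longrightarrow> A a b"
    and link_flag: "T v a b \<Longrightarrow> T v b c \<Longrightarrow> T v a c \<Longrightarrow> T a b c"
    and link_C4: "T v a b \<Longrightarrow> T v b c \<Longrightarrow> T v c d \<Longrightarrow> T v d a \<Longrightarrow> a \<noteq> c \<Longrightarrow> b \<noteq> d
      \<Longrightarrow> T v a c \<or> T v b d"
    and link_C5: "T v a b \<Longrightarrow> T v b c \<Longrightarrow> T v c d \<Longrightarrow> T v d e \<Longrightarrow> T v e a
      \<Longrightarrow> distinct [a, b, c, d, e]
      \<Longrightarrow> T v a c \<or> T v a d \<or> T v b d \<or> T v b e \<or> T v c e"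
begin

lemma T_neq: "T a b c \<Longrightarrow> a \<noteq> b \<and> a \<noteq> c \<and> b \<noteq> c"
  using T_A T_rot A_irrefl by metis

text \<open>The vertices of the cover are lists: the head is the projection, and the length exceeds the
  distance from the base vertex by one.\<close>

definition ball_cover :: "'a \<Rightarrow> nat \<Rightarrow> 'a list set \<Rightarrow> ('a list \<Rightarrow> 'a list \<Rightarrow> bool) \<Rightarrow> bool" where
  "ball_cover v n M E \<longleftrightarrow>
     [v] \<in> M \<and> (\<forall>m\<in>M. 1 \<le> length m \<and> length m \<le> n \<and> (length m = 1 \<longrightarrow> m = [v])) \<and>
     (\<forall>a b. E a b \<longrightarrow> a \<in> M \<and> b \<in> M \<and> E b a \<and> A (hd a) (hd b) \<and> length a \<le> Suc (length b)) \<and>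
     (\<forall>m a b. E m a \<and> E m b \<and> hd a = hd b \<longrightarrow> a = b) \<and>
     (\<forall>m\<in>M. \<forall>z. length m < n \<and> A (hd m) z \<longrightarrow> (\<exists>m'. E m m' \<and> hd m' = z)) \<and>
     (\<forall>m a b. E m a \<and> E m b \<and> T (hd m) (hd a) (hd b) \<longrightarrow> E a b) \<and>
     (\<forall>a b. E a b \<and> length a = length b \<longrightarrow>
        (\<exists>c. E c a \<and> E c b \<and> Suc (length c) = length a \<and> T (hd c) (hd a) (hd b))) \<and>
     (\<forall>m a b. E m a \<and> E m b \<and> Suc (length a) = length m \<and> Suc (length b) = length m \<longrightarrow>
        a = b \<or> E a b \<and> T (hd m) (hd a) (hd b)) \<and>
     (\<forall>m\<in>M. 1 < length m \<longrightarrow> (\<exists>c. E m c \<and> Suc (length c) = length m))"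

lemma ball_coverD:
  assumes "ball_cover v n M E"
  shows "[v] \<in> M"
    and "\<And>m. m \<in> M \<Longrightarrow> 1 \<le> length m \<and> length m \<le> n \<and> (length m = 1 \<longrightarrow> m = [v])"
    and "\<And>a b. E a b \<Longrightarrow> a \<in> M \<and> b \<in> M \<and> E b a \<and> A (hd a) (hd b) \<and> length a \<le> Suc (length b)"
    and "\<And>m a b. E m a \<Longrightarrow> E m b \<Longrightarrow> hd a = hd b \<Longrightarrow> a = b"
    and "\<And>m z. m \<in> M \<Longrightarrow> length m < n \<Longrightarrow> A (hd m) z \<Longrightarrow> \<exists>m'. E m m' \<and> hd m' = z"
    and "\<And>m a b. E m a \<Longrightarrow> E m b \<Longrightarrow> T (hd m) (hd a) (hd b) \<Longrightarrow> E a b"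
    and "\<And>a b. E a b \<Longrightarrow> length a = length b \<Longrightarrow>
        \<exists>c. E c a \<and> E c b \<and> Suc (length c) = length a \<and> T (hd c) (hd a) (hd b)"
    and "\<And>m a b. E m a \<Longrightarrow> E m b \<Longrightarrow> Suc (length a) = length m \<Longrightarrow> Suc (length b) = length m \<Longrightarrow>
        a = b \<or> E a b \<and> T (hd m) (hd a) (hd b)"
    and "\<And>m. m \<in> M \<Longrightarrow> 1 < length m \<Longrightarrow> \<exists>c. E m c \<and> Suc (length c) = length m"
  using assms unfolding ball_cover_def by blast+

lemma ball_cover_1: "ball_cover v 1 {[v]} (\<lambda>_ _. False)"
  by (simp add: ball_cover_def)

text \<open>The vertices of the next sphere are represented by pairs (m, z), where m is in the outermost sphere
  and z is a neighbour of its projection that is not yet the projection of a neighbour of m; two pairs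
  (m, z) and (m', z) are identified if m and m' are adjacent and span a triangle with z.  The link
  conditions enter in the transitivity of this identification and in the lifting of
  triangles in the new sphere.\<close>

lemma ball_cover_step:
  assumes "ball_cover v n M E" and "1 \<le> n"
  shows "\<exists>M' E'. ball_cover v (Suc n) M' E' \<and> M = {m\<in>M'. length m \<le> n} \<and>
    (\<forall>a b. E a b \<longleftrightarrow> E' a b \<and> length a \<le> n \<and> length b \<le> n)"
proof -
  note root = ball_coverD(1)[OF assms(1)] and len = ball_coverD(2)[OF assms(1)]
    and E = ball_coverD(3)[OF assms(1)] and inj = ball_coverD(4)[OF assms(1)]
    and compl = ball_coverD(5)[OF assms(1)] and tri = ball_coverD(6)[OF assms(1)]
    and TC = ball_coverD(7)[OF assms(1)] and IC = ball_coverD(8)[OF assms(1)]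
    and down = ball_coverD(9)[OF assms(1)]
  define Z where "Z m z \<longleftrightarrow> m \<in> M \<and> length m = n \<and> A (hd m) z \<and> (\<forall>m'. E m m' \<longrightarrow> hd m' \<noteq> z)" for m z
  define R where "R z m m' \<longleftrightarrow> Z m z \<and> Z m' z \<and> (m = m' \<or> E m m' \<and> T (hd m) (hd m') z)" for z m m'
  have ZM: "m \<in> M" "length m = n" "A (hd m) z" if "Z m z" for m z
    using that by (auto simp: Z_def)
  have Zno: "\<not> E m m'" if "Z m (hd m')" for m m'
    using that by (auto simp: Z_def)
  \<comment> \<open>Inside the ball all neighbours lift: \<open>z\<close> would lift to a neighbour
    of \<open>p\<close>, which by \<open>tri\<close> is a neighbour of \<open>m\<close>, and then
    \<open>z\<close> would not be new at \<open>m\<close>.\<close>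
  have EZ: "\<not> T (hd m) z (hd p)" if "Z m z" "E m p" "length p < n" for m z p
  proof
    assume t: "T (hd m) z (hd p)"
    then have "A (hd p) z" by (meson T_A T_rot T_swap)
    with compl that E obtain y where y: "E p y" "hd y = z" by metis
    have "E m y" using tri[of p m y] y that E t by (metis T_rot T_swap)
    then show False using Zno y that by metis
  qed
  \<comment> \<open>The pair \<open>(m', z)\<close> is new too, since a neighbour of
    \<open>m'\<close> over \<open>z\<close> would by \<open>tri\<close> be a neighbour of
    \<open>m\<close>.\<close>
  have Rext: "R z m m'" if "Z m z" "E m m'" "T (hd m) (hd m') z" "length m' = n" for m m' z
  proof -
    have "Z m' z" unfolding Z_def
    proof (intro conjI allI impI)
      show "m' \<in> M" using that E by blast
      show "A (hd m') z" using that T_A T_rot by metis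
      show "length m' = n" by fact
      fix y assume y: "E m' y"
      show "hd y \<noteq> z"
      proof
        assume "hd y = z"
        then have "E m y" using tri[of m' m y] y that E T_swap by metis
        then show False using that Zno \<open>hd y = z\<close> by metis
      qed
    qed
    then show ?thesis using that by (simp add: R_def)
  qed
  have Rrefl: "R z m m" if "Z m z" for m z using that by (simp add: R_def)
  have Rsym: "R z m' m" if "R z m m'" for m m' z using that E T_swap by (auto simp: R_def)
  have Rtrans: "R z a c" if ab: "R z a b" and bc: "R z b c" for a b c z
  proof (cases "a = b \<or> b = c \<or> a = c")
    case True
    then show ?thesis using that by (auto simp: R_def)
  next
    case False
    have ab': "E b a" "T (hd b) (hd a) z" and bc': "E b c" "T (hd b) (hd c) z"
      and Zs: "Z a z" "Z b z" "Z c z"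
      using False that E T_swap by (auto simp: R_def)
    \<comment> \<open>In the link of \<open>hd b\<close>, the vertices
      \<open>z, hd a, hd p, hd q, hd c\<close> form a 5-cycle, or a 4-cycle if \<open>p = q\<close>.
      By \<open>EZ\<close>, \<open>z\<close> is not joined to \<open>hd p\<close> or
      \<open>hd q\<close>. A diagonal from \<open>hd a\<close> to \<open>hd q\<close>, or from
      \<open>hd p\<close> to \<open>hd c\<close>, cuts off a 4-cycle through \<open>z\<close> whose
      only possible diagonal is the desired edge (\<open>four\<close>).\<close>
    have "T (hd b) (hd a) (hd c)"
    proof -
      obtain p where p: "E p a" "E p b" "Suc (length p) = n" "T (hd p) (hd a) (hd b)"
        using TC[of a b] Zs ZM ab' E by metis
      obtain q where q: "E q c" "E q b" "Suc (length q) = n" "T (hd q) (hd c) (hd b)"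
        using TC[of c b] Zs ZM bc' E by metis
      have zs: "z \<noteq> hd a" "z \<noteq> hd c" "z \<noteq> hd p" "z \<noteq> hd q" "hd a \<noteq> hd c"
        using Zno Zs ab' bc' p q E False inj by metis+
      have noz: "\<not> T (hd b) z (hd p)" "\<not> T (hd b) z (hd q)"
        using EZ Zs p q E by (metis lessI)+
      have four: "T (hd b) (hd a) (hd c)" if "E b w" "T (hd b) (hd a) (hd w)" "T (hd b) (hd w) (hd c)"
          "\<not> T (hd b) z (hd w)" for w
        using link_C4[of "hd b" z "hd a" "hd w" "hd c"] that ab' bc' zs T_swap T_rot Zno Zs by metis
      have pq: "p = q \<or> E p q \<and> T (hd b) (hd p) (hd q)"
        using IC[of b p q] p q E Zs ZM by metis
      have Tap: "T (hd b) (hd a) (hd p)" and Tqc: "T (hd b) (hd q) (hd c)" using p q T_swap T_rot by metis+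
      show ?thesis
      proof (cases "p = q")
        case True
        then show ?thesis using four[of p] p q E noz Tap Tqc by blast
      next
        case False
        then have pq': "T (hd b) (hd p) (hd q)" "E p q" using pq by auto
        have "length a = n" "length c = n" using Zs ZM by auto
        then have "a \<noteq> p" "a \<noteq> q" "c \<noteq> p" "c \<noteq> q" using p q by auto
        then have "distinct [z, hd a, hd p, hd q, hd c]"
          using zs False inj[of b] ab' bc' p q E by (auto; metis)
        moreover have "T (hd b) z (hd a)" "T (hd b) (hd c) z"
          using ab' bc' T_swap T_rot by metis+
        ultimately consider "T (hd b) (hd a) (hd q)" | "T (hd b) (hd a) (hd c)" | "T (hd b) (hd p) (hd c)"
          using link_C5[of "hd b" z "hd a" "hd p" "hd q" "hd c"] pq' Tap Tqc noz by blast
        then show ?thesis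
          using four[of p] four[of q] p q E noz Tap Tqc by cases blast+
      qed
    qed
    moreover from this have "E a c" using tri[of b a c] ab' bc' by blast
    moreover have "T (hd a) (hd c) z"
      using link_flag[of "hd b" "hd a" "hd c" z] calculation(1) ab' bc' by blast
    ultimately show ?thesis using Zs by (simp add: R_def)
  qed
  \<comment> \<open>A class of pairs becomes a list of length \<open>Suc n\<close>: the projection
    \<open>z\<close>, then a chosen representative. The choice depends only on the predicate
    \<open>R z m\<close>, which equivalent pairs share.\<close>
  define nv where "nv m z = z # (SOME m'. R z m m')" for m z
  have nvR: "R z m (tl (nv m z))" if "Z m z" for m z
    unfolding nv_def using someI[of "R z m" m] Rrefl that by simp
  have hd_nv [simp]: "hd (nv m z) = z" for m z by (simp add: nv_def)
  have len_nv: "length (nv m z) = Suc n" if "Z m z" for m z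
  proof -
    have "length (tl (nv m z)) = n" using nvR[OF that] ZM unfolding R_def by blast
    then show ?thesis by (simp add: nv_def)
  qed
  have nv_eq: "nv m z = nv m' z \<longleftrightarrow> R z m m'" if "Z m z" "Z m' z" for m m' z
  proof
    assume "nv m z = nv m' z"
    then show "R z m m'" using nvR[OF that(1)] nvR[OF that(2)] Rsym Rtrans by metis
  next
    assume r: "R z m m'"
    have "R z m = R z m'"
    proof
      show "R z m x = R z m' x" for x using r Rsym Rtrans by blast
    qed
    then show "nv m z = nv m' z" by (simp add: nv_def)
  qed
  define N where "N = {nv m z |m z. Z m z}"
  have N: "\<exists>m. Z m (hd a) \<and> a = nv m (hd a)" if "a \<in> N" for a
    using that unfolding N_def by auto
  have lenN: "length a = Suc n" if "a \<in> N" for a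
    using N[OF that] len_nv by metis
  have NM: "a \<notin> M" if "a \<in> N" for a using lenN[OF that] len by fastforce
  \<comment> \<open>New vertices are joined only over a common representative \<open>m\<close> that
    spans a triangle with them. The triangle condition on the new sphere then holds by construction,
    and the work lies in the lifting of triangles.\<close>
  define E' where "E' a b \<longleftrightarrow> E a b \<or> Z a (hd b) \<and> b = nv a (hd b) \<or> Z b (hd a) \<and> a = nv b (hd a) \<or>
      (\<exists>m. Z m (hd a) \<and> Z m (hd b) \<and> T (hd m) (hd a) (hd b) \<and> a = nv m (hd a) \<and> b = nv m (hd b))" for a b
  have nvN: "nv m z \<in> N" if "Z m z" for m z using that by (auto simp: N_def)
  have E'_sym: "E' b a" if "E' a b" for a b
    using that E unfolding E'_def by (metis T_rot T_swap)
  have eMM: "E' a b \<longleftrightarrow> E a b" if "a \<in> M" "b \<in> M" for a b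
    using that unfolding E'_def using nvN NM by metis
  have eMN: "E' a b \<longleftrightarrow> Z a (hd b) \<and> b = nv a (hd b)" if "a \<in> M" "b \<in> N" for a b
    using that unfolding E'_def using nvN NM E ZM by metis
  have eNN: "E' a b \<longleftrightarrow> (\<exists>m. Z m (hd a) \<and> Z m (hd b) \<and> T (hd m) (hd a) (hd b) \<and> a = nv m (hd a) \<and> b = nv m (hd b))"
    if "a \<in> N" "b \<in> N" for a b
    using NM[OF that(1)] NM[OF that(2)] E[of a b] ZM(1)[of a] ZM(1)[of b] unfolding E'_def by blast
  have eM: "a \<in> M \<union> N \<and> b \<in> M \<union> N" if "E' a b" for a b
    using that unfolding E'_def using nvN E ZM by (metis UnCI)
  have R_of: "R (hd x) a b" if "Z a (hd x)" "x = nv a (hd x)" "Z b (hd x)" "x = nv b (hd x)" for x a b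
    using that nv_eq by metis
  have E'A: "A (hd a) (hd b)" if "E' a b" for a b
    using that unfolding E'_def using E ZM T_A T_rot A_sym by metis
  have adjR: "E' b x" if "Z a (hd x)" "x = nv a (hd x)" "R (hd x) a b" for x a b
    using that nv_eq[of a "hd x" b] unfolding E'_def R_def by metis

  have inj': "a = b" if ab: "E' m a" "E' m b" "hd a = hd b" for m a b
  proof -
    have *: False if mem: "a \<in> M" "b \<in> N" "m \<in> N" and "E' m a" and mb: "E' m b" and "hd a = hd b" for a b
    proof -
      obtain k where k: "Z k (hd m)" "Z k (hd b)" "T (hd k) (hd m) (hd b)" "m = nv k (hd m)" "b = nv k (hd b)"
        using mem mb eNN by blast
      have "Z a (hd m)" "m = nv a (hd m)" using that eMN E'_sym by metis+
      then have "R (hd m) k a" using R_of k by metis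
      then show False using k that Zno T_neq unfolding R_def by metis
    qed
    have **: "a = b" if N: "m \<in> N" "a \<in> N" "b \<in> N"
    proof -
      obtain k where k: "Z k (hd m)" "Z k (hd a)" "T (hd k) (hd m) (hd a)" "m = nv k (hd m)" "a = nv k (hd a)"
        using ab N eNN by blast
      obtain l where l: "Z l (hd m)" "Z l (hd b)" "T (hd l) (hd m) (hd b)" "m = nv l (hd m)" "b = nv l (hd b)"
        using ab N eNN by blast
      have r: "R (hd m) k l" using R_of k l by metis
      show ?thesis
      proof (cases "k = l")
        case True
        then show ?thesis using k l ab by metis
      next
        case False
        then have kl: "E k l" "T (hd k) (hd l) (hd m)" using r by (auto simp: R_def)
        \<comment> \<open>The representatives \<open>k\<close> and \<open>l\<close> of
          \<open>m\<close> are adjacent to each other and to \<open>hd a\<close> in the link of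
          \<open>hd m\<close>; flagness there lets them be identified over \<open>hd a\<close> as
          well.\<close>
        have "T (hd k) (hd l) (hd a)"
          using link_flag[of "hd m" "hd k" "hd l" "hd a"] kl k l ab T_rot T_swap by metis
        then have "R (hd a) k l" using Rext k l kl ZM by metis
        then show ?thesis using nv_eq k l ab by metis
      qed
    qed
    have ***: "a = b" if "m \<in> N" "a \<in> M" "b \<in> M"
    proof -
      have "R (hd m) a b" using that ab eMN E'_sym R_of by metis
      then show ?thesis using ab E A_irrefl unfolding R_def by metis
    qed
    show ?thesis
    proof (cases "m \<in> N")
      case True
      then show ?thesis using * ** *** ab eM by (metis UnE)
    next
      case False
      then have m: "m \<in> M" using eM ab by blast
      then show ?thesis using ab eM[OF ab(1)] eM[OF ab(2)] eMM eMN inj Zno by (metis UnE)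
    qed
  qed

  have triMMN: "E' a x" if "m \<in> M" "a \<in> M" "x \<in> N" "E' m a" "E' m x" "T (hd m) (hd a) (hd x)" for m a x
  proof -
    have Zm: "Z m (hd x)" "x = nv m (hd x)" and ma: "E m a" using that eMN eMM by auto
    have "\<not> length a < n" using EZ[of m "hd x" a] Zm ma that T_rot T_swap by metis
    then have "length a = n" using len that by force
    then have "R (hd x) m a" using Rext Zm ma that by metis
    then show ?thesis using adjR Zm by metis
  qed
  have triMNN: "E' x y" if "m \<in> M" "x \<in> N" "y \<in> N" "E' m x" "E' m y" "T (hd m) (hd x) (hd y)" for m x y
    using that eMN eNN by metis
  have triNMM: "E a b \<and> T (hd x) (hd a) (hd b) \<or> a = b" if "a \<in> M" "b \<in> M" "x \<in> N" "E' x a" "E' x b" for a b x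
  proof -
    have "R (hd x) a b" using that eMN E'_sym R_of by metis
    then show ?thesis unfolding R_def by (metis T_rot)
  qed
  have triNMN: "E' a y" if mem: "x \<in> N" "a \<in> M" "y \<in> N" and "E' x a" and xy: "E' x y" and "T (hd x) (hd a) (hd y)" for x a y
  proof -
    obtain k where k: "Z k (hd x)" "Z k (hd y)" "T (hd k) (hd x) (hd y)" "x = nv k (hd x)" "y = nv k (hd y)"
      using mem xy eNN by blast
    have Za: "Z a (hd x)" "x = nv a (hd x)" using that eMN E'_sym by metis+
    have xk: "E' k x" "E' k y" using k by (auto simp: E'_def)
    show ?thesis
    proof (cases "a = k")
      case True
      then show ?thesis using xk by blast
    next
      case False
      then have ak: "E k a" "T (hd k) (hd a) (hd x)"
        using R_of[OF k(1) k(4) Za] by (auto simp: R_def)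
      have "T (hd k) (hd a) (hd y)"
        using link_flag[of "hd x" "hd k" "hd a" "hd y"] ak k that T_rot T_swap by metis
      then show ?thesis using triMMN[of k a y] that xk ak E eMM by blast
    qed
  qed
  have triNNN: "E' y w" if xyw: "x \<in> N" "y \<in> N" "w \<in> N" "E' x y" "E' x w" "T (hd x) (hd y) (hd w)" for x y w
  proof -
    have diag: "E' y w" if "y \<in> N" "w \<in> N" "E' k x" "E' k y" "k \<in> M" "T (hd k) (hd x) (hd y)" "E' x w" "T (hd x) (hd y) (hd w)"
      "T (hd x) (hd k) (hd w)" for k y w
    proof -
      have "E' k w" using triNMN[of x k w] that xyw E'_sym by blast
      moreover have "T (hd k) (hd y) (hd w)"
        using link_flag[of "hd x" "hd k" "hd y" "hd w"] that T_rot T_swap by metis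
      ultimately show ?thesis using triMNN[of k y w] that by blast
    qed
    obtain k where k: "Z k (hd x)" "Z k (hd y)" "T (hd k) (hd x) (hd y)" "x = nv k (hd x)" "y = nv k (hd y)"
      using xyw eNN by blast
    obtain l where l: "Z l (hd x)" "Z l (hd w)" "T (hd l) (hd x) (hd w)" "x = nv l (hd x)" "w = nv l (hd w)"
      using xyw eNN by blast
    have xk: "E' k x" "E' k y" "k \<in> M" and xl: "E' l x" "E' l w" "l \<in> M" using k l ZM by (auto simp: E'_def)
    \<comment> \<open>If \<open>k\<close> and \<open>l\<close> differ, the link of
      \<open>hd x\<close> contains the 4-cycle \<open>hd k, hd y, hd w, hd l\<close>; either
      diagonal brings one representative next to both \<open>y\<close> and \<open>w\<close>.\<close>
    consider "T (hd x) (hd k) (hd w)" | "T (hd x) (hd l) (hd y)"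
    proof (cases "k = l")
      case True
      then show ?thesis using that l T_rot T_swap by metis
    next
      case False
      then have "T (hd k) (hd l) (hd x)" "E k l"
        using R_of[OF k(1) k(4) l(1) l(4)] by (auto simp: R_def)
      moreover have "T (hd x) (hd k) (hd w) \<or> T (hd x) (hd y) (hd l)"
      proof (rule link_C4)
        show "T (hd x) (hd k) (hd y)" using k T_swap by metis
        show "T (hd x) (hd y) (hd w)" by fact
        show "T (hd x) (hd w) (hd l)" using l T_rot by metis
        show "T (hd x) (hd l) (hd k)" using calculation T_swap T_rot by metis
        show "hd k \<noteq> hd w" using l calculation Zno E by metis
        show "hd y \<noteq> hd l" using k calculation Zno E by metis
      qed
      ultimately show ?thesis using that T_rot T_swap by metis
    qed
    then show ?thesis
    proof cases
      case 1
      then show ?thesis using diag[of y w k] xk k xyw by blast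
    next
      case 2
      have "E' w y" using diag[of w y l] xl l xyw 2 T_rot T_swap by metis
      then show ?thesis by (rule E'_sym)
    qed
  qed
  have tri': "E' a b" if mab: "E' m a" "E' m b" "T (hd m) (hd a) (hd b)" for m a b
  proof -
    have ba: "T (hd m) (hd b) (hd a)" using mab T_rot T_swap by metis
    have ne: "a \<noteq> b" using mab T_neq by metis
    have cs: "m \<in> M \<or> m \<in> N" "a \<in> M \<or> a \<in> N" "b \<in> M \<or> b \<in> N" using eM mab by blast+
    then show ?thesis
      using mab ba ne triMMN[of m a b] triMMN[of m b a] triMNN[of m a b] triNMM[of a b m]
        triNMN[of m a b] triNMN[of m b a] triNNN[of m a b] tri[of m a b] eMM E'_sym by metis
  qed
  have "ball_cover v (Suc n) (M \<union> N) E'"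
    unfolding ball_cover_def
  proof (intro conjI allI ballI impI)
    show "[v] \<in> M \<union> N" using root by blast
    fix m assume m: "m \<in> M \<union> N"
    show "1 \<le> length m" "length m \<le> Suc n" using m lenN len by fastforce+
    show "m = [v]" if "length m = 1" using m that lenN len assms(2) by (metis One_nat_def UnE not_one_le_zero nat.inject)
    show "\<exists>m'. E' m m' \<and> hd m' = z" if "length m < Suc n \<and> A (hd m) z" for z
    proof -
      have mM: "m \<in> M" using m that lenN by fastforce
      show ?thesis
      proof (cases "Z m z")
        case True
        then show ?thesis using eMN[OF mM nvN[OF True]] by auto
      next
        case False
        show ?thesis
        proof (cases "length m < n")
          case True
          then show ?thesis using compl[OF mM True] that E eMM by metis
        next
          case f2: False
          then show ?thesis using that False mM E eMM unfolding Z_def by (metis less_SucE)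
        qed
      qed
    qed
    show "\<exists>c. E' m c \<and> Suc (length c) = length m" if "1 < length m"
    proof (cases "m \<in> M")
      case True
      then show ?thesis using down that E eMM by metis
    next
      case False
      then obtain k where "Z k (hd m)" "m = nv k (hd m)" using m N by blast
      then have "E' m k" "length k = n" using ZM by (auto simp: E'_def)
      then show ?thesis using lenN False m by (intro exI[of _ k]) auto
    qed
  next
    fix a b assume ab: "E' a b"
    show "a \<in> M \<union> N" "b \<in> M \<union> N" using eM ab by blast+
    show "E' b a" by (rule E'_sym[OF ab])
    show "A (hd a) (hd b)" by (rule E'A[OF ab])
    show "length a \<le> Suc (length b)"
    proof -
      have "length x \<le> Suc n" "length x = Suc n \<or> x \<in> M" if "x \<in> M \<union> N" for x using that len lenN by fastforce+
      moreover have "length a \<le> Suc (length b)" if "a \<in> M" "b \<in> M" using eMM that ab E by blast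
      moreover have "length b = n" if "a \<in> N" "b \<in> M" using eMN that ab E'_sym ZM by blast
      moreover have "length b = Suc n" if "b \<in> N" using that lenN by blast
      ultimately show ?thesis using eM[OF ab] by (metis Suc_leD UnE le_SucI)
    qed
  next
    fix m a b assume "E' m a \<and> E' m b \<and> hd a = hd b"
    then show "a = b" using inj' by blast
  next
    fix m a b assume "E' m a \<and> E' m b \<and> T (hd m) (hd a) (hd b)"
    then show "E' a b" using tri' by blast
  next
    fix a b assume ab: "E' a b \<and> length a = length b"
    show "\<exists>c. E' c a \<and> E' c b \<and> Suc (length c) = length a \<and> T (hd c) (hd a) (hd b)"
    proof (cases "a \<in> M")
      case True
      then have "b \<in> M" using ab eM[of a b] lenN len[OF True] by force
      then show ?thesis using TC[of a b] ab True eMM E by metis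
    next
      case False
      then have "a \<in> N" "b \<in> N" using ab eM[of a b] lenN[of a] len[of b] by force+
      then obtain m where m: "Z m (hd a) \<and> Z m (hd b) \<and> T (hd m) (hd a) (hd b) \<and> a = nv m (hd a) \<and> b = nv m (hd b)"
        using eNN ab by blast
      then have "E' m a" "E' m b" "length m = n" using ZM by (auto simp: E'_def)
      then show ?thesis using m lenN \<open>a \<in> N\<close> by metis
    qed
  next
    fix m a b assume mab: "E' m a \<and> E' m b \<and> Suc (length a) = length m \<and> Suc (length b) = length m"
    show "a = b \<or> E' a b \<and> T (hd m) (hd a) (hd b)"
    proof (cases "m \<in> M")
      case True
      then have "a \<in> M" "b \<in> M" using mab eM[of m a] eM[of m b] lenN len[OF True] by force+
      then show ?thesis using IC[of m a b] mab True eMM E by metis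
    next
      case False
      then have mN: "m \<in> N" using mab eM by blast
      then have "a \<in> M" "b \<in> M" using mab eM[of m a] eM[of m b] lenN by fastforce+
      then show ?thesis using triNMM mN mab eMM E by metis
    qed
  qed
  moreover have "M = {m\<in>M \<union> N. length m \<le> n}" using len lenN by fastforce
  moreover have "\<forall>a b. E a b \<longleftrightarrow> E' a b \<and> length a \<le> n \<and> length b \<le> n"
    using eM eMM E len lenN by (metis Suc_n_not_le_n UnE)
  ultimately show ?thesis by blast
qed


text \<open>The limit of \<open>ball_cover\<close> for growing radius: lengths are unbounded and
  neighbours lift at every vertex.\<close>

definition geodesic_cover :: "'a \<Rightarrow> 'a list set \<Rightarrow> ('a list \<Rightarrow> 'a list \<Rightarrow> bool) \<Rightarrow> bool" where
  "geodesic_cover v M E \<longleftrightarrow>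
     [v] \<in> M \<and> (\<forall>m\<in>M. 1 \<le> length m \<and> (length m = 1 \<longrightarrow> m = [v])) \<and>
     (\<forall>a b. E a b \<longrightarrow> a \<in> M \<and> b \<in> M \<and> E b a \<and> A (hd a) (hd b) \<and> length a \<le> Suc (length b)) \<and>
     (\<forall>m a b. E m a \<and> E m b \<and> hd a = hd b \<longrightarrow> a = b) \<and>
     (\<forall>m\<in>M. \<forall>z. A (hd m) z \<longrightarrow> (\<exists>m'. E m m' \<and> hd m' = z)) \<and>
     (\<forall>m a b. E m a \<and> E m b \<and> T (hd m) (hd a) (hd b) \<longrightarrow> E a b) \<and>
     (\<forall>a b. E a b \<and> length a = length b \<longrightarrow>
        (\<exists>c. E c a \<and> E c b \<and> Suc (length c) = length a \<and> T (hd c) (hd a) (hd b))) \<and>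
     (\<forall>m a b. E m a \<and> E m b \<and> Suc (length a) = length m \<and> Suc (length b) = length m \<longrightarrow>
        a = b \<or> E a b \<and> T (hd m) (hd a) (hd b)) \<and>
     (\<forall>m\<in>M. 1 < length m \<longrightarrow> (\<exists>c. E m c \<and> Suc (length c) = length m))"

lemma geodesic_coverD:
  assumes "geodesic_cover v M E"
  shows "[v] \<in> M"
    and "\<And>m. m \<in> M \<Longrightarrow> 1 \<le> length m \<and> (length m = 1 \<longrightarrow> m = [v])"
    and "\<And>a b. E a b \<Longrightarrow> a \<in> M \<and> b \<in> M \<and> E b a \<and> A (hd a) (hd b) \<and> length a \<le> Suc (length b)"
    and "\<And>m a b. E m a \<Longrightarrow> E m b \<Longrightarrow> hd a = hd b \<Longrightarrow> a = b"
    and "\<And>m z. m \<in> M \<Longrightarrow> A (hd m) z \<Longrightarrow> \<exists>m'. E m m' \<and> hd m' = z"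
    and "\<And>m a b. E m a \<Longrightarrow> E m b \<Longrightarrow> T (hd m) (hd a) (hd b) \<Longrightarrow> E a b"
    and "\<And>a b. E a b \<Longrightarrow> length a = length b \<Longrightarrow>
        \<exists>c. E c a \<and> E c b \<and> Suc (length c) = length a \<and> T (hd c) (hd a) (hd b)"
    and "\<And>m a b. E m a \<Longrightarrow> E m b \<Longrightarrow> Suc (length a) = length m \<Longrightarrow> Suc (length b) = length m \<Longrightarrow>
        a = b \<or> E a b \<and> T (hd m) (hd a) (hd b)"
    and "\<And>m. m \<in> M \<Longrightarrow> 1 < length m \<Longrightarrow> \<exists>c. E m c \<and> Suc (length c) = length m"
  using assms unfolding geodesic_cover_def by meson+

text \<open>Balls chosen one after the other extend each other without changing what is already
  built, and every clause concerns few vertices, so that it can be checked in a single large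
  ball.\<close>

lemma ex_geodesic_cover: "\<exists>M E. geodesic_cover v M E"
proof -
  define P where "P n ME = ball_cover v (Suc n) (fst ME) (snd ME)" for n and ME :: "'a list set \<times> ('a list \<Rightarrow> 'a list \<Rightarrow> bool)"
  define Q where "Q n ME ME' \<longleftrightarrow> fst ME = {m\<in>fst ME'. length m \<le> Suc n} \<and>
      (\<forall>a b. snd ME a b \<longleftrightarrow> snd ME' a b \<and> length a \<le> Suc n \<and> length b \<le> Suc n)"
    for n and ME ME' :: "'a list set \<times> ('a list \<Rightarrow> 'a list \<Rightarrow> bool)"
  have "\<exists>F. \<forall>n. P n (F n) \<and> Q n (F n) (F (Suc n))"
  proof (rule dependent_nat_choice)
    show "\<exists>x. P 0 x" using ball_cover_1 by (auto simp: P_def)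
    show "\<exists>y. P (Suc n) y \<and> Q n x y" if "P n x" for x n
      using ball_cover_step[of v "Suc n" "fst x" "snd x"] that unfolding P_def Q_def by auto
  qed
  then obtain F where F: "\<And>n. ball_cover v (Suc n) (fst (F n)) (snd (F n))"
    and FQ: "\<And>n. Q n (F n) (F (Suc n))" unfolding P_def by blast
  define G where "G n = fst (F n)" for n
  define H where "H n = snd (F n)" for n
  have G: "G n = {m\<in>G (n + k). length m \<le> Suc n}" for n k
  proof (induction k)
    case 0
    then show ?case using ball_coverD(2)[OF F[of n]] by (auto simp: G_def)
  next
    case (Suc k)
    have "x \<in> G (n + k) \<longleftrightarrow> x \<in> G (n + Suc k) \<and> length x \<le> Suc (n + k)" for x
      using FQ[of "n + k"] by (auto simp: Q_def G_def)
    moreover have "x \<in> G n \<longleftrightarrow> x \<in> G (n + k) \<and> length x \<le> Suc n" for x by (subst Suc) simp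
    moreover have "length x \<le> Suc n \<Longrightarrow> length x \<le> Suc (n + k)" for x :: "'a list" by simp
    ultimately have "x \<in> G n \<longleftrightarrow> x \<in> G (n + Suc k) \<and> length x \<le> Suc n" for x by blast
    then show ?case by blast
  qed
  have HG: "a \<in> G n \<and> b \<in> G n" if "H n a b" for n a b
    using ball_coverD(3)[OF F[of n]] that unfolding G_def H_def by blast
  have H: "H n a b \<longleftrightarrow> H (n + k) a b \<and> length a \<le> Suc n \<and> length b \<le> Suc n" for n k a b
  proof (induction k)
    case 0
    then show ?case using HG[of n a b] ball_coverD(2)[OF F[of n]] by (auto simp: G_def)
  next
    case (Suc k)
    have "H (n + k) a b \<longleftrightarrow> H (n + Suc k) a b \<and> length a \<le> Suc (n + k) \<and> length b \<le> Suc (n + k)"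
      using FQ[of "n + k"] by (auto simp: Q_def H_def)
    then show ?case using Suc by auto
  qed
  define M where "M = (\<Union>n. G n)"
  define E where "E a b \<longleftrightarrow> (\<exists>n. H n a b)" for a b
  have GM: "m \<in> G n \<longleftrightarrow> m \<in> M \<and> length m \<le> Suc n" for m n
  proof
    assume "m \<in> G n"
    then show "m \<in> M \<and> length m \<le> Suc n" using ball_coverD(2)[OF F[of n]] unfolding M_def G_def by blast
  next
    assume m: "m \<in> M \<and> length m \<le> Suc n"
    then obtain k where "m \<in> G k" by (auto simp: M_def)
    then have "m \<in> G (max n k)" using G[of k "max n k - k"] by auto
    then show "m \<in> G n" using G[of n "max n k - n"] m by auto
  qed
  have HE: "H n a b \<longleftrightarrow> E a b \<and> length a \<le> Suc n \<and> length b \<le> Suc n" for a b n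
  proof
    assume "H n a b"
    then show "E a b \<and> length a \<le> Suc n \<and> length b \<le> Suc n" using HG GM unfolding E_def by blast
  next
    assume m: "E a b \<and> length a \<le> Suc n \<and> length b \<le> Suc n"
    then obtain k where "H k a b" by (auto simp: E_def)
    then have "H (max n k) a b" using H[of k a b "max n k - k"] by auto
    then show "H n a b" using H[of n a b "max n k - n"] m by auto
  qed
  have B: "ball_cover v (Suc n) {m\<in>M. length m \<le> Suc n} (\<lambda>a b. E a b \<and> length a \<le> Suc n \<and> length b \<le> Suc n)" for n
  proof -
    have "fst (F n) = {m\<in>M. length m \<le> Suc n}" using GM by (auto simp: G_def)
    moreover have "snd (F n) = (\<lambda>a b. E a b \<and> length a \<le> Suc n \<and> length b \<le> Suc n)"
      using HE by (auto simp: H_def fun_eq_iff)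
    ultimately show ?thesis using F[of n] by simp
  qed
  have "geodesic_cover v M E"
    unfolding geodesic_cover_def
  proof (intro conjI allI ballI impI)
    show "[v] \<in> M" using ball_coverD(1)[OF B[of 0]] by blast
    fix m assume m: "m \<in> M"
    then have m': "m \<in> {k\<in>M. length k \<le> Suc (length m)}" by simp
    show "1 \<le> length m" "length m = 1 \<Longrightarrow> m = [v]"
      using ball_coverD(2)[OF B[of "length m"] m'] by auto
    show "\<exists>m'. E m m' \<and> hd m' = z" if "A (hd m) z" for z
      using ball_coverD(5)[OF B[of "length m"] m' _ that] by auto
    show "\<exists>c. E m c \<and> Suc (length c) = length m" if "1 < length m"
      using ball_coverD(9)[OF B[of "length m"] m' that] by auto
  next
    fix a b assume ab: "E a b"
    then have "E a b \<and> length a \<le> Suc (length a + length b) \<and> length b \<le> Suc (length a + length b)" by auto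
    then show "a \<in> M" "b \<in> M" "E b a" "A (hd a) (hd b)" "length a \<le> Suc (length b)"
      using ball_coverD(3)[OF B[of "length a + length b"], of a b] by auto
  next
    fix m a b assume ab: "E m a \<and> E m b \<and> hd a = hd b"
    then show "a = b" using ball_coverD(4)[OF B[of "length m + length a + length b"], of m a b] by auto
  next
    fix m a b assume ab: "E m a \<and> E m b \<and> T (hd m) (hd a) (hd b)"
    then show "E a b" using ball_coverD(6)[OF B[of "length m + length a + length b"], of m a b] by auto
  next
    fix a b assume ab: "E a b \<and> length a = length b"
    then show "\<exists>c. E c a \<and> E c b \<and> Suc (length c) = length a \<and> T (hd c) (hd a) (hd b)"
      using ball_coverD(7)[OF B[of "length a + length b"], of a b] by auto
  next
    fix m a b assume ab: "E m a \<and> E m b \<and> Suc (length a) = length m \<and> Suc (length b) = length m"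
    then show "a = b \<or> E a b \<and> T (hd m) (hd a) (hd b)"
      using ball_coverD(8)[OF B[of "length m + length a + length b"], of m a b] by auto
  qed
  then show ?thesis by blast
qed

end

text \<open>Two vertices of the cover over the same vertex are joined by a path through the root, so
  \<open>closed\<close> makes the projection injective. It is also onto and turns length minus one
  into distance; the last clauses of the cover thus become statements about the graph
  itself.\<close>

lemma (in six_large_links) ball_structure:
  assumes "connected_graph V A" and v: "v \<in> V"
    and cov: "geodesic_cover v M E"
    and closed: "\<And>n a b. (E ^^ n) a b \<Longrightarrow> hd a = hd b \<Longrightarrow> a = b"
  shows "A a b \<Longrightarrow> gdist A a v = gdist A b v \<Longrightarrow>
      \<exists>c. T c a b \<and> Suc (gdist A c v) = gdist A a v"
    and "A m a \<Longrightarrow> A m b \<Longrightarrow> Suc (gdist A a v) = gdist A m v \<Longrightarrow> Suc (gdist A b v) = gdist A m v \<Longrightarrow>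
      a = b \<or> T m a b"
proof -
  interpret connected_graph V A by fact
  note cov = geodesic_coverD[OF cov]
  have Esym: "E b a" if "E a b" for a b using cov(3) that by blast
  have to_root: "(E ^^ (length m - 1)) [v] m" if "m \<in> M" for m
    using that
  proof (induction "length m" arbitrary: m rule: less_induct)
    case less
    show ?case
    proof (cases "length m = 1")
      case True
      then show ?thesis using cov(2) less by auto
    next
      case False
      then have "1 < length m" using cov(2)[OF less(2)] by linarith
      then obtain c where c: "E m c" "Suc (length c) = length m" using cov(9) less by blast
      then have "c \<in> M" using cov(3) by blast
      then have "(E ^^ (length c - 1)) [v] c" "1 \<le> length c" using less c cov(2) by auto
      moreover have "length m - 1 = Suc (length c - 1)" using c calculation by simp
      ultimately show ?thesis using Esym[OF c(1)] by (metis relpowp_Suc_I)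
    qed
  qed
  have inj: "a = b" if "a \<in> M" "b \<in> M" "hd a = hd b" for a b
    using relpowp_concat[OF relpowp_sym[OF Esym to_root[OF that(1)]] to_root[OF that(2)]] closed that by blast
  have lift: "\<exists>m\<in>M. hd m = x \<and> length m \<le> Suc n" if "(A ^^ n) v x" for n x
    using that
  proof (induction n arbitrary: x)
    case 0
    then show ?case using cov(1) by (intro bexI[of _ "[v]"]) auto
  next
    case (Suc n)
    then obtain y where y: "(A ^^ n) v y" "A y x" by auto
    then obtain m where m: "m \<in> M" "hd m = y" "length m \<le> Suc n" using Suc.IH by blast
    then obtain m' where "E m m'" "hd m' = x" using cov(5) y by blast
    moreover from this have "m' \<in> M" "length m' \<le> Suc (length m)" using cov(3)[of m' m] Esym by blast+
    ultimately show ?case using m by (intro bexI[of _ m']) auto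
  qed
  have proj: "(A ^^ n) (hd a) (hd b)" if "(E ^^ n) a b" for n a b
    using that
  proof (induction n arbitrary: b)
    case (Suc n)
    then obtain c where "(E ^^ n) a c" "E c b" by auto
    then show ?case using Suc.IH cov(3) by (metis relpowp_Suc_I)
  qed auto
  define L where "L x = (THE m. m \<in> M \<and> hd m = x)" for x
  have L: "L x \<in> M \<and> hd (L x) = x \<and> gdist A x v = length (L x) - 1 \<and> 1 \<le> length (L x)" if x: "x \<in> V" for x
  proof -
    obtain m where m: "m \<in> M" "hd m = x" "length m \<le> Suc (d v x)"
      using lift d_relpowp[OF v x] by blast
    then have "L x = m" unfolding L_def using inj by blast
    moreover have "d v x \<le> length m - 1" using proj[OF to_root[OF m(1)]] m d_le by simp
    ultimately show ?thesis using m d_sym[OF v x] cov(2) by force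
  qed
  have LE: "E (L x) (L y)" if "A x y" for x y
  proof -
    have xy: "x \<in> V" "y \<in> V" using that adj_V adj_V2 by auto
    have "A (hd (L x)) y" using L[OF xy(1)] that by simp
    then obtain m' where "E (L x) m'" "hd m' = y" using cov(5) L[OF xy(1)] by blast
    then show ?thesis using inj[of m' "L y"] L[OF xy(2)] cov(3) by metis
  qed
  show "\<exists>c. T c a b \<and> Suc (gdist A c v) = gdist A a v" if ab: "A a b" "gdist A a v = gdist A b v"
  proof -
    have V: "a \<in> V" "b \<in> V" using ab adj_V adj_V2 by auto
    have "length (L a) = length (L b)" using L[OF V(1)] L[OF V(2)] ab by linarith
    then obtain c where c: "E c (L a)" "Suc (length c) = length (L a)" "T (hd c) (hd (L a)) (hd (L b))"
      using cov(7)[OF LE[OF ab(1)]] by blast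
    have "T (hd c) a b" using c L V by simp
    moreover from this have hc: "hd c \<in> V" using T_A adj_V by blast
    moreover have "c \<in> M" using c cov(3) by blast
    then have "L (hd c) = c" using inj[of "L (hd c)" c] L[OF hc] by blast
    ultimately show ?thesis using L[OF hc] L[OF V(1)] c by (intro exI[of _ "hd c"]) auto
  qed
  show "a = b \<or> T m a b" if "A m a" "A m b" "Suc (gdist A a v) = gdist A m v" "Suc (gdist A b v) = gdist A m v"
  proof -
    have V: "a \<in> V" "b \<in> V" "m \<in> V" using that adj_V adj_V2 by auto
    have "Suc (length (L a)) = length (L m)" "Suc (length (L b)) = length (L m)"
      using L[OF V(1)] L[OF V(2)] L[OF V(3)] that by linarith+
    then show ?thesis using cov(8)[OF LE[OF that(1)] LE[OF that(2)]] L[OF V(1)] L[OF V(2)] L[OF V(3)] by metis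
  qed
qed

text \<open>A lift of a closed path is carried along a homotopy through a grid of simplices; it closes up
  because the lift of the final, constant row does.\<close>

lemma (in six_large_links) lift_grid_closed:
  assumes cov: "geodesic_cover v M E"
    and X_adj: "\<And>a b. {a, b} \<in> X \<Longrightarrow> a \<noteq> b \<Longrightarrow> A a b"
    and X_tri: "\<And>a b c. {a, b, c} \<in> X \<Longrightarrow> distinct [a, b, c] \<Longrightarrow> T a b c"
    and X_sub: "\<And>s t. s \<in> X \<Longrightarrow> t \<subseteq> s \<Longrightarrow> t \<noteq> {} \<Longrightarrow> t \<in> X"
    and "0 < N"
    and sq: "\<And>i j. i < N \<Longrightarrow> j < J \<Longrightarrow> {w i j, w (Suc i) j, w i (Suc j), w (Suc i) (Suc j)} \<in> X"
    and seam: "\<And>j. j \<le> J \<Longrightarrow> w N j = w 0 j"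
    and top: "\<And>i. i < N \<Longrightarrow> w (Suc i) J = w i J"
    and g_step: "\<And>i. i < N \<Longrightarrow> g i = g (Suc i) \<or> E (g i) (g (Suc i))"
    and g_M: "\<And>i. i \<le> N \<Longrightarrow> g i \<in> M \<and> hd (g i) = w i 0"
  shows "g N = g 0"
  using sq seam top g_step g_M
proof (induction J arbitrary: w g)
  case 0
  \<comment> \<open>The last row is constant, whereas every edge of the cover projects to an
    edge.\<close>
  have "g i = g 0" if "i \<le> N" for i
    using that
  proof (induction i)
    case (Suc i)
    have "hd (g (Suc i)) = hd (g i)" using 0(3)[of i] 0(5)[of i] 0(5)[of "Suc i"] Suc by simp
    moreover have "\<not> E (g i) (g (Suc i))" using geodesic_coverD(3)[OF cov, of "g i"] calculation A_irrefl by metis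
    ultimately show ?case using Suc 0(4)[of i] by auto
  qed simp
  from this[of N] show ?case by blast
next
  case (Suc J)
  \<comment> \<open>Squares of the grid may be degenerate, so lifted steps are allowed to
    rest.\<close>
  define W where "W a b \<longleftrightarrow> a = b \<and> a \<in> M \<or> E a b" for a b
  note cov' = geodesic_coverD[OF cov]
  have EM: "a \<in> M" "b \<in> M" "E b a" "hd a \<noteq> hd b" if "E a b" for a b
    using cov'(3)[OF that] A_irrefl by auto
  have W_sym: "W b a" if "W a b" for a b using that EM(3) by (auto simp: W_def)
  have W_hd: "a = b" if "W a b" "hd a = hd b" for a b using that EM(4) by (auto simp: W_def)
  have W_M: "b \<in> M" if "W a b" for a b using that EM(2) by (auto simp: W_def)
  have W_tri: "W b c" if ab: "W a b" and ac: "W a c" and X: "{hd a, hd b, hd c} \<in> X" for a b c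
  proof (cases "a = b \<or> a = c \<or> hd b = hd c")
    case True
    then consider "a = b" | "a = c" | "a \<noteq> b" "a \<noteq> c" "hd b = hd c" by blast
    then show ?thesis
    proof cases
      case 1
      then show ?thesis using ac by simp
    next
      case 2
      then show ?thesis using W_sym[OF ab] by simp
    next
      case 3
      then have "b = c" using cov'(4)[of a b c] ab ac by (simp add: W_def)
      then show ?thesis using W_M[OF ac] by (simp add: W_def)
    qed
  next
    case False
    then have E: "E a b" "E a c" using ab ac by (auto simp: W_def)
    then have "T (hd a) (hd b) (hd c)" using X_tri[OF X] EM(4) False by simp
    then show ?thesis using cov'(6)[OF E] by (simp add: W_def)
  qed
  have W_ex: "\<exists>b. W a b \<and> hd b = z" if "a \<in> M" "{hd a, z} \<in> X" for a z
    using that cov'(5)[of a z] X_adj[of "hd a" z] unfolding W_def by blast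
  have sub3: "{a, b, c} \<in> X" if "s \<in> X" "a \<in> s" "b \<in> s" "c \<in> s" for s a b c
    by (rule X_sub[of s]) (use that in auto)
  have up: "{w i 0, w i 1} \<in> X" if iN: "i \<le> N" for i
  proof (cases "i < N")
    case True
    show ?thesis by (rule X_sub[OF Suc.prems(1)[OF True, of 0]]) auto
  next
    case False
    then obtain k where "i = Suc k" "k < N" using iN \<open>0 < N\<close> False by (cases i) auto
    then show ?thesis using X_sub[OF Suc.prems(1)[of k 0], of "{w i 0, w i 1}"] by auto
  qed
  have "\<exists>b. W (g i) b \<and> hd b = w i 1" if "i \<le> N" for i
    using W_ex[of "g i" "w i 1"] up[OF that] Suc.prems(5)[OF that] by auto
  then obtain h where h: "\<And>i. i \<le> N \<Longrightarrow> W (g i) (h i) \<and> hd (h i) = w i 1" by metis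
  have "h N = h 0"
  proof (rule Suc.IH[of "\<lambda>i j. w i (Suc j)" h])
    fix i assume i: "i < N"
    have sqi: "{w i 0, w (Suc i) 0, w i 1, w (Suc i) 1} \<in> X" using Suc.prems(1)[OF i, of 0] by simp
    \<comment> \<open>The square is crossed through two triangles: the first yields the diagonal
      from \<open>g (Suc i)\<close> to \<open>h i\<close>, the second the next step of the upper
      row.\<close>
    have "W (g i) (g (Suc i))" using Suc.prems(4)[OF i] Suc.prems(5)[of i] i by (auto simp: W_def)
    then have "W (g (Suc i)) (h i)"
      using W_tri[of "g i" "g (Suc i)" "h i"] h[of i] Suc.prems(5)[of i] Suc.prems(5)[of "Suc i"] i
        sub3[OF sqi] by simp
    moreover have "W (g (Suc i)) (h (Suc i))" using h[of "Suc i"] i by simp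
    ultimately have "W (h i) (h (Suc i))"
      using W_tri[of "g (Suc i)" "h i" "h (Suc i)"] h[of i] h[of "Suc i"] Suc.prems(5)[of "Suc i"] i
        sub3[OF sqi] by simp
    then show "h i = h (Suc i) \<or> E (h i) (h (Suc i))" by (auto simp: W_def)
  next
    fix i assume "i \<le> N"
    then show "h i \<in> M \<and> hd (h i) = w i (Suc 0)" using h[of i] W_M[of "g i" "h i"] by simp
  next
    show "{w i (Suc j), w (Suc i) (Suc j), w i (Suc (Suc j)), w (Suc i) (Suc (Suc j))} \<in> X"
      if "i < N" "j < J" for i j
      using Suc.prems(1)[of i "Suc j"] that by simp
    show "w N (Suc j) = w 0 (Suc j)" if "j \<le> J" for j
      using Suc.prems(2)[of "Suc j"] that by simp
    show "w (Suc i) (Suc J) = w i (Suc J)" if "i < N" for i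
      using Suc.prems(3)[OF that] .
  qed
  \<comment> \<open>The upper row closes up, so both ends of the lower row are lifts of one vertex
    next to \<open>h 0\<close>.\<close>
  then have "W (h 0) (g N)" "W (h 0) (g 0)" using h[of N] h[of 0] W_sym by auto
  moreover have "hd (g N) = hd (g 0)" "hd (h 0) = w 0 1" using Suc.prems(2)[of 0] Suc.prems(5) h by auto
  moreover have "{w 0 1, w 0 0, w 0 0} \<in> X" using up[of 0] by (simp add: insert_commute)
  ultimately have "W (g N) (g 0)" using W_tri[of "h 0" "g N" "g 0"] Suc.prems(5)[of 0] by simp
  then show ?case using W_hd \<open>hd (g N) = hd (g 0)\<close> by blast
qed

section \<open>Weakly bridged graphs with an involution\<close>

text \<open>The interval condition makes the quadrangle condition of weakly modular graphs hold
  vacuously, so that these are the weakly bridged graphs.\<close>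

locale weakly_bridged_graph = connected_graph +
  assumes TC: "y \<in> V \<Longrightarrow> A a b \<Longrightarrow> d a y = d b y \<Longrightarrow> \<exists>c. A c a \<and> A c b \<and> Suc (d c y) = d a y"
    and IC: "y \<in> V \<Longrightarrow> A m a \<Longrightarrow> A m b \<Longrightarrow> Suc (d a y) = d m y \<Longrightarrow> Suc (d b y) = d m y \<Longrightarrow> a = b \<or> A a b"
begin

text \<open>If \<open>a\<close> and \<open>c\<close> are not adjacent, they are at distance 2, and
  \<open>b\<close>, \<open>e\<close> are both predecessors of \<open>a\<close> as seen from
  \<open>c\<close>; the interval condition applies.\<close>

lemma quadrangle_diagonal:
  assumes "A a b" "A b c" "A c e" "A e a" "a \<noteq> c"
  shows "A a c \<or> b = e \<or> A b e"
proof (cases "A a c")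
  case False
  have V: "a \<in> V" "b \<in> V" "c \<in> V" "e \<in> V" using assms adj_V by auto
  have "d a c \<noteq> 0" "d a c \<noteq> 1" using V False assms d_0 d_1 by auto
  moreover have "d a c \<le> 2" using d_triangle[of a b c] V assms d_adj[of a b] d_adj[of b c] by simp
  ultimately have "d a c = 2" by simp
  then show ?thesis using IC[of c a b e] V assms adj_sym d_adj by simp
qed simp

text \<open>Take a predecessor \<open>c\<close> of \<open>y\<close> as seen from \<open>x\<close>.
  Seen from \<open>x'\<close>, both \<open>c\<close> and \<open>y'\<close> are predecessors of
  \<open>y\<close>, hence equal or adjacent, which brings \<open>y'\<close> within distance
  \<open>n\<close> of \<open>x\<close>.\<close>

lemma no_straight_ladder:
  assumes "A x x'" "A y y'" "d x y = n" "d x' y' = n" "d x y' = Suc n" "d x' y = Suc n" "0 < n"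
  shows False
proof -
  have V: "x \<in> V" "x' \<in> V" "y \<in> V" "y' \<in> V" using assms adj_V adj_V2 by auto
  obtain k where k: "n = Suc k" using assms(7) by (cases n) auto
  obtain c where c: "A y c" "d c x = k" using d_Suc[of y x k] V d_sym[of x y] assms k by metis
  have cV: "c \<in> V" using c adj_V2 by blast
  have "d c x' \<le> n" using d_triangle[of c x x'] d_adj[of x x'] V cV assms c k by simp
  moreover have "d y x' \<le> Suc (d c x')" using d_adj_le[of y c x'] c V by simp
  ultimately have "d c x' = n" using assms V d_sym[of x' y] by simp
  then have "c = y' \<or> A c y'" using IC[of x' y c y'] V c assms d_sym[of x' y] d_sym[of x' y'] by simp
  then have "d y' x \<le> Suc (d c x)"
    using d_adj_le[of y' c x] V adj_sym by auto
  then show False using c k assms d_sym[of x y'] V by simp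
qed

text \<open>Induction on the size of the clique, with \<open>TC\<close> for two vertices. For more,
  let \<open>p\<close> serve all but \<open>c\<close> and \<open>q\<close> all but \<open>a\<close>.
  Both are predecessors of a third vertex \<open>b\<close>, hence equal or adjacent, and a diagonal
  of the quadrangle \<open>p, q, c, a\<close> lets one of them serve the whole clique.\<close>

lemma clique_common_nbr:
  assumes "finite S" "S \<noteq> {}" "y \<in> V" "0 < n" "S \<subseteq> V"
    and "\<And>a b. a \<in> S \<Longrightarrow> b \<in> S \<Longrightarrow> a = b \<or> A a b"
    and "\<And>a. a \<in> S \<Longrightarrow> d a y = n"
  shows "\<exists>z. Suc (d z y) = n \<and> (\<forall>a\<in>S. A z a)"
  using assms
proof (induction "card S" arbitrary: S rule: less_induct)
  case less
  obtain a where a: "a \<in> S" using less by blast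
  have 1: "\<exists>z. Suc (d z y) = n \<and> A z b" if "b \<in> S" for b
  proof -
    obtain k where "n = Suc k" using less by (cases n) auto
    then show ?thesis using d_Suc[of b y k] less that adj_sym by (metis subsetD)
  qed
  show ?case
  proof (cases "S = {a}")
    case True
    then show ?thesis using 1[of a] by auto
  next
    case False
    then obtain b where b: "b \<in> S" "b \<noteq> a" using a by blast
    show ?thesis
    proof (cases "S = {a, b}")
      case True
      then have "A a b" using less(7)[of a b] a b by auto
      then show ?thesis using TC[of y a b] less(8)[of a] less(8)[of b] a b less(4) True by auto
    next
      case False
      then obtain c where c: "c \<in> S" "c \<noteq> a" "c \<noteq> b" using a b by blast
      have sub: "\<exists>z. Suc (d z y) = n \<and> (\<forall>a\<in>S - {e}. A z a)" if "e \<in> S" "S - {e} \<noteq> {}" for e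
      proof (rule less(1))
        show "card (S - {e}) < card S" by (rule card_Diff1_less[OF less(2) that(1)])
        show "a = b \<or> A a b" if "a \<in> S - {e}" "b \<in> S - {e}" for a b using less(7) that by blast
        show "d a y = n" if "a \<in> S - {e}" for a using less(8) that by blast
      qed (use less(2,4,5,6) that in auto)
      obtain p where p: "Suc (d p y) = n" "\<forall>x\<in>S - {c}. A p x" using sub[of c] a c by auto
      obtain q where q: "Suc (d q y) = n" "\<forall>x\<in>S - {a}. A q x" using sub[of a] a c by auto
      have pc: "p \<noteq> c" using p less(8)[of c] c by auto
      have qa: "q \<noteq> a" using q less(8)[of a] a by auto
      have "p = q \<or> A p q"
        using IC[of y b p q] b c p q less(8)[of b] less(4) adj_sym by simp
      moreover have "A a c" using less(7)[of a c] a c by auto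
      ultimately have "A p c \<or> A q a"
        using quadrangle_diagonal[of p q c a] p q a c b pc qa adj_sym by auto
      then show ?thesis using p q by (metis Diff_iff singletonD)
    qed
  qed
qed

end

section \<open>Invariance sets of involutions of weakly bridged graphs\<close>

locale weakly_bridged_involution = weakly_bridged_graph +
  fixes u
  assumes u_inv: "x \<in> V \<Longrightarrow> u (u x) = x"
    and u_adj: "A a b \<Longrightarrow> A (u a) (u b)"
    and u_V: "x \<in> V \<Longrightarrow> u x \<in> V"
begin

definition I where "I = {x\<in>V. u x = x \<or> A (u x) x}"

lemma relpowp_u: "(A ^^ n) a b \<Longrightarrow> (A ^^ n) (u a) (u b)"
proof (induction n arbitrary: b)
  case (Suc n)
  then obtain c where "(A ^^ n) a c" "A c b" by auto
  then show ?case using Suc.IH u_adj by (metis relpowp_Suc_I)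
qed auto

lemma d_u: assumes "a \<in> V" "b \<in> V" shows "d (u a) (u b) = d a b"
proof (rule antisym)
  show "d (u a) (u b) \<le> d a b" using assms d_le relpowp_u d_relpowp by blast
  have "d (u (u a)) (u (u b)) \<le> d (u a) (u b)"
    using d_le[OF relpowp_u[OF d_relpowp[of "u a" "u b"]]] assms u_V by blast
  then show "d a b \<le> d (u a) (u b)" using assms u_inv by simp
qed

lemma d_u_swap: "a \<in> V \<Longrightarrow> b \<in> V \<Longrightarrow> d (u a) b = d a (u b)"
  using d_u[of a "u b"] u_inv u_V by simp

lemma u_in_I: "x \<in> I \<Longrightarrow> u x \<in> I"
  unfolding I_def using u_V u_inv adj_sym by auto

lemma I_V: "x \<in> I \<Longrightarrow> x \<in> V" by (simp add: I_def)

lemma I_adj: "x \<in> I \<Longrightarrow> x = u x \<or> A x (u x)" by (auto simp: I_def adj_sym)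

text \<open>A shortest displacement of at least 2 would be half of an isometric cycle.\<close>

lemma I_nonempty:
  assumes "V \<noteq> {}"
  shows "I \<noteq> {}"
proof -
  obtain x where x: "x \<in> V" "\<And>y. y \<in> V \<Longrightarrow> d x (u x) \<le> d y (u y)"
    using assms ex_has_least_nat[of "\<lambda>x. x \<in> V" _ "\<lambda>x. d x (u x)"] by blast
  have ux: "u x \<in> V" using x u_V by blast
  show ?thesis
  proof (cases "d x (u x) \<le> 1")
    case True
    then have "x \<in> I" using x ux d_le_1[of x "u x"] adj_sym by (auto simp: I_def)
    then show ?thesis by blast
  next
    case False
    then obtain k where k: "d x (u x) = Suc (Suc k)" by (metis One_nat_def le_SucI le_zero_eq not0_implies_Suc order_refl)
    obtain p where p: "A x p" "d p (u x) = Suc k" using d_Suc[OF x(1) ux k] .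
    have pV: "p \<in> V" "u p \<in> V" using p adj_V2 u_V by blast+
    obtain q where q: "A p q" "d q (u x) = k" using d_Suc[OF pV(1) ux p(2)] .
    have qV: "q \<in> V" "u q \<in> V" using q adj_V2 u_V by blast+
    have up: "A (u x) (u p)" using p u_adj by blast
    txt \<open>The path x, p, q, ..., u x and its image form a closed path.  Seen from p, the opposite
      vertex u p has the two predecessors u x and u q on it, which therefore are adjacent.\<close>
    have "d p (u p) \<ge> Suc (Suc k)" using x(2)[of p] pV k by simp
    moreover have "d p (u p) \<le> Suc (Suc k)" using d_triangle[of p "u x" "u p"] pV ux p d_adj[OF up] by simp
    ultimately have pp: "d (u p) p = Suc (Suc k)" using d_sym pV by simp
    have uxp: "A (u p) (u x)" "d (u x) p = Suc k" using up adj_sym d_sym ux pV p by simp_all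
    have qx: "A (u p) (u q)" using q u_adj by blast
    have "d (u q) x = k" using d_u[of q "u x"] u_inv qV ux x q by simp
    then have "d (u q) p \<le> Suc k" using d_triangle[of "u q" x p] qV x pV d_adj[OF p(1)] by simp
    moreover have "d (u p) p \<le> Suc (d (u q) p)" using d_adj_le[OF qx pV(1)] .
    ultimately have uqp: "d (u q) p = Suc k" using pp by simp
    have "u x = u q \<or> A (u x) (u q)"
      using IC[of p "u p" "u x" "u q"] pV uxp qx uqp pp by simp
    then have "x = q \<or> A x q" using u_adj u_inv x qV by metis
    then have "d x (u x) \<le> Suc (d q (u x))" using d_adj_le[of x q "u x"] ux by auto
    then show ?thesis using q k by simp
  qed
qed

text \<open>In the quadrangle \<open>x, u x, u y, y\<close> the involution swaps the two diagonals,
  so that with one of them the other is present too.\<close>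

lemma I_squares:
  assumes "x \<in> I" "y \<in> I" "A x y"
  shows "u x = y \<or> A (u x) y"
proof (rule ccontr)
  assume n: "\<not> (u x = y \<or> A (u x) y)"
  have V: "x \<in> V" "y \<in> V" using assms I_V by auto
  have "A (u x) (u y)" using u_adj assms by blast
  moreover have "u x \<noteq> x" "u y \<noteq> y"
    using n assms calculation by metis+
  then have "A x (u x)" "A (u y) y" using assms by (auto simp: I_def adj_sym)
  ultimately have "A (u x) y \<or> x = u y \<or> A x (u y)"
    using quadrangle_diagonal[of "u x" "u y" y x] n assms adj_sym by blast
  then show False using n u_adj[of x "u y"] u_inv V by auto
qed

text \<open>The four vertices x1, x2, u x1, u x2 form a clique.  If all of them are at distance n from y,
  they have a common neighbour z closer to y; if z and u z are not adjacent, then a common neighbour of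
  the clique that is closer to both y and u y is used instead.\<close>

lemma I_down:
  assumes x: "x1 \<in> I" "x2 \<in> I" "x1 = x2 \<or> A x1 x2" and y: "y \<in> I" and n: "d x1 y = n" "d x2 y = n" "0 < n"
  shows "\<exists>z\<in>I. A z x1 \<and> A z x2 \<and> Suc (d z y) = n"
proof -
  define S where "S = {x1, x2, u x1, u x2}"
  have V: "x1 \<in> V" "x2 \<in> V" "y \<in> V" "u x1 \<in> V" "u x2 \<in> V" "u y \<in> V" using x y I_V u_V by auto
  have yu: "y = u y \<or> A y (u y)" using I_adj y by blast
  have SI: "S \<subseteq> I" using x u_in_I by (auto simp: S_def)
  have uS: "u s \<in> S" if "s \<in> S" for s using that u_inv V by (auto simp: S_def)
  have clique: "a = b \<or> A a b" if "a \<in> S" "b \<in> S" for a b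
  proof -
    define c where "c a b \<longleftrightarrow> a = b \<or> A a b" for a b
    have sym: "c b a" if "c a b" for a b using that adj_sym by (auto simp: c_def)
    have refl: "c a a" for a by (simp add: c_def)
    have "c x1 (u x1)" "c x2 (u x2)" using I_adj x by (auto simp: c_def)
    moreover have "c (u x1) x2"
      using x(3) I_squares[OF x(1,2)] I_adj[OF x(1)] adj_sym unfolding c_def by metis
    moreover have "c (u x2) x1"
      using x(3) I_squares[OF x(2,1)] I_adj[OF x(1)] adj_sym unfolding c_def by metis
    moreover have "c (u x1) (u x2)" using x(3) u_adj by (auto simp: c_def)
    moreover have "c x1 x2" using x(3) by (simp add: c_def)
    ultimately have "c a b" using that refl sym unfolding S_def by blast
    then show ?thesis by (simp add: c_def)
  qed
  show ?thesis
  proof (cases "\<forall>s\<in>S. d s y = n")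
    case False
    then obtain i where i: "i \<in> {x1, x2}" "d (u i) y \<noteq> n" using n by (auto simp: S_def)
    have iV: "i \<in> V" "i \<in> I" "u i \<in> V" "d i y = n" using i V x n u_V by auto
    have ui: "A i (u i)" using I_adj[OF iV(2)] i iV by metis
    have "d (u i) y \<le> Suc n" "n \<le> Suc (d (u i) y)" using d_nbr_cases[OF ui V(3)] iV by auto
    \<comment> \<open>At distance \<open>Suc n\<close> the edges from \<open>i\<close> to
      \<open>u i\<close> and from \<open>y\<close> to \<open>u y\<close> would form a straight
      ladder; at distance \<open>n - 1\<close> the vertex \<open>u i\<close> itself is the one
      sought.\<close>
    then consider "d (u i) y = Suc n" | "Suc (d (u i) y) = n" using i by linarith
    then show ?thesis
    proof cases
      case 1
      then have "d i (u y) = Suc n" using d_u_swap iV V by simp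
      moreover have "A y (u y)" using yu 1 calculation iV by auto
      moreover have "d (u i) (u y) = n" using d_u iV V by simp
      ultimately show ?thesis using no_straight_ladder[OF ui, of y "u y" n] iV 1 n by blast
    next
      case 2
      then have "u i \<noteq> x1" "u i \<noteq> x2" using n by auto
      moreover have "u i \<in> S" "x1 \<in> S" "x2 \<in> S" using i by (auto simp: S_def)
      ultimately have "A (u i) x1" "A (u i) x2" using clique by blast+
      then show ?thesis using 2 \<open>u i \<in> S\<close> SI by blast
    qed
  next
    case True
    have Sn': "d s (u y) = n" if "s \<in> S" for s
      using True uS[OF that] d_u_swap[of s y] SI I_V V that by auto
    obtain z where z: "Suc (d z y) = n" "\<forall>a\<in>S. A z a"
      using clique_common_nbr[of S y n] clique True SI I_V V n by (auto simp: S_def)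
    have zx: "A z x1" "A z x2" using z by (auto simp: S_def)
    then have zV: "z \<in> V" "u z \<in> V" using adj_V u_V by auto
    have uzS: "A (u z) a" if "a \<in> S" for a
      using u_adj[of z "u a"] z uS[OF that] u_inv[of a] SI I_V that by auto
    have uzn: "Suc (d (u z) (u y)) = n" using d_u[of z y] zV V z by simp
    show ?thesis
    proof (cases "z = u z \<or> A z (u z)")
      case True
      then have "z \<in> I" using zV adj_sym by (auto simp: I_def)
      then show ?thesis using z zx by blast
    next
      case False
      have "\<exists>w. A x1 w \<and> Suc (d w y) = n \<and> Suc (d w (u y)) = n"
      proof (cases "y = u y")
        case True
        then show ?thesis using zx adj_sym z by metis
      next
        case f: False
        then have yy: "A y (u y)" using yu by blast
        have dd: "d y x1 = n" "d (u y) x1 = n" using d_sym V n Sn'[of x1] by (auto simp: S_def)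
        \<comment> \<open>The triangle condition is used from the other side: seen from
          \<open>x1\<close>, the edge from \<open>y\<close> to \<open>u y\<close> has a common
          neighbour one step closer. The first vertex \<open>t\<close> of a geodesic from
          \<open>x1\<close> to it is closer to both \<open>y\<close> and \<open>u y\<close>.\<close>
        obtain w where w: "A w y" "A w (u y)" "Suc (d w x1) = n"
          using TC[OF V(1) yy] dd by auto
        have wV: "w \<in> V" using w adj_V by blast
        show ?thesis
        proof (cases "d w x1")
          case 0
          \<comment> \<open>This case cannot occur: \<open>z\<close> would be \<open>y\<close>,
            which is equal or adjacent to its image.\<close>
          then have "d x1 y = 1" "n = 1" using w wV V d_0[of w x1] d_adj[of w y] by auto
          then show ?thesis
          proof -
            have "d z y = 0" using z \<open>n = 1\<close> by simp
            then have "z = y" using d_0 zV V by blast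
            then show ?thesis using False yy by blast
          qed
        next
          case (Suc k)
          obtain t where t: "A x1 t" "d t w = k"
            using d_Suc[of x1 w k] V wV Suc d_sym[of w x1] by metis
          have tV: "t \<in> V" using t adj_V2 by blast
          have "d t y \<le> Suc k" "d t (u y) \<le> Suc k"
            using d_triangle[of t w y] d_triangle[of t w "u y"] t w tV wV V d_adj[of w] by auto
          moreover have "n \<le> Suc (d t y)" "n \<le> Suc (d t (u y))"
            using d_adj_le[OF t(1), of y] d_adj_le[OF t(1), of "u y"] V n Sn'[of x1] by (auto simp: S_def)
          ultimately show ?thesis using t w Suc by (intro exI[of _ t]) auto
        qed
      qed
      then obtain w where w: "A x1 w" "Suc (d w y) = n" "Suc (d w (u y)) = n" by blast
      have wV: "w \<in> V" "u w \<in> V" using w adj_V2 u_V by blast+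
      have wz: "w = z \<or> A w z" using IC[OF V(3) w(1), of z] w z n zx adj_sym by auto
      have wuz: "w = u z \<or> A w (u z)"
        using IC[OF V(6) w(1), of "u z"] w uzn Sn'[of x1] uzS[of x1] adj_sym by (auto simp: S_def)
      have wzz: "A w z" "A w (u z)" using wz wuz False adj_sym by metis+
      \<comment> \<open>The vertex \<open>w\<close> is adjacent to both \<open>z\<close> and
        \<open>u z\<close>, and so is \<open>a\<close>. Since \<open>z\<close> and
        \<open>u z\<close> are neither equal nor adjacent, the quadrangle
        \<open>a, z, w, u z\<close> has its other diagonal.\<close>
      have wS: "A w a" if "a \<in> S" for a
      proof -
        have "d a y = n" using True that by blast
        then have "a \<noteq> w" using w by auto
        then show ?thesis
          using quadrangle_diagonal[of a z w "u z"] z uzS wzz that False adj_sym by blast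
      qed
      have uwS: "A (u w) a" if "a \<in> S" for a
        using u_adj[OF wS[OF uS[OF that]]] u_inv[of a] SI I_V that by auto
      \<comment> \<open>Being closer to \<open>u y\<close> makes the image of \<open>w\<close>
        closer to \<open>y\<close>, so \<open>w\<close> and \<open>u w\<close> are two predecessors
        of \<open>x1\<close> as seen from \<open>y\<close>.\<close>
      have "Suc (d (u w) y) = n" using d_u_swap[of w y] wV V w by simp
      then have "w = u w \<or> A w (u w)"
        using IC[OF V(3) w(1), of "u w"] w n uwS[of x1] adj_sym by (auto simp: S_def)
      then have "w \<in> I" using wV adj_sym by (auto simp: I_def)
      moreover have "A w x1" "A w x2" using wS by (auto simp: S_def)
      ultimately show ?thesis using w by blast
    qed
  qed
qed

lemma I_path:
  assumes "x \<in> I" "y \<in> I"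
  shows "((\<lambda>a b. A a b \<and> a \<in> I \<and> b \<in> I) ^^ d x y) x y"
  using assms(1)
proof (induction "d x y" arbitrary: x)
  case 0
  then have "x = y" using d_0 I_V assms by metis
  then show ?case by simp
next
  case (Suc n)
  obtain z where z: "z \<in> I" "A z x" "Suc (d z y) = d x y"
    using I_down[OF Suc.prems Suc.prems _ assms(2), of "d x y"] Suc.hyps(2) by auto
  then have n: "n = d z y" using Suc.hyps(2) by simp
  have "((\<lambda>a b. A a b \<and> a \<in> I \<and> b \<in> I) ^^ d z y) z y" by (rule Suc.hyps(1)[OF n z(1)])
  then show ?case using z n Suc.hyps(2) Suc.prems adj_sym by (metis (mono_tags, lifting) relpowp_Suc_I2)
qed

definition AI where "AI a b \<longleftrightarrow> A a b \<and> a \<in> I \<and> b \<in> I"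

lemma gdist_AI: assumes "x \<in> I" "y \<in> I" shows "gdist AI x y = d x y"
proof -
  have p: "(AI ^^ d x y) x y" using I_path[OF assms] by (simp add: AI_def[abs_def])
  have "(A ^^ n) x y" if "(AI ^^ n) x y" for n
    using relpowp_mono[of AI A n x y] that by (auto simp: AI_def)
  then have "(A ^^ gdist AI x y) x y" unfolding gdist_def using p by (metis LeastI)
  then show ?thesis using p d_le unfolding gdist_def by (metis (no_types, lifting) Least_le le_antisym)
qed

text \<open>The triangle condition needs its common neighbour inside \<open>I\<close>, which is why
  \<open>I_down\<close> treats two vertices at once. The interval condition passes to
  \<open>I\<close> because distances agree.\<close>

lemma bridged_I: "weakly_bridged_graph I AI"
proof
  show "AI b a" if "AI a b" for a b using that adj_sym by (auto simp: AI_def)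
  show "\<not> AI a a" for a by (auto simp: AI_def adj_irrefl)
  show "a \<in> I" if "AI a b" for a b using that by (auto simp: AI_def)
  show "\<exists>n. (AI ^^ n) a b" if "a \<in> I" "b \<in> I" for a b
    using I_path[OF that] by (auto simp: AI_def[abs_def])
  show "\<exists>c. AI c a \<and> AI c b \<and> Suc (gdist AI c y) = gdist AI a y"
    if "y \<in> I" "AI a b" "gdist AI a y = gdist AI b y" for y a b
  proof -
    have ab: "a \<in> I" "b \<in> I" "A a b" using that by (auto simp: AI_def)
    then have "0 < d a y" using that gdist_AI d_0[of a y] d_0[of b y] I_V adj_irrefl by (metis gr0I)
    then show ?thesis using I_down[OF ab(1,2) _ that(1), of "d a y"] that ab gdist_AI
      by (auto simp: AI_def)
  qed
  show "a = b \<or> AI a b" if "y \<in> I" "AI m a" "AI m b" "Suc (gdist AI a y) = gdist AI m y"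
    "Suc (gdist AI b y) = gdist AI m y" for y m a b
    using that IC[of y m a b] I_V gdist_AI by (auto simp: AI_def)
qed

end

section \<open>Points and continuous maps of the realization\<close>

definition supp :: "('a \<Rightarrow> real) \<Rightarrow> 'a set" where
  "supp \<alpha> = {v. \<alpha> v \<noteq> 0}"

definition vertex_point :: "'a \<Rightarrow> 'a \<Rightarrow> real" where
  "vertex_point v = (\<lambda>w. if w = v then 1 else 0)"

lemma closed_simplex_nonneg: "\<alpha> \<in> closed_simplex \<sigma> \<Longrightarrow> 0 \<le> \<alpha> v"
  by (simp add: closed_simplex_def)

lemma closed_simplex_supp: "\<alpha> \<in> closed_simplex \<sigma> \<Longrightarrow> supp \<alpha> \<subseteq> \<sigma>"
  by (auto simp: closed_simplex_def supp_def)

lemma closed_simplex_pos: "\<alpha> \<in> closed_simplex \<sigma> \<Longrightarrow> 0 < \<alpha> v \<longleftrightarrow> v \<in> supp \<alpha>"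
  using closed_simplex_nonneg[of \<alpha> \<sigma> v] by (auto simp: supp_def)

lemma closed_simplex_in_supp:
  assumes "\<alpha> \<in> closed_simplex \<sigma>" "finite \<sigma>"
  shows "\<alpha> \<in> closed_simplex (supp \<alpha>)" "supp \<alpha> \<noteq> {}"
proof -
  have "(\<Sum>v\<in>supp \<alpha>. \<alpha> v) = (\<Sum>v\<in>\<sigma>. \<alpha> v)"
    using assms closed_simplex_supp[OF assms(1)] by (intro sum.mono_neutral_left) (auto simp: supp_def)
  then have s: "(\<Sum>v\<in>supp \<alpha>. \<alpha> v) = 1" using assms by (simp add: closed_simplex_def)
  then show "\<alpha> \<in> closed_simplex (supp \<alpha>)"
    using assms by (auto simp: closed_simplex_def supp_def)
  show "supp \<alpha> \<noteq> {}" using s by auto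
qed

lemma closed_closed_simplex:
  assumes "finite \<sigma>" shows "closed (closed_simplex \<sigma> :: ('a \<Rightarrow> real) set)"
proof -
  have "closed_simplex \<sigma> = (\<Inter>v. {\<alpha>. 0 \<le> \<alpha> v}) \<inter> (\<Inter>v\<in>-\<sigma>. {\<alpha>. \<alpha> v = 0}) \<inter> {\<alpha>. (\<Sum>v\<in>\<sigma>. \<alpha> v) = (1::real)}"
    by (auto simp: closed_simplex_def)
  moreover have "closed {\<alpha> :: 'a \<Rightarrow> real. 0 \<le> \<alpha> v}" for v
    by (intro closed_Collect_le continuous_on_product_coordinates continuous_on_const)
  moreover have "closed {\<alpha> :: 'a \<Rightarrow> real. \<alpha> v = 0}" for v
    by (intro closed_Collect_eq continuous_on_product_coordinates continuous_on_const)
  moreover have "closed {\<alpha> :: 'a \<Rightarrow> real. (\<Sum>v\<in>\<sigma>. \<alpha> v) = 1}"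
    by (intro closed_Collect_eq continuous_on_sum continuous_on_product_coordinates continuous_on_const)
  ultimately show ?thesis by (simp add: closed_INT closed_Int)
qed

lemma closed_finite_fun:
  fixes S :: "('a \<Rightarrow> real) set"
  assumes "finite S" shows "closed S"
proof -
  have "closed {\<alpha>}" for \<alpha> :: "'a \<Rightarrow> real"
  proof -
    have "{\<alpha>} = (\<Inter>v. {\<beta>. \<beta> v = \<alpha> v})" by auto
    moreover have "closed {\<beta> :: 'a \<Rightarrow> real. \<beta> v = \<alpha> v}" for v
      by (intro closed_Collect_eq continuous_on_product_coordinates continuous_on_const)
    ultimately show ?thesis by (simp add: closed_INT)
  qed
  then have "closed (\<Union>\<alpha>\<in>S. {\<alpha>})" using assms by (intro closed_UN) auto
  then show ?thesis by simp
qed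

locale simplicial_complex =
  fixes K :: "'a set set"
  assumes K: "abstract_complex K"
begin

lemma K_finite: "\<sigma> \<in> K \<Longrightarrow> finite \<sigma>"
  using K by (auto simp: abstract_complex_def)

lemma K_nonempty: "\<sigma> \<in> K \<Longrightarrow> \<sigma> \<noteq> {}"
  using K by (auto simp: abstract_complex_def)

lemma K_sub: "\<sigma> \<in> K \<Longrightarrow> \<tau> \<subseteq> \<sigma> \<Longrightarrow> \<tau> \<noteq> {} \<Longrightarrow> \<tau> \<in> K"
  using K unfolding abstract_complex_def by blast

lemma verts_iff: "v \<in> verts K \<longleftrightarrow> {v} \<in> K"
  using K_sub by (auto simp: verts_def)

abbreviation T where "T \<equiv> realization K"

lemma carrier_supp:
  assumes "\<alpha> \<in> realization_carrier K"
  shows "supp \<alpha> \<in> K" "\<alpha> \<in> closed_simplex (supp \<alpha>)"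
proof -
  obtain \<sigma> where s: "\<sigma> \<in> K" "\<alpha> \<in> closed_simplex \<sigma>" using assms by (auto simp: realization_carrier_def)
  show "\<alpha> \<in> closed_simplex (supp \<alpha>)" using closed_simplex_in_supp s K_finite by blast
  show "supp \<alpha> \<in> K"
    using K_sub[OF s(1) closed_simplex_supp[OF s(2)]] closed_simplex_in_supp(2)[OF s(2)] K_finite s by blast
qed

lemma carrier_I: "\<sigma> \<in> K \<Longrightarrow> \<alpha> \<in> closed_simplex \<sigma> \<Longrightarrow> \<alpha> \<in> realization_carrier K"
  by (auto simp: realization_carrier_def)

lemma openin_Int_carrier:
  assumes "open U" shows "openin T (U \<inter> realization_carrier K)"
  unfolding openin_realization
proof (intro conjI ballI)
  fix \<sigma> assume "\<sigma> \<in> K"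
  then have "U \<inter> realization_carrier K \<inter> closed_simplex \<sigma> = closed_simplex \<sigma> \<inter> U"
    by (auto simp: realization_carrier_def)
  then show "openin (top_of_set (closed_simplex \<sigma>)) (U \<inter> realization_carrier K \<inter> closed_simplex \<sigma>)"
    using assms by auto
qed simp

lemma openin_star: "openin T {\<alpha>\<in>realization_carrier K. 0 < \<alpha> v}"
proof -
  have "open {\<alpha> :: 'a \<Rightarrow> real. 0 < \<alpha> v}"
    by (intro open_Collect_less continuous_on_product_coordinates continuous_on_const)
  from openin_Int_carrier[OF this] show ?thesis by (simp add: Int_def conj_commute)
qed

text \<open>The weak topology is finer than the one induced by the product topology; this makes
  barycentric coordinates continuous.\<close>

lemma continuous_map_to_euclidean:
  assumes "continuous_map A T g" shows "continuous_map A euclidean g"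
  unfolding continuous_map
proof (intro conjI allI impI)
  show "g ` topspace A \<subseteq> topspace euclidean" by simp
  fix U :: "('a \<Rightarrow> real) set" assume "openin euclidean U"
  then have "open U" using open_openin by blast
  then have "openin A {x \<in> topspace A. g x \<in> U \<inter> realization_carrier K}"
    by (rule openin_continuous_map_preimage[OF assms openin_Int_carrier])
  moreover have "g x \<in> realization_carrier K" if "x \<in> topspace A" for x
    using assms that topspace_realization unfolding continuous_map by blast
  ultimately show "openin A {x \<in> topspace A. g x \<in> U}" by (metis (no_types, lifting) Collect_cong IntD1 IntI)
qed

lemma closedin_realization:
  assumes "C \<subseteq> realization_carrier K"
    and "\<And>\<sigma>. \<sigma> \<in> K \<Longrightarrow> closed (C \<inter> closed_simplex \<sigma>)"
  shows "closedin T C"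
  unfolding closedin_def topspace_realization openin_realization
proof (intro conjI ballI)
  fix \<sigma> assume s: "\<sigma> \<in> K"
  have "(realization_carrier K - C) \<inter> closed_simplex \<sigma> = closed_simplex \<sigma> \<inter> - (C \<inter> closed_simplex \<sigma>)"
    using s by (auto simp: realization_carrier_def)
  then show "openin (top_of_set (closed_simplex \<sigma>)) ((realization_carrier K - C) \<inter> closed_simplex \<sigma>)"
    using assms(2)[OF s] by (metis open_Compl openin_open_Int)
qed (use assms in auto)

lemma closed_Int_simplex:
  assumes "closedin T C" "\<sigma> \<in> K" shows "closed (C \<inter> closed_simplex \<sigma>)"
proof -
  have "openin (top_of_set (closed_simplex \<sigma>)) ((realization_carrier K - C) \<inter> closed_simplex \<sigma>)"
    using assms unfolding closedin_def topspace_realization openin_realization by blast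
  then obtain U where U: "open U" "(realization_carrier K - C) \<inter> closed_simplex \<sigma> = closed_simplex \<sigma> \<inter> U"
    by (auto simp: openin_open)
  have "C \<inter> closed_simplex \<sigma> = closed_simplex \<sigma> \<inter> - U"
    using U(2) carrier_I[OF assms(2)] by blast
  then show ?thesis using U(1) closed_closed_simplex K_finite[OF assms(2)] by auto
qed

text \<open>On finitely many simplices the two topologies agree: the preimage of a closed set is a
  finite union of preimages of closed sets.\<close>

lemma continuous_map_finite_subcomplex:
  assumes g: "continuous_map A euclidean g" and F: "finite F" "F \<subseteq> K"
    and gF: "\<And>x. x \<in> topspace A \<Longrightarrow> \<exists>\<sigma>\<in>F. g x \<in> closed_simplex \<sigma>"
  shows "continuous_map A T g"
  unfolding continuous_map_closedin topspace_realization
proof (intro conjI allI impI)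
  show "g \<in> topspace A \<rightarrow> realization_carrier K" using gF F carrier_I by blast
  fix C assume C: "closedin T C"
  have "{x \<in> topspace A. g x \<in> C} = (\<Union>\<sigma>\<in>F. {x \<in> topspace A. g x \<in> C \<inter> closed_simplex \<sigma>})"
    using gF by auto
  moreover have "closedin A {x \<in> topspace A. g x \<in> C \<inter> closed_simplex \<sigma>}" if "\<sigma> \<in> F" for \<sigma>
    using closedin_continuous_map_preimage[OF g] closed_Int_simplex[OF C] F that closed_closedin by blast
  then have "closedin A (\<Union>\<sigma>\<in>F. {x \<in> topspace A. g x \<in> C \<inter> closed_simplex \<sigma>})"
    using F by (intro closedin_Union) blast+
  ultimately show "closedin A {x \<in> topspace A. g x \<in> C}" by simp
qed

text \<open>Choose one point of \<open>C\<close> for each support. Every simplex contains only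
  finitely many of these points, so all sets of them are closed, and compactness makes them finite
  in number.\<close>

lemma compactin_finite_supp:
  assumes "compactin T C" shows "finite (supp ` C)"
proof -
  have CK: "C \<subseteq> realization_carrier K" using assms topspace_realization unfolding compactin_def by metis
  have "\<forall>\<tau>\<in>supp ` C. \<exists>a. a \<in> C \<and> supp a = \<tau>" by auto
  then obtain g where g: "\<And>\<tau>. \<tau> \<in> supp ` C \<Longrightarrow> g \<tau> \<in> C \<and> supp (g \<tau>) = \<tau>" by metis
  define D where "D = g ` supp ` C"
  have DC: "D \<subseteq> C" using g by (auto simp: D_def)
  have D_supp: "a = b" if "a \<in> D" "b \<in> D" "supp a = supp b" for a b
    using that g unfolding D_def by (metis imageE)
  have cl: "openin T (realization_carrier K - B)" if "B \<subseteq> D" for B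
  proof -
    have "closed (B \<inter> closed_simplex \<sigma>)" if s: "\<sigma> \<in> K" for \<sigma>
    proof (rule closed_finite_fun, rule finite_subset)
      show "B \<inter> closed_simplex \<sigma> \<subseteq> g ` Pow \<sigma>"
      proof
        fix a assume a: "a \<in> B \<inter> closed_simplex \<sigma>"
        then obtain \<tau> where t: "\<tau> \<in> supp ` C" "a = g \<tau>" using \<open>B \<subseteq> D\<close> unfolding D_def by blast
        then have "\<tau> = supp a" using g by simp
        then have "\<tau> \<in> Pow \<sigma>" using a closed_simplex_supp[of a \<sigma>] by blast
        then show "a \<in> g ` Pow \<sigma>" using t by blast
      qed
      show "finite (g ` Pow \<sigma>)" using K_finite[OF s] by blast
    qed
    then have "closedin T B" using that DC CK by (intro closedin_realization) auto
    then show ?thesis by (simp add: closedin_def topspace_realization)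
  qed
  \<comment> \<open>Each of these open sets contains at most one chosen point, namely
    \<open>x\<close>.\<close>
  define U where "U x = realization_carrier K - (D - {x})" for x
  have "\<exists>\<F>. finite \<F> \<and> \<F> \<subseteq> U ` C \<and> C \<subseteq> \<Union>\<F>"
  proof -
    have "\<forall>V\<in>U ` C. openin T V" using cl by (auto simp: U_def)
    moreover have "C \<subseteq> \<Union>(U ` C)" using CK by (auto simp: U_def)
    ultimately show ?thesis using assms unfolding compactin_def by blast
  qed
  then obtain S where S: "finite S" "S \<subseteq> C" "C \<subseteq> (\<Union>x\<in>S. U x)"
    by (metis finite_subset_image)
  have "D \<subseteq> S" using S(3) DC unfolding U_def by blast
  then have "finite D" using S finite_subset by blast
  moreover have "supp ` C \<subseteq> supp ` D"
  proof
    fix \<tau> assume t: "\<tau> \<in> supp ` C"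
    then have "g \<tau> \<in> D" "supp (g \<tau>) = \<tau>" using g by (auto simp: D_def)
    then show "\<tau> \<in> supp ` D" by blast
  qed
  ultimately show ?thesis using finite_surj by blast
qed

lemma pathin_continuous: "pathin T p \<Longrightarrow> continuous_on {0..1} p"
  using continuous_map_to_euclidean unfolding pathin_def by fastforce

lemma pathin_carrier: "pathin T p \<Longrightarrow> t \<in> {0..1} \<Longrightarrow> p t \<in> realization_carrier K"
  unfolding pathin_def continuous_map topspace_realization by auto

lemma pathin_finite_supp: "pathin T p \<Longrightarrow> finite (supp ` p ` {0..1})"
  using image_compactin[of "top_of_set {0..1}" "{0..1}" T p] compactin_finite_supp
  by (simp add: pathin_def compactin_subtopology)

text \<open>Simplices are convex, and \<open>F\<close> being finite makes the affine homotopy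
  continuous for the weak topology.\<close>

lemma homotopic_straight_line:
  fixes p q :: "real \<Rightarrow> 'a \<Rightarrow> real"
  assumes p: "continuous_on {0..1} p" "p 1 = p 0" and q: "continuous_on {0..1} q" "q 1 = q 0"
    and F: "finite F" "F \<subseteq> K"
    and pqF: "\<And>t. t \<in> {0..1} \<Longrightarrow> \<exists>\<sigma>\<in>F. p t \<in> closed_simplex \<sigma> \<and> q t \<in> closed_simplex \<sigma>"
  shows "homotopic_with (\<lambda>r. r 1 = r 0) (top_of_set {0..1}) T p q"
proof -
  define h :: "real \<times> real \<Rightarrow> 'a \<Rightarrow> real"
    where "h x = (\<lambda>v. (1 - fst x) * p (snd x) v + fst x * q (snd x) v)" for x
  have pv: "continuous_on ({0..1} \<times> {0..1}) (\<lambda>x. p (snd x) v)" for v :: 'a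
  proof (rule continuous_on_compose2[where g = "\<lambda>t. p t v" and f = snd and t = "{0..1}"])
    show "continuous_on {0..1} (\<lambda>t. p t v)" by (rule continuous_on_product_then_coordinatewise[OF p(1)])
  qed (auto intro: continuous_intros)
  have qv: "continuous_on ({0..1} \<times> {0..1}) (\<lambda>x. q (snd x) v)" for v :: 'a
  proof (rule continuous_on_compose2[where g = "\<lambda>t. q t v" and f = snd and t = "{0..1}"])
    show "continuous_on {0..1} (\<lambda>t. q t v)" by (rule continuous_on_product_then_coordinatewise[OF q(1)])
  qed (auto intro: continuous_intros)
  have "continuous_on ({0..1} \<times> {0..1}) h"
    unfolding h_def by (intro continuous_on_coordinatewise_then_product continuous_intros pv qv)
  then have "continuous_map (top_of_set ({0..1} \<times> {0..1})) euclidean h" by simp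
  then have "continuous_map (top_of_set ({0..1} \<times> {0..1})) T h"
  proof (rule continuous_map_finite_subcomplex[OF _ F])
    fix x :: "real \<times> real" assume "x \<in> topspace (top_of_set ({0..1} \<times> {0..1}))"
    then have x: "0 \<le> fst x" "fst x \<le> 1" "snd x \<in> {0..1}" by auto
    obtain \<sigma> where s: "\<sigma> \<in> F" "p (snd x) \<in> closed_simplex \<sigma>" "q (snd x) \<in> closed_simplex \<sigma>" using pqF x by blast
    then have "h x \<in> closed_simplex \<sigma>"
      using x by (auto simp: closed_simplex_def h_def sum.distrib sum_distrib_left[symmetric])
    then show "\<exists>\<sigma>\<in>F. h x \<in> closed_simplex \<sigma>" using s by blast
  qed
  then have "continuous_map (prod_topology (top_of_set {0..1}) (top_of_set {0..1})) T h" by simp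
  then show ?thesis
    unfolding homotopic_with_def using p q by (intro exI[of _ h]) (auto simp: h_def)
qed

end

section \<open>Simplicial loops\<close>

text \<open>Writing a polygon as a sum of shifted tent functions gives its continuity without gluing
  affine pieces.\<close>

definition hat :: "real \<Rightarrow> real" where
  "hat x = max 0 (1 - \<bar>x\<bar>)"

text \<open>The loop through the vertices \<open>c 0, \<dots>, c n\<close> that is affine on each of the
  intervals of length \<open>1 / n\<close>.\<close>

definition polygon :: "nat \<Rightarrow> (nat \<Rightarrow> 'a) \<Rightarrow> real \<Rightarrow> 'a \<Rightarrow> real" where
  "polygon n c t = (\<lambda>v. \<Sum>i\<le>n. hat (real n * t - real i) * vertex_point (c i) v)"

lemma continuous_on_polygon: "continuous_on S (polygon n c)"
  unfolding polygon_def hat_def by (intro continuous_on_coordinatewise_then_product continuous_intros)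

lemma polygon_eq:
  assumes k: "k < n" "real k \<le> real n * t" "real n * t \<le> real (Suc k)"
  shows "polygon n c t v = (1 - (real n * t - real k)) * vertex_point (c k) v
    + (real n * t - real k) * vertex_point (c (Suc k)) v"
proof -
  have z: "hat (real n * t - real i) = 0" if "i \<noteq> k" "i \<noteq> Suc k" for i
  proof -
    have "i < k \<or> Suc k < i" using that by linarith
    then have "real i \<le> real k - 1 \<or> real (Suc k) + 1 \<le> real i" by linarith
    then show ?thesis using k by (auto simp: hat_def)
  qed
  have "polygon n c t v = (\<Sum>i\<in>{k, Suc k}. hat (real n * t - real i) * vertex_point (c i) v)"
    unfolding polygon_def using k z by (intro sum.mono_neutral_right) auto
  also have "\<dots> = hat (real n * t - real k) * vertex_point (c k) v
      + hat (real n * t - real (Suc k)) * vertex_point (c (Suc k)) v" by simp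
  also have "hat (real n * t - real k) = 1 - (real n * t - real k)" using k by (simp add: hat_def)
  also have "hat (real n * t - real (Suc k)) = real n * t - real k" using k by (simp add: hat_def)
  finally show ?thesis .
qed

lemma vertex_point_in: "v \<in> \<sigma> \<Longrightarrow> finite \<sigma> \<Longrightarrow> vertex_point v \<in> closed_simplex \<sigma>"
  by (auto simp: closed_simplex_def vertex_point_def)

lemma supp_vertex_point [simp]: "supp (vertex_point v) = {v}"
  by (auto simp: supp_def vertex_point_def)

lemma polygon_in:
  assumes k: "k < n" "real k \<le> real n * t" "real n * t \<le> real (Suc k)"
    and "c k \<in> \<sigma>" "c (Suc k) \<in> \<sigma>" "finite \<sigma>"
  shows "polygon n c t \<in> closed_simplex \<sigma>"
proof -
  have 1: "(\<Sum>v\<in>\<sigma>. vertex_point (c k) v) = 1" "(\<Sum>v\<in>\<sigma>. vertex_point (c (Suc k)) v) = 1"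
    using vertex_point_in[OF assms(4,6)] vertex_point_in[OF assms(5,6)] by (simp_all add: closed_simplex_def)
  have "(\<Sum>v\<in>\<sigma>. polygon n c t v) = 1"
    unfolding polygon_eq[OF k] sum.distrib sum_distrib_left[symmetric] 1 by simp
  moreover have "0 \<le> polygon n c t v" for v
    unfolding polygon_eq[OF k] using k by (intro add_nonneg_nonneg mult_nonneg_nonneg) (auto simp: vertex_point_def)
  moreover have "polygon n c t v = 0" if "v \<notin> \<sigma>" for v
    unfolding polygon_eq[OF k] using that assms by (auto simp: vertex_point_def)
  ultimately show ?thesis by (auto simp: closed_simplex_def)
qed

lemma polygon_0: "0 < n \<Longrightarrow> polygon n c 0 = vertex_point (c 0)"
  using polygon_eq[of 0 n 0 c] by auto

lemma polygon_1: assumes "0 < n" shows "polygon n c 1 = vertex_point (c n)"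
proof -
  obtain m where m: "n = Suc m" using assms by (cases n) auto
  show ?thesis using polygon_eq[of m n 1 c] by (auto simp: m)
qed

lemma interval_index:
  assumes "0 < n" "t \<in> {0..1}"
  obtains k where "k < n" "real k \<le> real n * t" "real n * t \<le> real (Suc k)"
proof (cases "t = 1")
  case True
  then show ?thesis using assms that[of "n - 1"] by (auto simp: of_nat_diff)
next
  case False
  define k where "k = nat \<lfloor>real n * t\<rfloor>"
  have nn: "0 \<le> real n * t" using assms by simp
  have k: "real k \<le> real n * t" "real n * t < real k + 1"
    using nn by (simp_all add: k_def)
  have "real n * t < real n" using assms False by (simp add: mult_less_cancel_left1)
  then have "k < n" using k by linarith
  then show ?thesis using k that by force
qed

context simplicial_complex
begin

text \<open>Consecutive vertices may coincide, which makes room for stuttering and for constant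
  stretches.\<close>

definition simplicial_loop :: "nat \<Rightarrow> (nat \<Rightarrow> 'a) \<Rightarrow> bool" where
  "simplicial_loop n c \<longleftrightarrow> 0 < n \<and> c n = c 0 \<and> (\<forall>k<n. {c k, c (Suc k)} \<in> K)"

abbreviation free_homotopic where
  "free_homotopic \<equiv> homotopic_with (\<lambda>r. r 1 = r 0) (top_of_set {0..1}) T"

lemma polygon_closed: "simplicial_loop n c \<Longrightarrow> polygon n c 1 = polygon n c 0"
  by (simp add: simplicial_loop_def polygon_0 polygon_1)

lemma loop_vertex: "simplicial_loop n c \<Longrightarrow> i \<le> n \<Longrightarrow> {c i} \<in> K"
proof -
  assume a: "simplicial_loop n c" "i \<le> n"
  show "{c i} \<in> K"
  proof (cases "i = n")
    case True
    then have "c i = c 0" "{c 0, c (Suc 0)} \<in> K" using a by (auto simp: simplicial_loop_def)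
    then show ?thesis using K_sub[of "{c 0, c (Suc 0)}" "{c i}"] by auto
  next
    case False
    then have "{c i, c (Suc i)} \<in> K" using a by (auto simp: simplicial_loop_def)
    then show ?thesis using K_sub[of "{c i, c (Suc i)}" "{c i}"] by auto
  qed
qed

lemma loop_edge_carrier:
  assumes "simplicial_loop n c" "t \<in> {0..1}"
  shows "\<exists>k<n. polygon n c t \<in> closed_simplex {c k, c (Suc k)}"
proof -
  obtain k where k: "k < n" "real k \<le> real n * t" "real n * t \<le> real (Suc k)"
    using interval_index[of n t] assms by (auto simp: simplicial_loop_def)
  then show ?thesis using polygon_in[of k n t c "{c k, c (Suc k)}"] by auto
qed

lemma pathin_polygon:
  assumes "simplicial_loop n c"
  shows "pathin T (polygon n c)"
  unfolding pathin_def
proof (rule continuous_map_finite_subcomplex)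
  show "continuous_map (top_of_set {0..1}) euclidean (polygon n c)" by (simp add: continuous_on_polygon)
  show "finite ((\<lambda>k. {c k, c (Suc k)}) ` {..<n})" by simp
  show "(\<lambda>k. {c k, c (Suc k)}) ` {..<n} \<subseteq> K" using assms by (auto simp: simplicial_loop_def)
  show "\<exists>\<sigma>\<in>(\<lambda>k. {c k, c (Suc k)}) ` {..<n}. polygon n c t \<in> closed_simplex \<sigma>"
    if "t \<in> topspace (top_of_set {0..1})" for t
    using loop_edge_carrier[OF assms, of t] that by auto
qed

lemma homotopic_parallel:
  assumes c: "simplicial_loop n c" and c': "simplicial_loop n c'"
    and sq: "\<And>k. k < n \<Longrightarrow> {c k, c (Suc k), c' k, c' (Suc k)} \<in> K"
  shows "free_homotopic (polygon n c) (polygon n c')"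
proof (rule homotopic_straight_line)
  let ?F = "(\<lambda>k. {c k, c (Suc k), c' k, c' (Suc k)}) ` {..<n}"
  show "finite ?F" by simp
  show "?F \<subseteq> K" using sq by auto
  fix t :: real assume "t \<in> {0..1}"
  then obtain k where k: "k < n" "real k \<le> real n * t" "real n * t \<le> real (Suc k)"
    using interval_index[of n t] c by (auto simp: simplicial_loop_def)
  have "polygon n c t \<in> closed_simplex {c k, c (Suc k), c' k, c' (Suc k)}"
    "polygon n c' t \<in> closed_simplex {c k, c (Suc k), c' k, c' (Suc k)}"
    by (rule polygon_in[OF k]; simp)+
  then show "\<exists>\<sigma>\<in>?F. polygon n c t \<in> closed_simplex \<sigma> \<and> polygon n c' t \<in> closed_simplex \<sigma>"
    using k by blast
qed (use c c' in \<open>auto simp: continuous_on_polygon polygon_closed\<close>)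

text \<open>Doubling every vertex prepares for replacing it by two different ones. At each time both
  polygons lie in the same edge of the original loop.\<close>

lemma homotopic_stutter:
  assumes c: "simplicial_loop n c"
  shows "simplicial_loop (2 * n) (\<lambda>i. c (i div 2))"
    and "free_homotopic (polygon n c) (polygon (2 * n) (\<lambda>i. c (i div 2)))"
proof -
  have k2: "Suc k div 2 = k div 2 \<or> Suc k div 2 = Suc (k div 2)" for k :: nat by linarith
  have e: "{c (k div 2), c (Suc k div 2)} \<in> K" if k: "k < 2 * n" for k
  proof -
    have kn: "k div 2 < n" using k by linarith
    then have "{c (k div 2), c (Suc (k div 2))} \<in> K" using c by (auto simp: simplicial_loop_def)
    then show ?thesis using k2[of k] K_sub[of "{c (k div 2), c (Suc (k div 2))}"] by auto
  qed
  then show c2: "simplicial_loop (2 * n) (\<lambda>i. c (i div 2))"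
    using c by (auto simp: simplicial_loop_def)
  show "free_homotopic (polygon n c) (polygon (2 * n) (\<lambda>i. c (i div 2)))"
  proof (rule homotopic_straight_line)
    let ?F = "(\<lambda>k. {c k, c (Suc k)}) ` {..<n}"
    show "finite ?F" by simp
    show "?F \<subseteq> K" using c by (auto simp: simplicial_loop_def)
    fix t :: real assume t: "t \<in> {0..1}"
    have "0 < 2 * n" using c by (auto simp: simplicial_loop_def)
    then obtain k where k: "k < 2 * n" "real k \<le> real (2 * n) * t" "real (2 * n) * t \<le> real (Suc k)"
      using interval_index[of "2 * n" t] t by blast
    define m where "m = k div 2"
    have "2 * m \<le> k" "Suc k \<le> 2 * Suc m" by (auto simp: m_def)
    then have "2 * real m \<le> real k" "real (Suc k) \<le> 2 * real (Suc m)"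
      by (metis of_nat_le_iff of_nat_mult of_nat_numeral)+
    then have m: "m < n" "real m \<le> real n * t" "real n * t \<le> real (Suc m)"
      using k by (auto simp: m_def)
    have "polygon n c t \<in> closed_simplex {c m, c (Suc m)}"
      by (rule polygon_in[OF m]; simp)
    moreover have "polygon (2 * n) (\<lambda>i. c (i div 2)) t \<in> closed_simplex {c m, c (Suc m)}"
      by (rule polygon_in[OF k]) (use k2[of k] in \<open>auto simp: m_def\<close>)
    ultimately show "\<exists>\<sigma>\<in>?F. polygon n c t \<in> closed_simplex \<sigma> \<and>
        polygon (2 * n) (\<lambda>i. c (i div 2)) t \<in> closed_simplex \<sigma>" using m by blast
  qed (use c c2 in \<open>auto simp: continuous_on_polygon polygon_closed\<close>)
qed

text \<open>The points with positive coordinate at \<open>v\<close> form the open star of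
  \<open>v\<close>. These stars cover the realization, so their preimages have a Lebesgue
  number.\<close>

lemma star_Lebesgue:
  fixes S :: "'b::metric_space set"
  assumes "compact S" and g: "continuous_map (top_of_set S) T g"
  obtains \<delta> where "0 < \<delta>" "\<And>A. A \<subseteq> S \<Longrightarrow> diameter A < \<delta> \<Longrightarrow> \<exists>v. \<forall>x\<in>A. 0 < g x v"
proof -
  have "\<exists>U. open U \<and> {x\<in>S. 0 < g x v} = S \<inter> U" for v
  proof -
    have "openin (top_of_set S) {x \<in> topspace (top_of_set S). g x \<in> {\<alpha>\<in>realization_carrier K. 0 < \<alpha> v}}"
      by (rule openin_continuous_map_preimage[OF g openin_star])
    moreover have "g x \<in> realization_carrier K" if "x \<in> S" for x
      using g that unfolding continuous_map topspace_realization by auto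
    then have "{x \<in> topspace (top_of_set S). g x \<in> {\<alpha>\<in>realization_carrier K. 0 < \<alpha> v}} = {x\<in>S. 0 < g x v}"
      by auto
    ultimately show ?thesis by (simp add: openin_open)
  qed
  then obtain U where U: "\<And>v. open (U v)" "\<And>v. {x\<in>S. 0 < g x v} = S \<inter> U v" by metis
  have "S \<subseteq> \<Union>(range U)"
  proof
    fix x assume x: "x \<in> S"
    then have c: "g x \<in> realization_carrier K"
      using g unfolding continuous_map topspace_realization by auto
    then obtain v where "v \<in> supp (g x)" using carrier_supp K_nonempty by blast
    then have "0 < g x v" using closed_simplex_pos[OF carrier_supp(2)[OF c]] by blast
    then show "x \<in> \<Union>(range U)" using U(2)[of v] x by auto
  qed
  then obtain \<delta> where d: "0 < \<delta>" "\<And>A. A \<subseteq> S \<Longrightarrow> diameter A < \<delta> \<Longrightarrow> \<exists>B\<in>range U. A \<subseteq> B"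
    using Lebesgue_number_lemma[OF assms(1), of "range U"] U(1) by blast
  have "\<exists>v. \<forall>x\<in>A. 0 < g x v" if A: "A \<subseteq> S" "diameter A < \<delta>" for A
  proof -
    obtain v where "A \<subseteq> U v" using d(2)[OF A] by blast
    then have "A \<subseteq> {x\<in>S. 0 < g x v}" using U(2) A by blast
    then show ?thesis by blast
  qed
  then show ?thesis using d(1) that by blast
qed

text \<open>The vertices are chosen such that at each time both ends of the current edge lie in the
  support of \<open>p t\<close>; loop and polygon then share this simplex.\<close>

lemma loop_homotopic_polygon:
  assumes p: "pathin T p" "p 1 = p 0"
  shows "\<exists>n c. simplicial_loop n c \<and> free_homotopic p (polygon n c)"
proof -
  have car: "p t \<in> realization_carrier K" if "t \<in> {0..1}" for t using pathin_carrier[OF p(1)] that .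
  obtain \<delta> where d: "0 < \<delta>" "\<And>A. A \<subseteq> {0..1} \<Longrightarrow> diameter A < \<delta> \<Longrightarrow> \<exists>v. \<forall>x\<in>A. 0 < p x v"
    using star_Lebesgue[of "{0..1}" p] p(1) unfolding pathin_def by auto
  \<comment> \<open>The polygon must close up, so one vertex is fixed for both ends;
    \<open>e0\<close> and \<open>e1\<close> keep \<open>p\<close> in its star near 0 and near
    1.\<close>
  obtain v where v: "0 < p 0 v"
    using closed_simplex_pos[OF carrier_supp(2)[OF car]] carrier_supp(1)[OF car] K_nonempty[of "supp (p 0)"] by force
  have cont: "continuous_on {0..1} (\<lambda>t. p t v)"
    by (rule continuous_on_product_then_coordinatewise[OF pathin_continuous[OF p(1)]])
  obtain e0 where e0: "0 < e0" "\<And>t. t \<in> {0..1} \<Longrightarrow> dist t 0 < e0 \<Longrightarrow> dist (p t v) (p 0 v) < p 0 v"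
    using continuous_on_iff[THEN iffD1, OF cont] v by (metis atLeastAtMost_iff order_refl zero_le_one)
  obtain e1 where e1: "0 < e1" "\<And>t. t \<in> {0..1} \<Longrightarrow> dist t 1 < e1 \<Longrightarrow> dist (p t v) (p 1 v) < p 0 v"
    using continuous_on_iff[THEN iffD1, OF cont] v by (metis atLeastAtMost_iff order_refl zero_le_one)
  \<comment> \<open>The windows \<open>W i\<close> have diameter at most 2 / n, and those at the
    ends reach 1 / n into the interval; 3 / n bounds both strictly.\<close>
  obtain n where n: "0 < n" "3 / real n < min \<delta> (min e0 e1)"
  proof -
    define e where "e = min \<delta> (min e0 e1)"
    have e: "0 < e" using d e0 e1 by (simp add: e_def)
    obtain n :: nat where n: "3 / e < real n" using reals_Archimedean2 by blast
    moreover have "0 < 3 / e" using e by simp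
    ultimately have "0 < real n" by linarith
    then have "3 / real n < e" using n e by (simp add: pos_divide_less_eq mult.commute)
    then show ?thesis using that[of n] \<open>0 < real n\<close> by (simp add: e_def)
  qed
  define W where "W i = {t\<in>{0..1}. \<bar>t - real i / real n\<bar> \<le> 1 / real n}" for i
  have "\<exists>w. (i = 0 \<or> i = n \<longrightarrow> w = v) \<and> (\<forall>t\<in>W i. 0 < p t w)" if "i \<le> n" for i
  proof -
    have sm: "1 / real n < e0" "1 / real n < e1" "2 / real n < \<delta>"
      using n by (auto intro: le_less_trans[rotated] simp: divide_right_mono)
    consider "i = 0" | "i = n" "i \<noteq> 0" | "i \<noteq> 0" "i \<noteq> n" by blast
    then show ?thesis
    proof cases
      case 1
      have "0 < p t v" if "t \<in> W i" for t
        using e0(2)[of t] that sm 1 by (auto simp: W_def dist_real_def)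
      then show ?thesis by blast
    next
      case 2
      have "0 < p t v" if "t \<in> W i" for t
        using e1(2)[of t] that sm 2 n p(2) by (auto simp: W_def dist_real_def)
      then show ?thesis by blast
    next
      case 3
      have "diameter (W i) \<le> 2 / real n"
      proof (rule diameter_le)
        show "norm (x - y) \<le> 2 / real n" if "x \<in> W i" "y \<in> W i" for x y
          using that by (auto simp: W_def)
      qed (use n in auto)
      then show ?thesis using d(2)[of "W i"] 3 sm by (force simp: W_def)
    qed
  qed
  then obtain c where c: "\<And>i. i \<le> n \<Longrightarrow> (i = 0 \<or> i = n \<longrightarrow> c i = v) \<and> (\<forall>t\<in>W i. 0 < p t (c i))"
    by metis
  have in_supp: "c k \<in> supp (p t)" "c (Suc k) \<in> supp (p t)"
    if k: "k < n" "real k \<le> real n * t" "real n * t \<le> real (Suc k)" and t: "t \<in> {0..1}" for k t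
  proof -
    have "real k / real n \<le> t" "t \<le> real (Suc k) / real n" using n k by (auto simp: field_simps)
    moreover have "real (Suc k) / real n = real k / real n + 1 / real n" by (simp add: add_divide_distrib)
    ultimately have "t \<in> W k" "t \<in> W (Suc k)" using t by (auto simp: W_def)
    then show "c k \<in> supp (p t)" "c (Suc k) \<in> supp (p t)"
      using c[of k] c[of "Suc k"] k by (auto simp: supp_def)
  qed
  have "{c k, c (Suc k)} \<in> K" if k: "k < n" for k
  proof -
    have t: "real k / real n \<in> {0..1}" using k by auto
    then have "{c k, c (Suc k)} \<subseteq> supp (p (real k / real n))"
      using in_supp[OF k, of "real k / real n"] k by auto
    then show ?thesis using carrier_supp(1)[OF car[OF t]] K_sub by blast
  qed
  then have loop: "simplicial_loop n c" using n c[of 0] c[of n] by (auto simp: simplicial_loop_def)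
  have "free_homotopic p (polygon n c)"
  proof (rule homotopic_straight_line)
    show "finite (supp ` p ` {0..1})" by (rule pathin_finite_supp[OF p(1)])
    show "supp ` p ` {0..1} \<subseteq> K" using carrier_supp(1) car by blast
    fix t :: real assume t: "t \<in> {0..1}"
    then obtain k where k: "k < n" "real k \<le> real n * t" "real n * t \<le> real (Suc k)"
      using interval_index[of n t] n by blast
    have "polygon n c t \<in> closed_simplex (supp (p t))"
      using polygon_in[OF k, of c "supp (p t)"] in_supp[OF k t] K_finite[OF carrier_supp(1)[OF car[OF t]]] by blast
    then show "\<exists>\<sigma>\<in>supp ` p ` {0..1}. p t \<in> closed_simplex \<sigma> \<and> polygon n c t \<in> closed_simplex \<sigma>"
      using carrier_supp(2)[OF car[OF t]] t by blast
  qed (use p n loop in \<open>auto simp: continuous_on_polygon polygon_closed pathin_continuous\<close>)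
  then show ?thesis using loop by blast
qed

end

section \<open>Simple connectivity of flag complexes with weakly bridged graph\<close>

locale weakly_bridged_complex = simplicial_complex +
  assumes flag: "flag_complex K"
    and bridged: "weakly_bridged_graph (verts K) (adjacent K)"
begin

sublocale weakly_bridged_graph "verts K" "adjacent K" by (rule bridged)

lemma clique_in_K:
  assumes "finite S" "S \<noteq> {}" "S \<subseteq> verts K" "\<And>a b. a \<in> S \<Longrightarrow> b \<in> S \<Longrightarrow> a = b \<or> adjacent K a b"
  shows "S \<in> K"
  using flag assms unfolding flag_complex_def by blast

lemma edge_in_K: "a \<in> verts K \<Longrightarrow> b \<in> verts K \<Longrightarrow> {a, b} \<in> K \<longleftrightarrow> a = b \<or> adjacent K a b"
  using verts_iff by (auto simp: adjacent_def)

text \<open>Each vertex at maximal distance from the base point is replaced by two of its neighbours closer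
  to the base point, one for each adjacent edge of the loop.\<close>

lemma polygon_contractible:
  assumes y: "y \<in> verts K" and c: "simplicial_loop n c" and "\<And>i. i \<le> n \<Longrightarrow> d (c i) y \<le> m"
  shows "free_homotopic (polygon n c) (\<lambda>_. vertex_point y)"
  using assms(2,3)
proof (induction m arbitrary: n c)
  case 0
  have cV: "c i \<in> verts K" if "i \<le> n" for i using loop_vertex[OF 0(1) that] verts_iff by blast
  have cy: "c i = y" if "i \<le> n" for i using 0(2)[OF that] d_0[OF cV[OF that] y] by simp
  show ?case
  proof (rule homotopic_straight_line)
    show "finite {{y}}" "{{y}} \<subseteq> K" using y verts_iff by auto
    fix t :: real assume "t \<in> {0..1}"
    then obtain k where "k < n" "polygon n c t \<in> closed_simplex {c k, c (Suc k)}"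
      using loop_edge_carrier[OF 0(1)] by blast
    then show "\<exists>\<sigma>\<in>{{y}}. polygon n c t \<in> closed_simplex \<sigma> \<and> vertex_point y \<in> closed_simplex \<sigma>"
      using cy[of k] cy[of "Suc k"] vertex_point_in[of y "{y}"] by simp
  qed (use 0(1) in \<open>auto simp: continuous_on_polygon polygon_closed\<close>)
next
  case (Suc m)
  have cV: "c i \<in> verts K" if "i \<le> n" for i using loop_vertex[OF Suc(2) that] verts_iff by blast
  have n: "0 < n" "c n = c 0" and ce: "\<And>k. k < n \<Longrightarrow> {c k, c (Suc k)} \<in> K"
    using Suc(2) by (auto simp: simplicial_loop_def)
  \<comment> \<open>The vertex \<open>e\<close> serves the edge from \<open>a\<close> to
    \<open>b\<close>: it lies on level \<open>m\<close>, next to each end on the top level and equal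
    to an end that is already lower.\<close>
  define P where "P a b e \<longleftrightarrow> e \<in> verts K \<and> d e y = m \<and> (if d a y = Suc m then adjacent K a e else e = a) \<and>
      (if d b y = Suc m then adjacent K b e else e = b)" for a b e
  have P_ex: "\<exists>e. P a b e" if ab: "{a, b} \<in> K" "d a y \<le> Suc m" "d b y \<le> Suc m" "d a y = Suc m \<or> d b y = Suc m" for a b
  proof -
    have V: "a \<in> verts K" "b \<in> verts K" using ab(1) by (auto simp: verts_def)
    have adj: "a = b \<or> adjacent K a b" using edge_in_K[OF V] ab by blast
    then have near: "d a y \<le> Suc (d b y)" "d b y \<le> Suc (d a y)" using d_nbr_cases[OF _ y, of a b] by auto
    consider "a = b" "d a y = Suc m" | "adjacent K a b" "d a y = Suc m" "d b y = Suc m"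
      | "adjacent K a b" "d a y = m" "d b y = Suc m" | "adjacent K a b" "d b y = m" "d a y = Suc m"
    proof (cases "a = b")
      case True
      then show ?thesis using that(1) ab(4) by auto
    next
      case False
      then show ?thesis using that(2-4) adj near ab(2-4) by linarith
    qed
    then show ?thesis
    proof cases
      case 1
      then obtain e where "adjacent K a e" "d e y = m" using d_Suc[of a y m] V y by blast
      then show ?thesis using 1 adj_V2 by (auto simp: P_def)
    next
      case 2
      then obtain e where "adjacent K e a" "adjacent K e b" "Suc (d e y) = Suc m"
        using TC[OF y 2(1)] by auto
      then have "P a b e" using 2 adj_V[of e a] adj_sym[of e a] adj_sym[of e b] by (simp add: P_def)
      then show ?thesis by blast
    next
      case 3
      then have "P a b a" using V adj_sym by (simp add: P_def)
      then show ?thesis by blast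
    next
      case 4
      then have "P a b b" using V by (simp add: P_def)
      then show ?thesis by blast
    qed
  qed
  define e where "e a b = (SOME e. P a b e)" for a b
  have eP: "P a b (e a b)" if "{a, b} \<in> K" "d a y \<le> Suc m" "d b y \<le> Suc m" "d a y = Suc m \<or> d b y = Suc m" for a b
    unfolding e_def using someI_ex[OF P_ex[OF that]] .
  \<comment> \<open>The cyclic predecessor: index 0 and index \<open>n\<close> stand for the same
    vertex and both get \<open>n - 1\<close>, so that the new loop closes up.\<close>
  define prv where "prv k = (if k = 0 then n - 1 else k - 1)" for k
  \<comment> \<open>The two copies of a top vertex go to the vertices serving the edge before it and
    the edge after it.\<close>
  define c' where "c' i = (let k = i div 2 in if d (c k) y \<le> m then c k
      else if even i then e (c (prv k)) (c k) else e (c (k mod n)) (c (Suc (k mod n))))" for i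
  have prvK: "{c (prv k), c k} \<in> K" and prvV: "prv k \<le> n" if "k \<le> n" for k
    using that ce[of "k - 1"] ce[of "n - 1"] n by (auto simp: prv_def split: if_splits)
  have even_c': "c' (2 * k) = (if d (c k) y \<le> m then c k else e (c (prv k)) (c k))" for k
    by (simp add: c'_def)
  have odd_c': "c' (Suc (2 * k)) = (if d (c k) y \<le> m then c k else e (c k) (c (Suc k)))" if "k < n" for k
    using that by (simp add: c'_def)
  have lev: "d (c k) y \<le> Suc m" if "k \<le> n" for k using Suc(3)[OF that] .
  have top: "d (c k) y = Suc m" if "k \<le> n" "\<not> d (c k) y \<le> m" for k using lev[OF that(1)] that by simp
  have even_prop: "c' (2 * k) \<in> verts K \<and> d (c' (2 * k)) y \<le> m \<and>
      (if d (c k) y \<le> m then c' (2 * k) = c k else adjacent K (c k) (c' (2 * k)) \<and> d (c' (2 * k)) y = m)" if k: "k \<le> n" for k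
    using eP[OF prvK[OF k] lev[OF prvV[OF k]] lev[OF k]] top[OF k] cV[OF k] k
    by (auto simp: even_c' P_def)
  have odd_prop: "c' (Suc (2 * k)) \<in> verts K \<and> d (c' (Suc (2 * k))) y \<le> m \<and>
      (if d (c k) y \<le> m then c' (Suc (2 * k)) = c k else adjacent K (c k) (c' (Suc (2 * k))) \<and> d (c' (Suc (2 * k))) y = m)" if k: "k < n" for k
    using eP[OF ce[OF k] lev lev] top[of k] cV[of k] k
    by (auto simp: odd_c' P_def)
  have link_prop: "if d (c k) y \<le> m \<and> d (c (Suc k)) y \<le> m then c' (Suc (2 * k)) = c k \<and> c' (2 * Suc k) = c (Suc k)
      else c' (Suc (2 * k)) = c' (2 * Suc k) \<and> (c' (2 * Suc k) = c (Suc k) \<or> adjacent K (c' (2 * Suc k)) (c (Suc k))) \<and>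
        (c' (2 * Suc k) = c k \<or> adjacent K (c' (2 * Suc k)) (c k))" if k: "k < n" for k
  proof -
    have pk: "prv (Suc k) = k" by (simp add: prv_def)
    have P: "P (c k) (c (Suc k)) (e (c k) (c (Suc k)))" if "\<not> (d (c k) y \<le> m \<and> d (c (Suc k)) y \<le> m)"
      using eP[OF ce[OF k] lev lev] top[of k] top[of "Suc k"] k that by auto
    define f where "f = e (c k) (c (Suc k))"
    note defs = even_c' odd_c'[OF k] pk f_def[symmetric]
    show ?thesis
    proof (cases "d (c k) y \<le> m \<and> d (c (Suc k)) y \<le> m")
      case True
      then show ?thesis unfolding defs by simp
    next
      case False
      then have f: "P (c k) (c (Suc k)) f" using P by (simp add: f_def)
      show ?thesis
      proof (cases "d (c k) y \<le> m")
        case True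
        then have "d (c (Suc k)) y = Suc m" "f = c k" "adjacent K f (c (Suc k))"
          using False top[of "Suc k"] k f adj_sym[of "c (Suc k)" f] by (auto simp: P_def)
        then show ?thesis unfolding defs using True by simp
      next
        case a: False
        then have a': "d (c k) y = Suc m" "adjacent K f (c k)"
          using top[of k] k f adj_sym[of "c k" f] by (auto simp: P_def)
        show ?thesis
        proof (cases "d (c (Suc k)) y \<le> m")
          case True
          then have "f = c (Suc k)" using f by (auto simp: P_def)
          then show ?thesis unfolding defs using a a' True by simp
        next
          case b: False
          then have "adjacent K f (c (Suc k))"
            using top[of "Suc k"] k f adj_sym[of "c (Suc k)" f] by (auto simp: P_def)
          then show ?thesis unfolding defs using a a' b by simp
        qed
      qed
    qed
  qed
  have c2: "simplicial_loop (2 * n) (\<lambda>i. c (i div 2))" by (rule homotopic_stutter[OF Suc(2)])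
  have sq: "{c (i div 2), c (Suc i div 2), c' i, c' (Suc i)} \<in> K" if i: "i < 2 * n" for i
  proof -
    define k where "k = i div 2"
    have k: "k < n" using i by (auto simp: k_def)
    \<comment> \<open>Between two copies of \<open>c k\<close>, the two new vertices are
      predecessors of \<open>c k\<close> and \<open>IC\<close> joins them. Between
      \<open>c k\<close> and \<open>c (Suc k)\<close> with a top end, the new vertex is
      shared.\<close>
    consider "i = 2 * k" | "i = Suc (2 * k)" by (metis k_def even_two_times_div_two odd_two_times_div_two_succ Suc_eq_plus1)
    then show ?thesis
    proof cases
      case 1
      have "c' (2 * k) = c' (Suc (2 * k)) \<or> adjacent K (c' (2 * k)) (c' (Suc (2 * k)))"
        using IC[OF y, of "c k" "c' (2 * k)" "c' (Suc (2 * k))"] even_prop[of k] odd_prop[of k] k top[of k]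
        by (auto split: if_splits)
      then have "{c k, c' (2 * k), c' (Suc (2 * k))} \<in> K"
        using even_prop[of k] odd_prop[of k] k cV[of k] adj_sym
        by (intro clique_in_K) (auto split: if_splits)
      then show ?thesis using 1 by simp
    next
      case 2
      have "{c k, c (Suc k), c' (Suc (2 * k)), c' (2 * Suc k)} \<in> K"
      proof (cases "d (c k) y \<le> m \<and> d (c (Suc k)) y \<le> m")
        case True
        then show ?thesis using link_prop[OF k] ce[OF k] by (simp add: insert_commute)
      next
        case False
        have "c k = c (Suc k) \<or> adjacent K (c k) (c (Suc k))"
          using ce[OF k] edge_in_K cV[of k] cV[of "Suc k"] k by auto
        then have "{c k, c (Suc k), c' (2 * Suc k)} \<in> K"
          using link_prop[OF k] False even_prop[of "Suc k"] cV[of k] cV[of "Suc k"] k adj_sym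
          by (intro clique_in_K) auto
        then show ?thesis using link_prop[OF k] False by (simp add: insert_commute)
      qed
      then show ?thesis using 2 by simp
    qed
  qed
  have loop': "simplicial_loop (2 * n) c'"
    unfolding simplicial_loop_def
  proof (intro conjI allI impI)
    show "0 < 2 * n" using n by simp
    show "c' (2 * n) = c' 0"
      using even_c'[of n] even_c'[of 0] n by (auto simp: prv_def)
    show "{c' k, c' (Suc k)} \<in> K" if "k < 2 * n" for k
      by (rule K_sub[OF sq[OF that]]) auto
  qed
  have "d (c' i) y \<le> m" if i: "i \<le> 2 * n" for i
  proof -
    consider k where "i = 2 * k" "k \<le> n" | k where "i = Suc (2 * k)" "k < n"
    proof (cases "even i")
      case True
      then obtain k where "i = 2 * k" by (auto elim: evenE)
      then show ?thesis using that(1)[of k] i by simp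
    next
      case False
      then obtain k where "i = 2 * k + 1" by (auto elim: oddE)
      then show ?thesis using that(2)[of k] i by simp
    qed
    then show ?thesis using even_prop odd_prop by cases auto
  qed
  then have "free_homotopic (polygon (2 * n) c') (\<lambda>_. vertex_point y)" by (rule Suc.IH[OF loop'])
  moreover have "free_homotopic (polygon (2 * n) (\<lambda>i. c (i div 2))) (polygon (2 * n) c')"
    by (rule homotopic_parallel[OF c2 loop' sq])
  ultimately show ?case using homotopic_stutter(2)[OF Suc(2)] homotopic_with_trans by blast
qed

lemma simply_connected_realization: "simply_connected_top T"
  unfolding simply_connected_top_def
proof (intro allI impI)
  fix p q assume pq: "pathin T p \<and> p 1 = p 0 \<and> pathin T q \<and> q 1 = q 0"
  have "p 0 \<in> realization_carrier K" using pathin_carrier[of p 0] pq by simp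
  then obtain \<sigma> where "\<sigma> \<in> K" by (auto simp: realization_carrier_def)
  then obtain y where y: "y \<in> verts K" using K_nonempty[of \<sigma>] by (auto simp: verts_def)
  have "free_homotopic r (\<lambda>_. vertex_point y)" if r: "pathin T r" "r 1 = r 0" for r
  proof -
    obtain n c where c: "simplicial_loop n c" "free_homotopic r (polygon n c)"
      using loop_homotopic_polygon[OF r] by blast
    have "d (c i) y \<le> Max ((\<lambda>i. d (c i) y) ` {..n})" if "i \<le> n" for i
      using that by (intro Max_ge) auto
    then have "free_homotopic (polygon n c) (\<lambda>_. vertex_point y)" using polygon_contractible[OF y c(1)] by blast
    then show ?thesis using c(2) homotopic_with_trans by blast
  qed
  then show "free_homotopic p q" using pq homotopic_with_trans homotopic_with_symD by blast
qed

end

context simplicial_complex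
begin

text \<open>A free homotopy between constant loops at two points contains a path between the
  points.\<close>

lemma simply_connected_imp_connected:
  assumes "simply_connected_top T"
  shows "connected_space T"
proof (rule path_connected_imp_connected_space)
  show "path_connected_space T"
    unfolding path_connected_space_def
  proof (intro ballI)
    fix \<alpha> \<beta> assume ab: "\<alpha> \<in> topspace T" "\<beta> \<in> topspace T"
    have "pathin T (\<lambda>_::real. \<alpha>)" "pathin T (\<lambda>_::real. \<beta>)" using ab by (auto simp: pathin_def)
    then have "free_homotopic (\<lambda>_::real. \<alpha>) (\<lambda>_::real. \<beta>)" using assms unfolding simply_connected_top_def by simp
    then have "homotopic_with (\<lambda>_. True) (top_of_set {0..1::real}) T (\<lambda>_. \<alpha>) (\<lambda>_. \<beta>)"
      by (rule homotopic_with_mono) simp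
    then have "path_component_of T \<alpha> \<beta>" 
      using null_topspace_iff_trivial[of "top_of_set {0..1::real}"] by (simp add: homotopic_constant_maps)
    then show "\<exists>g. pathin T g \<and> g 0 = \<alpha> \<and> g 1 = \<beta>" by (simp add: path_component_of_def)
  qed
qed

end

section \<open>Simplicial grids from null-homotopies\<close>

context simplicial_complex
begin

text \<open>A simplicial approximation of a null-homotopy: \<open>i\<close> runs around the loop and
  \<open>j\<close> along the homotopy. Row 0 is the loop itself, slowed down by \<open>h\<close>, so
  a lift of the loop serves as a lift of row 0.\<close>

lemma loop_grid:
  assumes sc: "simply_connected_top T" and c: "simplicial_loop n c"
  obtains N J w h where "0 < N"
    and "\<And>i j. i < N \<Longrightarrow> j < J \<Longrightarrow> {w i j, w (Suc i) j, w i (Suc j), w (Suc i) (Suc j)} \<in> K"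
    and "\<And>j. j \<le> J \<Longrightarrow> w N j = w 0 j"
    and "\<And>i. i < N \<Longrightarrow> w (Suc i) J = w i J"
    and "\<And>i. i \<le> N \<Longrightarrow> w i 0 = c (h i) \<and> h i \<le> n" "h 0 = 0" "h N = n"
    and "\<And>i. i < N \<Longrightarrow> h (Suc i) = h i \<or> h (Suc i) = Suc (h i)"
proof -
  have n: "0 < n" "c n = c 0" using c by (auto simp: simplicial_loop_def)
  define S where "S = {0..1::real} \<times> {0..1::real}"
  have c0: "{c 0} \<in> K" using loop_vertex[OF c] by simp
  have "pathin T (\<lambda>_::real. vertex_point (c 0))"
    using carrier_I[OF c0 vertex_point_in] by (simp add: pathin_def topspace_realization)
  then have "free_homotopic (polygon n c) (\<lambda>_. vertex_point (c 0))"
    using sc pathin_polygon[OF c] polygon_closed[OF c] unfolding simply_connected_top_def by simp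
  then obtain H :: "real \<times> real \<Rightarrow> 'a \<Rightarrow> real"
    where H: "continuous_map (prod_topology (top_of_set {0..1}) (top_of_set {0..1})) T H"
      and H0: "\<forall>t. H (0, t) = polygon n c t" and H1: "\<forall>t. H (1, t) = vertex_point (c 0)"
      and H_seam: "\<forall>s\<in>{0..1}. H (s, 1) = H (s, 0)"
    unfolding homotopic_with_def by auto
  have HS: "continuous_map (top_of_set S) T H" using H by (simp add: S_def)
  have compS: "compact S" unfolding S_def by (intro compact_Times compact_Icc)
  have car: "H x \<in> realization_carrier K" if "x \<in> S" for x
    using HS that unfolding continuous_map topspace_realization by auto
  obtain \<delta> where d: "0 < \<delta>" "\<And>A. A \<subseteq> S \<Longrightarrow> diameter A < \<delta> \<Longrightarrow> \<exists>v. \<forall>x\<in>A. 0 < H x v"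
    using star_Lebesgue[OF compS HS] by blast
  obtain k :: nat where k: "4 / \<delta> < real k" using reals_Archimedean2 by blast
  have k0: "0 < k" using k d(1) by (metis divide_pos_pos less_trans of_nat_0_less_iff zero_less_numeral)
  \<comment> \<open>Since \<open>N\<close> is a multiple of \<open>n\<close>, every grid interval at
    time 0 lies in one edge of the polygon. A window \<open>W j i\<close> has diameter at most 4 /
    N, which the choice of \<open>k\<close> puts below \<delta>.\<close>
  define N where "N = n * k"
  have N: "0 < N" "k \<le> N" using n k0 by (auto simp: N_def)
  have "4 / \<delta> < real N" using k N(2) by (metis less_le_trans of_nat_le_iff)
  then have N4: "4 / real N < \<delta>" using d(1) N by (simp add: field_simps)
  define W where "W j i = {x\<in>S. \<bar>fst x - real j / real N\<bar> \<le> 1 / real N \<and> \<bar>snd x - real i / real N\<bar> \<le> 1 / real N}" for i j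
  have W_star: "\<exists>v. \<forall>x\<in>W j i. 0 < H x v" for i j
  proof (rule d(2))
    show "W j i \<subseteq> S" by (auto simp: W_def)
    have "diameter (W j i) \<le> 4 / real N"
    proof (rule diameter_le)
      show "norm (x - y) \<le> 4 / real N" if "x \<in> W j i" "y \<in> W j i" for x y
      proof -
        have "norm (x - y) \<le> \<bar>fst x - fst y\<bar> + \<bar>snd x - snd y\<bar>"
          using sqrt_sum_squares_le_sum_abs[of "fst x - fst y" "snd x - snd y"] by (simp add: norm_prod_def)
        moreover have "\<bar>fst x - fst y\<bar> \<le> 2 / real N" "\<bar>snd x - snd y\<bar> \<le> 2 / real N"
          using that by (auto simp: W_def)
        ultimately show ?thesis by simp
      qed
    qed (use N in auto)
    then show "diameter (W j i) < \<delta>" using N4 by simp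
  qed
  define v where "v i j = (SOME v. \<forall>x\<in>W j i. 0 < H x v)" for i j
  have v: "0 < H x (v i j)" if "x \<in> W j i" for i j x
    using someI_ex[OF W_star[of j i]] that by (simp add: v_def)
  have v_supp: "v i j \<in> supp (H x)" if "x \<in> W j i" for i j x using v[OF that] by (simp add: supp_def)
  \<comment> \<open>A grid point lies in the windows around all neighbouring nodes, so the vertices
    chosen at these nodes lie in one support and span a simplex.\<close>
  have pt: "(real j / real N, real i / real N) \<in> W j' i'"
    if "i \<le> N" "j \<le> N" "i \<le> Suc i'" "i' \<le> Suc i" "j \<le> Suc j'" "j' \<le> Suc j" for i j i' j'
  proof -
    have *: "\<bar>real a / real N - real b / real N\<bar> \<le> 1 / real N" if "a \<le> Suc b" "b \<le> Suc a" for a b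
    proof -
      have "\<bar>real a - real b\<bar> \<le> 1" using that by linarith
      then have "\<bar>real a - real b\<bar> / real N \<le> 1 / real N" by (simp add: divide_right_mono)
      then show ?thesis using N by (simp add: diff_divide_distrib[symmetric])
    qed
    show ?thesis using that N * by (auto simp: W_def S_def)
  qed
  have WS: "x \<in> S" if "x \<in> W j i" for x i j using that by (simp add: W_def)
  have simplexI: "A \<in> K" if "x \<in> S" "A \<subseteq> supp (H x)" "A \<noteq> {}" for x A
    using K_sub[OF carrier_supp(1)[OF car[OF that(1)]] that(2,3)] .
  \<comment> \<open>The choices \<open>v N j\<close> and \<open>v 0 j\<close> over the seam need not
    agree, so an extra column repeats column 0; an extra row at the start carries the loop, with
    \<open>min\<close> capping its index in the extra column.\<close>
  define w where "w i j = (case j of 0 \<Rightarrow> c (min n (i div k)) | Suc j' \<Rightarrow> v (if i = Suc N then 0 else i) j')" for i j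
  define h where "h i = min n (i div k)" for i
  have Nk: "N div k = n" "Suc N div k \<ge> n"
    using k0 div_le_mono[of N "Suc N" k] by (simp_all add: N_def)
  have v_seam: "v N j \<in> supp (H (real l / real N, 0))" "v 0 j \<in> supp (H (real l / real N, 0))"
    if "l \<le> N" "l \<le> Suc j" "j \<le> Suc l" for j l
  proof -
    have "H (real l / real N, 1) = H (real l / real N, 0)" using H_seam that N by auto
    then show "v N j \<in> supp (H (real l / real N, 0))"
      using v_supp[OF pt[of N l N j]] that N by simp
    show "v 0 j \<in> supp (H (real l / real N, 0))"
      using v_supp[OF pt[of 0 l 0 j]] that N by simp
  qed
  have S0: "(real l / real N, 0) \<in> S" if "l \<le> N" for l using that N by (auto simp: S_def)
  have sq: "{w i j, w (Suc i) j, w i (Suc j), w (Suc i) (Suc j)} \<in> K" if i: "i < Suc N" and j: "j < Suc N" for i j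
  proof (cases j)
    case (Suc l)
    then have l: "l < N" using j by simp
    show ?thesis
    proof (cases "i = N")
      case True
      have "{v N l, v 0 l, v N (Suc l), v 0 (Suc l)} \<in> K"
        by (rule simplexI[OF S0[of l]]) (use v_seam[of l l] v_seam[of l "Suc l"] l in auto)
      then show ?thesis using True Suc by (simp add: w_def)
    next
      case False
      then have i: "i < N" using i by simp
      have "{v i l, v (Suc i) l, v i (Suc l), v (Suc i) (Suc l)} \<in> K"
      proof (rule simplexI)
        show "(real l / real N, real i / real N) \<in> S" by (rule WS[OF pt[of i l i l]]) (use i l in simp_all)
        show "{v i l, v (Suc i) l, v i (Suc l), v (Suc i) (Suc l)} \<subseteq> supp (H (real l / real N, real i / real N))"
          using i l by (auto intro!: v_supp pt)
      qed simp
      then show ?thesis using i Suc by (simp add: w_def)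
    qed
  next
    case 0
    show ?thesis
    proof (cases "i = N")
      case True
      have "v N 0 \<in> supp (H (0, 0))" "v 0 0 \<in> supp (H (0, 0))" using v_seam[of 0 0] N by auto
      then have "v N 0 = c 0" "v 0 0 = c 0" using H0 polygon_0[OF n(1), of c] by auto
      then show ?thesis using True 0 Nk n c0 by (simp add: w_def min_absorb1)
    next
      case False
      then have i: "i < N" using i by simp
      define m where "m = i div k"
      have m: "m < n" using i k0 by (simp add: m_def N_def less_mult_imp_div_less)
      have hm: "h i = m" "h (Suc i) = m \<or> h (Suc i) = Suc m"
        using m div_Suc[of i k] by (auto simp: h_def m_def)
      have "m * k \<le> i" "i \<le> Suc m * k" using k0 by (auto simp: m_def dividend_less_times_div less_imp_le mult.commute)
      then have "real m * real k \<le> real i" "real i \<le> real (Suc m) * real k" by (metis of_nat_le_iff of_nat_mult)+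
      moreover have "real n * (real i / real N) = real i / real k" using n k0 by (simp add: N_def)
      ultimately have mi: "real m \<le> real n * (real i / real N)" "real n * (real i / real N) \<le> real (Suc m)"
        using k0 by (simp_all add: pos_le_divide_eq pos_divide_le_eq)
      \<comment> \<open>At time 0 the homotopy is the polygon, so the chosen vertices are ends of
        the edge carrying the point.\<close>
      have "supp (H (0, real i / real N)) \<subseteq> {c m, c (Suc m)}"
        using closed_simplex_supp[OF polygon_in[OF m mi, of c "{c m, c (Suc m)}"]] H0 by simp
      moreover have "v i 0 \<in> supp (H (0, real i / real N))" "v (Suc i) 0 \<in> supp (H (0, real i / real N))"
        using v_supp[OF pt[of i 0 i 0]] v_supp[OF pt[of i 0 "Suc i" 0]] i by auto
      moreover have e: "{c m, c (Suc m)} \<in> K" using c m by (auto simp: simplicial_loop_def)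
      moreover have "w i 0 \<in> {c m, c (Suc m)}" "w (Suc i) 0 \<in> {c m, c (Suc m)}"
        using hm by (auto simp: w_def h_def)
      moreover have "w i (Suc 0) = v i 0" "w (Suc i) (Suc 0) = v (Suc i) 0" using i by (auto simp: w_def)
      ultimately have "{w i 0, w (Suc i) 0, w i (Suc 0), w (Suc i) (Suc 0)} \<subseteq> {c m, c (Suc m)}"
        by auto
      from K_sub[OF e this] show ?thesis unfolding 0 by simp
    qed
  qed
  have top: "w i (Suc N) = c 0" if "i \<le> Suc N" for i
  proof -
    have "v i N = c 0" if "i \<le> N" for i
    proof -
      have "v i N \<in> supp (H (real N / real N, real i / real N))" by (rule v_supp[OF pt]) (use that in auto)
      then show ?thesis using H1 N by simp
    qed
    then show ?thesis using that by (simp add: w_def)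
  qed
  show ?thesis
  proof (rule that[of "Suc N" "Suc N" w h])
    show "w (Suc N) j = w 0 j" if "j \<le> Suc N" for j
      using Nk n by (auto simp: w_def min_absorb1 split: nat.splits)
    show "w i 0 = c (h i) \<and> h i \<le> n" for i by (simp add: w_def h_def)
    show "h 0 = 0" "h (Suc N) = n" using Nk by (auto simp: h_def)
    show "h (Suc i) = h i \<or> h (Suc i) = Suc (h i)" for i
      using div_Suc[of i k] by (auto simp: h_def)
  qed (use sq top in auto)
qed

end

section \<open>Filled triangles, short cycles and edge distances\<close>

definition filled :: "'a set set \<Rightarrow> 'a \<Rightarrow> 'a \<Rightarrow> 'a \<Rightarrow> bool" where
  "filled K a b c \<longleftrightarrow> distinct [a, b, c] \<and> {a, b, c} \<in> K"

lemma flag_complexD: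
  assumes "flag_complex K" "finite \<sigma>" "\<sigma> \<noteq> {}" "\<sigma> \<subseteq> verts K"
    and "\<forall>a\<in>\<sigma>. \<forall>b\<in>\<sigma>. a \<noteq> b \<longrightarrow> adjacent K a b"
  shows "\<sigma> \<in> K"
  using assms by (simp add: flag_complex_def)

lemma is_cycle_4: "is_cycle K [a, b, c, d] \<longleftrightarrow> distinct [a, b, c, d] \<and>
    adjacent K a b \<and> adjacent K b c \<and> adjacent K c d \<and> adjacent K d a"
  by (auto simp: is_cycle_def All_less_Suc)

lemma is_cycle_5: "is_cycle K [a, b, c, d, e] \<longleftrightarrow> distinct [a, b, c, d, e] \<and>
    adjacent K a b \<and> adjacent K b c \<and> adjacent K c d \<and> adjacent K d e \<and> adjacent K e a"
  by (auto simp: is_cycle_def All_less_Suc)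

lemma adjacent_commute: "adjacent K a b \<longleftrightarrow> adjacent K b a"
  by (auto simp: adjacent_def insert_commute)

lemma has_diagonal_4: "has_diagonal K [a, b, c, d] \<Longrightarrow> adjacent K a c \<or> adjacent K b d"
  using adjacent_commute[of K] by (auto simp: has_diagonal_def Ex_less_Suc)

lemma has_diagonal_5: "has_diagonal K [a, b, c, d, e] \<Longrightarrow>
    adjacent K a c \<or> adjacent K a d \<or> adjacent K b d \<or> adjacent K b e \<or> adjacent K c e"
  using adjacent_commute[of K] by (auto simp: has_diagonal_def Ex_less_Suc)

lemma gdist_edge_dist:
  assumes "a \<in> verts K" "b \<in> verts K" and K: "abstract_complex K" and "connected_graph (verts K) (adjacent K)"
  shows "edge_dist K a b = enat (gdist (adjacent K) a b)"
proof -
  interpret connected_graph "verts K" "adjacent K" by fact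
  have path: "(adjacent K ^^ (length p - 1)) (hd p) (last p)" if "p \<noteq> []" "successively (adjacent K) p" for p
    using that
  proof (induction p rule: induct_list012)
    case (3 x y zs)
    then have "(adjacent K ^^ length zs) y (last (y # zs))" "adjacent K x y" by auto
    then show ?case using relpowp_Suc_I2[of "adjacent K" x y] by auto
  qed auto
  have ex: "\<exists>p. edge_path K p \<and> hd p = x \<and> last p = b \<and> length p = Suc n" if "(adjacent K ^^ n) x b" "x \<in> verts K" for n x
    using that
  proof (induction n arbitrary: x)
    case 0
    then show ?case using assms(2) by (intro exI[of _ "[b]"]) (auto simp: edge_path_def)
  next
    case (Suc n)
    then obtain y where y: "adjacent K x y" "(adjacent K ^^ n) y b" by (metis relpowp_Suc_D2)
    then obtain p where p: "edge_path K p" "hd p = y" "last p = b" "length p = Suc n" using Suc.IH adj_V2 by blast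
    then show ?case using y Suc.prems(2)
      by (intro exI[of _ "x # p"]) (cases p; auto simp: edge_path_def)
  qed
  show ?thesis
  proof (rule antisym)
    obtain p where p: "edge_path K p \<and> hd p = a \<and> last p = b" "length p = Suc (d a b)"
      using ex[OF d_relpowp[OF assms(1,2)] assms(1)] by blast
    then show "edge_dist K a b \<le> enat (d a b)"
      unfolding edge_dist_def by (intro INF_lower2[of p]) auto
    show "enat (d a b) \<le> edge_dist K a b"
      unfolding edge_dist_def
    proof (rule INF_greatest)
      fix p assume "p \<in> {p. edge_path K p \<and> hd p = a \<and> last p = b}"
      then show "enat (d a b) \<le> enat (length p - 1)"
        using path[of p] d_le[of "length p - 1" a b] by (auto simp: edge_path_def)
    qed
  qed
qed

section \<open>Systolic complexes are weakly bridged\<close>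

text \<open>The stars of the vertices reachable from \<open>a\<close> and the stars of the others
  are open and cover the realization. A common point would have a support containing an edge between
  the two kinds.\<close>

lemma (in simplicial_complex) connected_graph_adjacent:
  assumes "connected_space T"
  shows "connected_graph (verts K) (adjacent K)"
proof
  show "adjacent K b a" if "adjacent K a b" for a b using that by (auto simp: adjacent_def insert_commute)
  show "\<not> adjacent K a a" for a by (simp add: adjacent_def)
  show "a \<in> verts K" if "adjacent K a b" for a b using that by (auto simp: adjacent_def verts_def)
  show "\<exists>n. (adjacent K ^^ n) a b" if ab: "a \<in> verts K" "b \<in> verts K" for a b
  proof (rule ccontr)
    assume no: "\<nexists>n. (adjacent K ^^ n) a b"
    define R where "R = {x. \<exists>n. (adjacent K ^^ n) a x}"
    define U where "U = (\<Union>v\<in>R. {\<alpha>\<in>realization_carrier K. 0 < \<alpha> v})"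
    define W where "W = (\<Union>v\<in>-R. {\<alpha>\<in>realization_carrier K. 0 < \<alpha> v})"
    have R_step: "y \<in> R" if "x \<in> R" "{x, y} \<in> K" for x y
    proof (cases "x = y")
      case False
      then have "adjacent K x y" using that by (simp add: adjacent_def)
      then show ?thesis using that(1) relpowp_Suc_I[of _ "adjacent K" a x y] unfolding R_def by blast
    qed (use that in simp)
    have "openin T U" "openin T W" unfolding U_def W_def using openin_star by blast+
    moreover have "topspace T \<subseteq> U \<union> W"
    proof
      fix \<alpha> assume a: "\<alpha> \<in> topspace T"
      then have c: "\<alpha> \<in> realization_carrier K" by (simp add: topspace_realization)
      then obtain v where "v \<in> supp \<alpha>" using carrier_supp(1) K_nonempty by blast
      then have "0 < \<alpha> v" using closed_simplex_pos[OF carrier_supp(2)[OF c]] by blast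
      then show "\<alpha> \<in> U \<union> W" using c by (auto simp: U_def W_def)
    qed
    moreover have "U \<inter> W = {}"
    proof (rule equals0I)
      fix \<alpha> assume a: "\<alpha> \<in> U \<inter> W"
      then obtain v w where vw: "v \<in> R" "w \<notin> R" "0 < \<alpha> v" "0 < \<alpha> w" and c: "\<alpha> \<in> realization_carrier K"
        by (auto simp: U_def W_def)
      have "{v, w} \<subseteq> supp \<alpha>" using vw by (auto simp: supp_def)
      then have "{v, w} \<in> K" using K_sub carrier_supp(1)[OF c] by blast
      then show False using R_step vw by blast
    qed
    moreover have "vertex_point a \<in> U"
    proof -
      have "a \<in> R" unfolding R_def by (auto intro: exI[of _ 0])
      moreover have "vertex_point a \<in> realization_carrier K"
        using carrier_I[OF _ vertex_point_in[of a "{a}"]] ab verts_iff by blast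
      ultimately show ?thesis by (auto simp: U_def vertex_point_def)
    qed
    moreover have "vertex_point b \<in> W"
    proof -
      have "b \<notin> R" using no by (simp add: R_def)
      moreover have "vertex_point b \<in> realization_carrier K"
        using carrier_I[OF _ vertex_point_in[of b "{b}"]] ab verts_iff by blast
      ultimately show ?thesis by (auto simp: W_def vertex_point_def)
    qed
    ultimately show False using assms unfolding connected_space_def by blast
  qed
qed

lemma (in simplicial_complex) adjacent_link:
  "adjacent (vertex_link K v) a b \<longleftrightarrow> filled K v a b"
proof
  assume "adjacent (vertex_link K v) a b"
  then show "filled K v a b" by (auto simp: adjacent_def vertex_link_def filled_def)
next
  assume a: "filled K v a b"
  then have "{a, b} \<in> K" using K_sub[of "{v, a, b}" "{a, b}"] by (auto simp: filled_def)
  then show "adjacent (vertex_link K v) a b" using a by (auto simp: adjacent_def vertex_link_def filled_def)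
qed

lemma (in simplicial_complex) six_large_links:
  assumes large: "\<And>v. v \<in> verts K \<Longrightarrow> large 6 (vertex_link K v)"
  shows "six_large_links (adjacent K) (filled K)"
proof -
  have v: "v \<in> verts K" if "filled K v a b" for v a b
    using that by (auto simp: filled_def verts_def)
  show ?thesis
  proof
    show "adjacent K b a" if "adjacent K a b" for a b using that by (auto simp: adjacent_def insert_commute)
    show "\<not> adjacent K a a" for a by (simp add: adjacent_def)
    show "filled K b a c" "filled K b c a" if "filled K a b c" for a b c
      using that by (auto simp: filled_def insert_commute)
    show "adjacent K a b" if "filled K a b c" for a b c
      using that K_sub[of "{a, b, c}" "{a, b}"] by (auto simp: filled_def adjacent_def)
    show "filled K a b c" if f: "filled K v a b" "filled K v b c" "filled K v a c" for v a b c
    proof -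
      have fl: "flag_complex (vertex_link K v)" using large[OF v[OF f(1)]] by (simp add: large_def)
      have adj: "adjacent (vertex_link K v) a b" "adjacent (vertex_link K v) b c" "adjacent (vertex_link K v) a c"
        using f adjacent_link by auto
      have "\<forall>x\<in>{a, b, c}. \<forall>y\<in>{a, b, c}. x \<noteq> y \<longrightarrow> adjacent (vertex_link K v) x y"
        using adj by (auto simp: adjacent_def insert_commute)
      moreover have "{a, b, c} \<subseteq> verts (vertex_link K v)"
        using adj by (auto simp: adjacent_def verts_def)
      ultimately have "{a, b, c} \<in> vertex_link K v" by (intro flag_complexD[OF fl]) auto
      then show ?thesis using f by (auto simp: vertex_link_def filled_def)
    qed
    have ne: "a \<noteq> b" if "filled K v a b" for v a b using that by (auto simp: filled_def)
    show "filled K v a c \<or> filled K v b d"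
      if f: "filled K v a b" "filled K v b c" "filled K v c d" "filled K v d a" "a \<noteq> c" "b \<noteq> d" for v a b c d
    proof -
      have "is_cycle (vertex_link K v) [a, b, c, d]"
        unfolding is_cycle_4 adjacent_link using f ne[OF f(1)] ne[OF f(2)] ne[OF f(3)] ne[OF f(4)] by auto
      then have "has_diagonal (vertex_link K v) [a, b, c, d]" using large[OF v[OF f(1)]] by (simp add: large_def)
      from has_diagonal_4[OF this] show ?thesis by (simp add: adjacent_link)
    qed
    show "filled K v a c \<or> filled K v a d \<or> filled K v b d \<or> filled K v b e \<or> filled K v c e"
      if f: "filled K v a b" "filled K v b c" "filled K v c d" "filled K v d e" "filled K v e a"
        "distinct [a, b, c, d, e]" for v a b c d e
    proof -
      have "is_cycle (vertex_link K v) [a, b, c, d, e]"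
        unfolding is_cycle_5 adjacent_link using f by blast
      then have "has_diagonal (vertex_link K v) [a, b, c, d, e]" using large[OF v[OF f(1)]] by (simp add: large_def)
      from has_diagonal_5[OF this] show ?thesis by (simp add: adjacent_link)
    qed
  qed
qed

text \<open>Simple connectivity enters here: the projected closed path bounds a grid, and its lift,
  slowed down in the same way as the path, closes up.\<close>

lemma (in simplicial_complex) closed_lifts:
  assumes sc: "simply_connected_top T" and "six_large_links (adjacent K) (filled K)"
    and cov: "six_large_links.geodesic_cover (adjacent K) (filled K) v M E"
    and v: "v \<in> verts K" and ab: "(E ^^ n) a b" "hd a = hd b"
  shows "a = b"
proof (cases "n = 0")
  case True
  then show ?thesis using ab by simp
next
  case False
  interpret L: six_large_links "adjacent K" "filled K" by fact
  note cov' = L.geodesic_coverD[OF cov]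
  obtain g where g: "g 0 = a" "g n = b" "\<And>i. i < n \<Longrightarrow> E (g i) (g (Suc i))"
    using ab(1) unfolding relpowp_fun_conv by blast
  have gM: "g i \<in> M" if i: "i \<le> n" for i
  proof (cases "i < n")
    case True
    then show ?thesis using g(3)[OF True] cov'(3) by blast
  next
    case f: False
    then obtain k where "i = Suc k" "k < n" using i f \<open>n \<noteq> 0\<close> by (cases i) auto
    then show ?thesis using g(3)[of k] cov'(3) by blast
  qed
  define c where "c i = hd (g i)" for i
  have "{c k, c (Suc k)} \<in> K" if "k < n" for k
    using cov'(3)[OF g(3)[OF that]] by (simp add: c_def adjacent_def)
  then have loop: "simplicial_loop n c" using False g ab by (simp add: simplicial_loop_def c_def)
  obtain N J w h where wh: "0 < N"
    "\<And>i j. i < N \<Longrightarrow> j < J \<Longrightarrow> {w i j, w (Suc i) j, w i (Suc j), w (Suc i) (Suc j)} \<in> K"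
    "\<And>j. j \<le> J \<Longrightarrow> w N j = w 0 j" "\<And>i. i < N \<Longrightarrow> w (Suc i) J = w i J"
    "\<And>i. i \<le> N \<Longrightarrow> w i 0 = c (h i) \<and> h i \<le> n" "h 0 = 0" "h N = n"
    "\<And>i. i < N \<Longrightarrow> h (Suc i) = h i \<or> h (Suc i) = Suc (h i)"
    by (rule loop_grid[OF sc loop]) (rule that)
  have "g (h N) = g (h 0)"
  proof (rule L.lift_grid_closed[OF cov _ _ _ wh(1-4)])
    show "adjacent K a b" if "{a, b} \<in> K" "a \<noteq> b" for a b using that by (simp add: adjacent_def)
    show "filled K a b c" if "{a, b, c} \<in> K" "distinct [a, b, c]" for a b c using that by (simp add: filled_def)
    show "t \<in> K" if "s \<in> K" "t \<subseteq> s" "t \<noteq> {}" for s t using K_sub that .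
    show "g (h i) = g (h (Suc i)) \<or> E (g (h i)) (g (h (Suc i)))" if "i < N" for i
      using wh(8)[OF that] wh(5)[of "Suc i"] that g(3)[of "h i"] by auto
    show "g (h i) \<in> M \<and> hd (g (h i)) = w i 0" if "i \<le> N" for i
      using wh(5)[OF that] gM by (simp add: c_def)
  qed
  then show ?thesis using wh g by simp
qed

lemma systolic_weakly_bridged:
  assumes "systolic K"
  shows "weakly_bridged_complex K"
proof -
  have K: "abstract_complex K" and sc: "simply_connected_top (realization K)"
    and cn: "connected_space (realization K)"
    and large: "\<And>v. v \<in> verts K \<Longrightarrow> large 6 (vertex_link K v)"
    using assms by (auto simp: systolic_def)
  interpret simplicial_complex K by unfold_locales fact
  interpret L: six_large_links "adjacent K" "filled K" by (rule six_large_links[OF large])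
  interpret connected_graph "verts K" "adjacent K" by (rule connected_graph_adjacent[OF cn])
  have cg: "connected_graph (verts K) (adjacent K)" by unfold_locales
  have TC: "\<exists>c. filled K c a b \<and> Suc (d c v) = d a v" if "v \<in> verts K" "adjacent K a b" "d a v = d b v" for v a b
  proof -
    obtain M E where cov: "L.geodesic_cover v M E" using L.ex_geodesic_cover by blast
    show ?thesis
      by (rule L.ball_structure(1)[OF cg that(1) cov _ that(2,3)])
        (rule closed_lifts[OF sc L.six_large_links_axioms cov that(1)])
  qed
  have IC: "a = b \<or> filled K m a b" if "v \<in> verts K" "adjacent K m a" "adjacent K m b"
      "Suc (d a v) = d m v" "Suc (d b v) = d m v" for v m a b
  proof -
    obtain M E where cov: "L.geodesic_cover v M E" using L.ex_geodesic_cover by blast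
    show ?thesis
      by (rule L.ball_structure(2)[OF cg that(1) cov _ that(2-5)])
        (rule closed_lifts[OF sc L.six_large_links_axioms cov that(1)])
  qed
  \<comment> \<open>Seen from \<open>a\<close>, the vertices \<open>b\<close> and \<open>c\<close>
    are at distance 1; the filled triangle from \<open>TC\<close> has its apex at distance 0, which
    is \<open>a\<close> itself.\<close>
  have tri: "filled K a b c" if abc: "adjacent K a b" "adjacent K b c" "adjacent K a c" for a b c
  proof -
    have V: "a \<in> verts K" "b \<in> verts K" "c \<in> verts K" using abc adj_V adj_V2 by auto
    have "d b a = 1" "d c a = 1" using abc d_adj adj_sym by auto
    then obtain e where e: "filled K e b c" "d e a = 0" using TC[OF V(1) abc(2)] by auto
    then have "e \<in> verts K" using L.T_A adj_V by blast
    then show ?thesis using d_0 V e by blast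
  qed
  show ?thesis
  proof (intro weakly_bridged_complex.intro weakly_bridged_complex_axioms.intro simplicial_complex_axioms)
    show "flag_complex K"
      unfolding flag_complex_def
    proof (intro conjI allI impI K, elim conjE)
      fix \<sigma> assume \<sigma>: "finite \<sigma>" "\<sigma> \<noteq> {}" "\<sigma> \<subseteq> verts K" "\<forall>a\<in>\<sigma>. \<forall>b\<in>\<sigma>. a \<noteq> b \<longrightarrow> adjacent K a b"
      then obtain v where v: "v \<in> \<sigma>" by blast
      show "\<sigma> \<in> K"
      proof (cases "\<sigma> = {v}")
        case True
        then show ?thesis using \<sigma> verts_iff by auto
      next
        case False
        \<comment> \<open>The simplex is sought as a cone over the remaining vertices: by
          \<open>tri\<close> they form a clique in the link of \<open>v\<close>, which is
          flag.\<close>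
        define \<tau> where "\<tau> = \<sigma> - {v}"
        have \<tau>: "\<tau> \<noteq> {}" "finite \<tau>" "insert v \<tau> = \<sigma>" "v \<notin> \<tau>" using \<sigma> v False by (auto simp: \<tau>_def)
        have fl: "flag_complex (vertex_link K v)" using large \<sigma> v by (auto simp: large_def)
        have "\<tau> \<subseteq> verts (vertex_link K v)"
        proof
          fix x assume x: "x \<in> \<tau>"
          then have "adjacent K v x" "x \<in> verts K" using \<sigma> v \<tau>_def by auto
          then have "{x} \<in> vertex_link K v" using verts_iff by (auto simp: vertex_link_def adjacent_def)
          then show "x \<in> verts (vertex_link K v)" by (auto simp: verts_def)
        qed
        moreover have "\<forall>a\<in>\<tau>. \<forall>b\<in>\<tau>. a \<noteq> b \<longrightarrow> adjacent (vertex_link K v) a b"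
        proof (intro ballI impI)
          fix a b assume "a \<in> \<tau>" "b \<in> \<tau>" "a \<noteq> b"
          then have "adjacent K v a" "adjacent K a b" "adjacent K v b" using \<sigma> v \<tau>_def by auto
          then show "adjacent (vertex_link K v) a b" using tri adjacent_link by blast
        qed
        ultimately have "\<tau> \<in> vertex_link K v" by (rule flag_complexD[OF fl \<tau>(2,1)])
        then show ?thesis using \<tau> by (simp add: vertex_link_def)
      qed
    qed
    show "weakly_bridged_graph (verts K) (adjacent K)"
    proof
      show "\<exists>c. adjacent K c a \<and> adjacent K c b \<and> Suc (d c y) = d a y"
        if "y \<in> verts K" "adjacent K a b" "d a y = d b y" for y a b
        using TC[OF that] L.T_A L.T_rot L.T_swap by metis
      show "a = b \<or> adjacent K a b"
        if "y \<in> verts K" "adjacent K m a" "adjacent K m b" "Suc (d a y) = d m y" "Suc (d b y) = d m y" for y m a b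
        using IC[OF that] L.T_A L.T_rot by metis
    qed
  qed
qed

section \<open>Invariance sets\<close>

lemma triangle_gen_involution:
  "triangle_gen j x \<in> carrier (triangle_group j)"
  "triangle_gen j x \<otimes>\<^bsub>triangle_group j\<^esub> triangle_gen j x = \<one>\<^bsub>triangle_group j\<^esub>"
proof -
  let ?R = "triangle_relators j"
  show "triangle_gen j x \<in> carrier (triangle_group j)"
    by (simp add: triangle_gen_def triangle_group_def presented_group_def)
  have "[(x, True), (x, True)] \<in> ?R"
    by (cases x) (auto simp: triangle_relators_def word_power_def numeral_2_eq_2 Let_def)
  then have "pres_eq ?R [(x, True), (x, True)] []" using pres_rel[of "[(x, True), (x, True)]" ?R "[]" "[]"] by simp
  then show "triangle_gen j x \<otimes>\<^bsub>triangle_group j\<^esub> triangle_gen j x = \<one>\<^bsub>triangle_group j\<^esub>"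
    unfolding triangle_group_def triangle_gen_def presented_group_mult
    by (simp add: presented_group_def word_class_eq_iff)
qed

locale simplicial_involution = weakly_bridged_complex X for X :: "'a set set" +
  fixes f :: "'a \<Rightarrow> 'a"
  assumes f_inv: "x \<in> verts X \<Longrightarrow> f (f x) = x"
    and f_simplex: "\<sigma> \<in> X \<Longrightarrow> f ` \<sigma> \<in> X"
begin

lemma f_V: "x \<in> verts X \<Longrightarrow> f x \<in> verts X"
  using f_simplex[of "{x}"] verts_iff by simp

sublocale weakly_bridged_involution "verts X" "adjacent X" f
proof
  show "f (f x) = x" if "x \<in> verts X" for x by (rule f_inv[OF that])
  show "f x \<in> verts X" if "x \<in> verts X" for x by (rule f_V[OF that])
  show "adjacent X (f a) (f b)" if "adjacent X a b" for a b
  proof -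
    have "a \<in> verts X" "b \<in> verts X" using that adj_V adj_V2 by auto
    then have "f a \<noteq> f b" using f_inv that by (metis adjacent_def)
    then show ?thesis using f_simplex[of "{a, b}"] that by (simp add: adjacent_def)
  qed
qed

definition XI where
  "XI = {\<sigma>. finite \<sigma> \<and> \<sigma> \<noteq> {} \<and> \<sigma> \<subseteq> I \<and> (\<forall>a\<in>\<sigma>. \<forall>b\<in>\<sigma>. a \<noteq> b \<longrightarrow> adjacent X a b)}"

lemma XI_iff: "\<sigma> \<in> XI \<longleftrightarrow> \<sigma> \<in> X \<and> \<sigma> \<subseteq> I"
proof
  assume s: "\<sigma> \<in> XI"
  then have "\<sigma> \<in> X" using I_V by (intro clique_in_K) (auto simp: XI_def)
  then show "\<sigma> \<in> X \<and> \<sigma> \<subseteq> I" using s by (simp add: XI_def)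
next
  assume s: "\<sigma> \<in> X \<and> \<sigma> \<subseteq> I"
  then have "adjacent X a b" if "a \<in> \<sigma>" "b \<in> \<sigma>" "a \<noteq> b" for a b
    using that K_sub[of \<sigma> "{a, b}"] by (auto simp: adjacent_def)
  then show "\<sigma> \<in> XI" using s K_finite K_nonempty by (auto simp: XI_def)
qed

lemma verts_XI: "verts XI = I"
proof
  show "verts XI \<subseteq> I" using XI_iff by (auto simp: verts_def)
  show "I \<subseteq> verts XI" using XI_iff[of "{_}"] I_V verts_iff by (auto simp: verts_def)
qed

lemma adjacent_XI: "adjacent XI = AI"
  by (auto simp: fun_eq_iff adjacent_def AI_def XI_iff)

lemma XI_complex: "abstract_complex XI"
  unfolding abstract_complex_def using XI_iff K_finite K_nonempty K_sub by (meson order_trans)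

lemma XI_full: "full_subcomplex XI X"
  using XI_complex verts_XI by (auto simp: full_subcomplex_def subcomplex_def XI_iff)

lemma XI_flag: "flag_complex XI"
  unfolding flag_complex_def
proof (intro conjI allI impI XI_complex, elim conjE)
  fix \<sigma> assume s: "finite \<sigma>" "\<sigma> \<noteq> {}" "\<sigma> \<subseteq> verts XI" "\<forall>a\<in>\<sigma>. \<forall>b\<in>\<sigma>. a \<noteq> b \<longrightarrow> adjacent XI a b"
  have "\<sigma> \<subseteq> I" using s(3) by (simp add: verts_XI)
  moreover have "\<forall>a\<in>\<sigma>. \<forall>b\<in>\<sigma>. a \<noteq> b \<longrightarrow> adjacent X a b"
    using s(4) by (simp add: adjacent_XI AI_def)
  ultimately show "\<sigma> \<in> XI" using s(1,2) by (simp add: XI_def)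
qed

lemma XI_bridged: "weakly_bridged_complex XI"
  by (intro weakly_bridged_complex.intro simplicial_complex.intro weakly_bridged_complex_axioms.intro XI_complex XI_flag)
    (simp add: verts_XI adjacent_XI bridged_I)

lemma XI_isometric: "isometrically_embedded XI X"
  unfolding isometrically_embedded_def
proof (intro conjI ballI)
  show "subcomplex XI X" using XI_full by (simp add: full_subcomplex_def)
  fix a b assume ab: "a \<in> verts XI" "b \<in> verts XI"
  interpret Y: weakly_bridged_complex XI by (rule XI_bridged)
  have "edge_dist XI a b = enat (gdist AI a b)"
    using gdist_edge_dist[OF ab XI_complex Y.connected_graph_axioms] by (simp add: adjacent_XI)
  moreover have "edge_dist X a b = enat (gdist (adjacent X) a b)"
    using gdist_edge_dist[OF _ _ K connected_graph_axioms] ab I_V by (simp add: verts_XI)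
  ultimately show "edge_dist XI a b = edge_dist X a b" using gdist_AI ab by (simp add: verts_XI)
qed

text \<open>The link in \<open>XI\<close> is the part of the link in \<open>X\<close> spanned by
  \<open>I\<close>. A diagonal joins two vertices of the cycle, so it stays inside.\<close>

lemma XI_large:
  assumes v: "v \<in> I" and large: "large 6 (vertex_link X v)"
  shows "large 6 (vertex_link XI v)"
proof -
  let ?L = "vertex_link X v" and ?M = "vertex_link XI v"
  have M: "\<sigma> \<in> ?M \<longleftrightarrow> \<sigma> \<in> ?L \<and> \<sigma> \<subseteq> I" for \<sigma>
    using v by (auto simp: vertex_link_def XI_iff)
  have adj: "adjacent ?M a b \<longleftrightarrow> adjacent ?L a b \<and> a \<in> I \<and> b \<in> I" for a b
    by (auto simp: adjacent_def M)
  have fl: "flag_complex ?L" and cyc: "\<And>c. is_cycle ?L c \<Longrightarrow> 4 \<le> length c \<Longrightarrow> length c < 6 \<Longrightarrow> has_diagonal ?L c"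
    using large by (auto simp: large_def)
  have "abstract_complex ?M"
    using fl M unfolding flag_complex_def abstract_complex_def by (meson order_trans)
  moreover have "\<sigma> \<in> ?M" if "finite \<sigma>" "\<sigma> \<noteq> {}" "\<sigma> \<subseteq> verts ?M" "\<forall>a\<in>\<sigma>. \<forall>b\<in>\<sigma>. a \<noteq> b \<longrightarrow> adjacent ?M a b" for \<sigma>
  proof -
    have "verts ?M \<subseteq> verts ?L \<inter> I" using M by (auto simp: verts_def)
    then have sub: "\<sigma> \<subseteq> verts ?L" "\<sigma> \<subseteq> I" using that(3) by blast+
    then have "\<sigma> \<in> ?L" using flag_complexD[OF fl that(1,2) sub(1)] that(4) adj by blast
    then show ?thesis using M sub by blast
  qed
  moreover have "has_diagonal ?M c" if c: "is_cycle ?M c" "4 \<le> length c" "length c < 6" for c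
  proof -
    have "is_cycle ?L c" using c(1) adj by (auto simp: is_cycle_def)
    then obtain i k where ik: "i < length c" "k < length c" "i \<noteq> k" "k \<noteq> Suc i mod length c" "i \<noteq> Suc k mod length c"
      "adjacent ?L (c ! i) (c ! k)" using cyc c unfolding has_diagonal_def by blast
    have "c ! i \<in> I" if "i < length c" for i using c(1) that adj by (auto simp: is_cycle_def)
    then show ?thesis unfolding has_diagonal_def using ik adj by blast
  qed
  ultimately show ?thesis unfolding large_def flag_complex_def by simp
qed

text \<open>By \<open>I_squares\<close> a clique in \<open>I\<close> together with its image is
  again a clique in \<open>I\<close>, so maximality puts the image inside; injectivity and
  finiteness give equality.\<close>

lemma XI_maximal:
  assumes "maximal_simplex XI \<sigma>"
  shows "f ` \<sigma> = \<sigma>"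
proof -
  have s: "\<sigma> \<in> XI" and max: "\<And>\<tau>. \<tau> \<in> XI \<Longrightarrow> \<sigma> \<subseteq> \<tau> \<Longrightarrow> \<tau> = \<sigma>"
    using assms by (auto simp: maximal_simplex_def)
  have sI: "\<sigma> \<subseteq> I" and fin: "finite \<sigma>" and ne: "\<sigma> \<noteq> {}"
    and adj: "\<And>a b. a \<in> \<sigma> \<Longrightarrow> b \<in> \<sigma> \<Longrightarrow> a \<noteq> b \<Longrightarrow> adjacent X a b"
    using s by (auto simp: XI_def)
  have fI: "f ` \<sigma> \<subseteq> I" using sI u_in_I by blast
  have 1: "adjacent X (f a) b" if "a \<in> \<sigma>" "b \<in> \<sigma>" "f a \<noteq> b" for a b
  proof (cases "a = b")
    case True
    then show ?thesis using that sI by (auto simp: I_def)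
  next
    case False
    then show ?thesis using I_squares[of a b] adj that sI by blast
  qed
  have 2: "adjacent X (f a) (f b)" if "a \<in> \<sigma>" "b \<in> \<sigma>" "f a \<noteq> f b" for a b
    using adj[of a b] u_adj that by blast
  have "\<sigma> \<union> f ` \<sigma> \<in> XI"
    using sI fI fin ne adj 1 2 adj_sym unfolding XI_def by (auto; metis)
  then have "f ` \<sigma> \<subseteq> \<sigma>" using max by blast
  moreover have "inj_on f \<sigma>" using sI I_V f_inv by (metis inj_onI subsetD)
  ultimately show ?thesis using fin by (metis endo_inj_surj)
qed

end

theorem proposition3p6:
  fixes X :: "'a set set" and j :: nat
    and \<phi> :: "gen word set \<Rightarrow> 'a \<Rightarrow> 'a" and u :: "gen word set"
  assumes "j \<in> {4, 5}"
    and "systolic X"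
    and "simplicial_action (triangle_group j) X \<phi>"
    and "u \<in> {triangle_gen j Gen_r, triangle_gen j Gen_s, triangle_gen j Gen_t}"
  shows "systolic (invariance_set X \<phi> u) \<and>
    isometrically_embedded (invariance_set X \<phi> u) X \<and>
    full_subcomplex (invariance_set X \<phi> u) X \<and>
    (\<forall>\<sigma>. maximal_simplex (invariance_set X \<phi> u) \<sigma> \<longrightarrow> \<phi> u ` \<sigma> = \<sigma>)"
proof -
  let ?G = "triangle_group j"
  interpret weakly_bridged_complex X by (rule systolic_weakly_bridged[OF assms(2)])
  have u: "u \<in> carrier ?G" "u \<otimes>\<^bsub>?G\<^esub> u = \<one>\<^bsub>?G\<^esub>"
    using assms(4) triangle_gen_involution by auto
  interpret A: group_action ?G "verts X" \<phi>
    using assms(3) by (simp add: simplicial_action_def)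
  interpret simplicial_involution X "\<phi> u"
  proof
    show "\<phi> u (\<phi> u x) = x" if "x \<in> verts X" for x
      using A.composition_rule[OF that u(1) u(1)] A.id_eq_one u(2) that by (metis restrict_apply')
    show "\<phi> u ` \<sigma> \<in> X" if "\<sigma> \<in> X" for \<sigma>
      using assms(3) u(1) that by (simp add: simplicial_action_def)
  qed
  have XI: "invariance_set X \<phi> u = XI"
    by (simp add: invariance_set_def XI_def invariance_verts_def I_def)
  interpret Y: weakly_bridged_complex XI by (rule XI_bridged)
  have "XI \<noteq> {}"
  proof -
    have "verts X \<noteq> {}" using assms(2) K_nonempty by (auto simp: systolic_def verts_def)
    then obtain x where "x \<in> I" using I_nonempty by blast
    then have "{x} \<in> XI" using XI_iff I_V verts_iff by auto
    then show ?thesis by blast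
  qed
  moreover have "large 6 (vertex_link XI v)" if "v \<in> verts XI" for v
    using XI_large[of v] that verts_XI I_V assms(2) by (auto simp: systolic_def)
  ultimately have "systolic XI"
    using XI_complex Y.simply_connected_realization Y.simply_connected_imp_connected
    by (simp add: systolic_def)
  then show ?thesis unfolding XI using XI_isometric XI_full XI_maximal by blast
qed

end
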